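(* Let $\mathbf{s}\in\mathbb{R}^j$. Let $K\subset\mathbb{R}^n$ be a compact subset such that $(K-K)\cap\mathbb{Z}^n=\{0\}$, and let $\{u_\gamma\}_{\gamma\in\mathbb{Z}^n}$ be a family of elements of $\mathcal{H}^{\mathbf{s}}(\mathbb{R}^n)\cap\mathcal{D}'_K(\mathbb{R}^n)$. Put $$u=\sum_{\gamma\in\mathbb{Z}^n}\tau_\gamma u_\gamma=\sum_{\gamma\in\mathbb{Z}^n}u_\gamma(\cdot-\gamma)\in\mathcal{D}'(\mathbb{R}^n).$$ Then the following statements are equivalent: (a) $u\in\mathcal{H}^{\mathbf{s}}(\mathbb{R}^n)$. (b) $\sum_{\gamma\in\mathbb{Z}^n}\|u_\gamma\|^2_{\mathcal{H}^{\mathbf{s}}}<\infty$. Moreover, there is $C\ge1$, which does not depend on the family $\{u_\gamma\}_{\gamma\in\mathbb{Z}^n}$, such that $$C^{-1}\|u\|_{\mathcal{H}^{\mathbf{s}}}\le\Big(\sum_{\gamma\in\mathbb{Z}^n}\|u_\gamma\|^2_{\mathcal{H}^{\mathbf{s}}}\Big)^{1/2}\le C\|u\|_{\mathcal{H}^{\mathbf{s}}}.$$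
   Context: Fix $j\in\{1,\dots,n\}$ and a decomposition $\mathbb{R}^n=\mathbb{R}^{n_1}\times\dots\times\mathbb{R}^{n_j}$ with $n_1,\dots,n_j\ge1$; write $\xi=(\xi_1,\dots,\xi_j)$ accordingly. For $\mathbf{s}=(s_1,\dots,s_j)\in\mathbb{R}^j$ put $\langle\langle\xi\rangle\rangle^{\mathbf{s}}=\prod_{l=1}^j(1+|\xi_l|^2)^{s_l/2}$ and $\mathcal{H}^{\mathbf{s}}(\mathbb{R}^n)=\{u\in\mathcal{S}'(\mathbb{R}^n):\langle\langle D\rangle\rangle^{\mathbf{s}}u\in L^2(\mathbb{R}^n)\}$, $\|u\|_{\mathcal{H}^{\mathbf{s}}}=\|\langle\langle D\rangle\rangle^{\mathbf{s}}u\|_{L^2}$, where $\langle\langle D\rangle\rangle^{\mathbf{s}}$ is the Fourier multiplier with symbol $\langle\langle\xi\rangle\rangle^{\mathbf{s}}$; set $\|u\|_{\mathcal{H}^{\mathbf{s}}}=+\infty$ if $u\in\mathcal{D}'(\mathbb{R}^n)$ is not in $\mathcal{H}^{\mathbf{s}}$. $\mathcal{D}'_K(\mathbb{R}^n)$ is the set of distributions on $\mathbb{R}^n$ supported in $K$, and $\tau_\gamma u=u(\cdot-\gamma)$ is translation by $\gamma$. The series defining $u$ is locally finite. *)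

theory Defs
  imports "HOL-Analysis.Analysis"
begin

section \<open>Smooth functions, test functions, Schwartz functions\<close>

text \<open>\<open>partials [i\<^sub>1, \<dots>, i\<^sub>k] f\<close> is the iterated partial derivative of order \<open>k\<close> in the
  coordinate directions \<open>i\<^sub>1, \<dots>, i\<^sub>k\<close>; lists of coordinates play the role of multi-indices.\<close>

primrec partials :: "'n::finite list \<Rightarrow> (real^'n \<Rightarrow> complex) \<Rightarrow> real^'n \<Rightarrow> complex" where
  "partials [] f = f"
| "partials (i # is) f = (\<lambda>x. frechet_derivative (partials is f) (at x) (axis i 1))"

definition smooth :: "(real^'n::finite \<Rightarrow> complex) \<Rightarrow> bool" where
  "smooth f \<longleftrightarrow> (\<forall>is x. partials is f differentiable (at x))"

definition fun_support :: "(real^'n::finite \<Rightarrow> complex) \<Rightarrow> (real^'n) set" where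
  "fun_support \<phi> = closure {x. \<phi> x \<noteq> 0}"

definition test_functions :: "(real^'n::finite \<Rightarrow> complex) set" where
  "test_functions = {\<phi>. smooth \<phi> \<and> compact (fun_support \<phi>)}"

definition schwartz :: "(real^'n::finite \<Rightarrow> complex) set" where
  "schwartz = {\<phi>. smooth \<phi> \<and>
     (\<forall>k is. bounded (range (\<lambda>x. (1 + norm x) ^ k * norm (partials is \<phi> x))))}"

text \<open>The seminorms defining the topologies of \<open>\<D>\<close> (with \<open>k = 0\<close>) and \<open>\<S>\<close>. The
  suprema are over bounded sets of reals when \<open>\<phi>\<close> is a test function or a Schwartz function.\<close>

definition seminorm :: "nat \<Rightarrow> nat \<Rightarrow> (real^'n::finite \<Rightarrow> complex) \<Rightarrow> real" where
  "seminorm k N \<phi> =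
     (\<Sum>is | length is \<le> N. SUP x. (1 + norm x) ^ k * norm (partials is \<phi> x))"


section \<open>Distributions and tempered distributions\<close>

text \<open>A distribution is represented by a total functional of which only the values on test
  functions (for tempered distributions: on Schwartz functions) are meaningful.\<close>

type_synonym 'n functional = "(real^'n \<Rightarrow> complex) \<Rightarrow> complex"

definition linear_functional_on :: "(real^'n::finite \<Rightarrow> complex) set \<Rightarrow> 'n functional \<Rightarrow> bool" where
  "linear_functional_on A u \<longleftrightarrow>
     (\<forall>\<phi>\<in>A. \<forall>\<psi>\<in>A. u (\<lambda>x. \<phi> x + \<psi> x) = u \<phi> + u \<psi>) \<and>
     (\<forall>\<phi>\<in>A. \<forall>c. u (\<lambda>x. c * \<phi> x) = c * u \<phi>)"

definition distributions :: "'n::finite functional set" where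
  "distributions = {u. linear_functional_on test_functions u \<and>
     (\<forall>Q. compact Q \<longrightarrow> (\<exists>C N. \<forall>\<phi>\<in>test_functions.
        fun_support \<phi> \<subseteq> Q \<longrightarrow> norm (u \<phi>) \<le> C * seminorm 0 N \<phi>))}"

definition tempered_distributions :: "'n::finite functional set" where
  "tempered_distributions = {T. linear_functional_on schwartz T \<and>
     (\<exists>C k N. \<forall>\<phi>\<in>schwartz. norm (T \<phi>) \<le> C * seminorm k N \<phi>)}"

definition dist_support :: "'n::finite functional \<Rightarrow> (real^'n) set" where
  "dist_support u = - \<Union>{U. open U \<and> (\<forall>\<phi>\<in>test_functions. fun_support \<phi> \<subseteq> U \<longrightarrow> u \<phi> = 0)}"

definition distributions_in :: "(real^'n::finite) set \<Rightarrow> 'n functional set" where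
  "distributions_in K = {u \<in> distributions. dist_support u \<subseteq> K}"

text \<open>\<open>(\<tau>\<^sub>\<gamma> u)(\<phi>) = u(\<phi>(\<cdot> + \<gamma>))\<close>, which extends \<open>\<tau>\<^sub>\<gamma> f = f(\<cdot> - \<gamma>)\<close> from functions.\<close>

definition translate :: "real^'n::finite \<Rightarrow> 'n functional \<Rightarrow> 'n functional" where
  "translate \<gamma> u = (\<lambda>\<phi>. u (\<lambda>x. \<phi> (x + \<gamma>)))"


section \<open>Fourier multipliers\<close>

text \<open>The normalisation is the one for which \<open>D = -i\<partial>\<close> is the multiplier with symbol \<open>\<xi>\<close>.\<close>

definition fourier :: "(real^'n::finite \<Rightarrow> complex) \<Rightarrow> real^'n \<Rightarrow> complex" where
  "fourier \<phi> = (\<lambda>\<xi>. LINT x|lborel. exp (- \<i> * of_real (x \<bullet> \<xi>)) * \<phi> x)"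

definition inverse_fourier :: "(real^'n::finite \<Rightarrow> complex) \<Rightarrow> real^'n \<Rightarrow> complex" where
  "inverse_fourier \<phi> = (\<lambda>x. of_real (1 / (2 * pi) ^ CARD('n)) *
     (LINT \<xi>|lborel. exp (\<i> * of_real (x \<bullet> \<xi>)) * \<phi> \<xi>))"

text \<open>On tempered distributions, all three operations are defined by transposition.\<close>

definition fourier_dist :: "'n::finite functional \<Rightarrow> 'n functional" where
  "fourier_dist T = (\<lambda>\<phi>. T (fourier \<phi>))"

definition inverse_fourier_dist :: "'n::finite functional \<Rightarrow> 'n functional" where
  "inverse_fourier_dist T = (\<lambda>\<phi>. T (inverse_fourier \<phi>))"

definition mult_dist :: "(real^'n::finite \<Rightarrow> complex) \<Rightarrow> 'n functional \<Rightarrow> 'n functional" where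
  "mult_dist m T = (\<lambda>\<phi>. T (\<lambda>\<xi>. m \<xi> * \<phi> \<xi>))"

definition fourier_multiplier :: "(real^'n::finite \<Rightarrow> complex) \<Rightarrow> 'n functional \<Rightarrow> 'n functional" where
  "fourier_multiplier m T = inverse_fourier_dist (mult_dist m (fourier_dist T))"


section \<open>Square-integrable functions as tempered distributions\<close>

definition ennreal_sqrt :: "ennreal \<Rightarrow> ennreal" where
  "ennreal_sqrt a = (if a = \<infinity> then \<infinity> else ennreal (sqrt (enn2real a)))"

definition L2_norm :: "(real^'n::finite \<Rightarrow> complex) \<Rightarrow> ennreal" where
  "L2_norm g = ennreal_sqrt (\<integral>\<^sup>+x. ennreal ((norm (g x))\<^sup>2) \<partial>lborel)"

definition L2_functions :: "(real^'n::finite \<Rightarrow> complex) set" where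
  "L2_functions = {g \<in> borel_measurable lborel. L2_norm g < \<infinity>}"

definition represents :: "(real^'n::finite \<Rightarrow> complex) \<Rightarrow> 'n functional \<Rightarrow> bool" where
  "represents g T \<longleftrightarrow> (\<forall>\<phi>\<in>schwartz. T \<phi> = (LINT x|lborel. g x * \<phi> x))"


section \<open>The spaces \<open>\<H>\<^sup>s\<close>\<close>

text \<open>The decomposition of \<open>\<real>\<^sup>n\<close> into blocks is given by a map \<open>b\<close> sending each coordinate to
  the index of its block: \<open>\<xi>\<^sub>l\<close> consists of the coordinates \<open>\<xi> $ i\<close> with \<open>b i = l\<close>, and
  \<open>n\<^sub>l \<ge> 1\<close> for all \<open>l\<close> means that \<open>b\<close> is surjective.\<close>

definition bracket :: "('n::finite \<Rightarrow> 'j::finite) \<Rightarrow> real^'j \<Rightarrow> real^'n \<Rightarrow> real" where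
  "bracket b s \<xi> = (\<Prod>l\<in>UNIV. (1 + (\<Sum>i | b i = l. (\<xi> $ i)\<^sup>2)) powr (s $ l / 2))"

definition bracket_D :: "('n::finite \<Rightarrow> 'j::finite) \<Rightarrow> real^'j \<Rightarrow> 'n functional \<Rightarrow> 'n functional" where
  "bracket_D b s = fourier_multiplier (\<lambda>\<xi>. complex_of_real (bracket b s \<xi>))"

text \<open>A distribution \<open>u\<close> is tempered if it extends to a tempered distribution \<open>T\<close>; the values of
  \<open>T\<close> on Schwartz functions are then determined by \<open>u\<close>, as test functions are dense in \<open>\<S>\<close>.\<close>

definition tempered_extension :: "'n::finite functional \<Rightarrow> 'n functional \<Rightarrow> bool" where
  "tempered_extension u T \<longleftrightarrow> T \<in> tempered_distributions \<and> (\<forall>\<phi>\<in>test_functions. T \<phi> = u \<phi>)"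

text \<open>\<open>H_density b s u g\<close> says that \<open>u\<close> is in \<open>\<H>\<^sup>s\<close> and \<open>g\<close> is the \<open>L\<^sup>2\<close> function
  \<open>\<langle>\<langle>D\<rangle>\<rangle>\<^sup>s u\<close>, which is unique up to null sets.\<close>

definition H_density ::
    "('n::finite \<Rightarrow> 'j::finite) \<Rightarrow> real^'j \<Rightarrow> 'n functional \<Rightarrow> (real^'n \<Rightarrow> complex) \<Rightarrow> bool" where
  "H_density b s u g \<longleftrightarrow> u \<in> distributions \<and> g \<in> L2_functions \<and>
     (\<exists>T. tempered_extension u T \<and> represents g (bracket_D b s T))"

definition H_space :: "('n::finite \<Rightarrow> 'j::finite) \<Rightarrow> real^'j \<Rightarrow> 'n functional set" where
  "H_space b s = {u. \<exists>g. H_density b s u g}"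

definition H_norm :: "('n::finite \<Rightarrow> 'j::finite) \<Rightarrow> real^'j \<Rightarrow> 'n functional \<Rightarrow> ennreal" where
  "H_norm b s u = (if u \<in> H_space b s then L2_norm (SOME g. H_density b s u g) else \<infinity>)"


section \<open>Sums over the integer lattice\<close>

definition int_lattice :: "(real^'n::finite) set" where
  "int_lattice = {x. \<forall>i. x $ i \<in> \<int>}"

text \<open>The series is taken in the weak sense; when all \<open>v \<gamma>\<close> are supported in one bounded set,
  only finitely many terms are nonzero on a given test function.\<close>

definition lattice_series :: "(real^'n::finite \<Rightarrow> 'n functional) \<Rightarrow> 'n functional" where
  "lattice_series v = (\<lambda>\<phi>. \<Sum>\<^sub>\<infinity>\<gamma>\<in>int_lattice. translate \<gamma> (v \<gamma>) \<phi>)"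

end

theory Submission
  imports Defs "HOL-Probability.Characteristic_Functions" "HOL-Probability.Sinc_Integral"
begin

text \<open>
  The norm of \<open>\<H>\<^sup>s\<close> is a dual norm. Write \<open>N\<^sub>t(\<phi>) = \<parallel>\<langle>\<langle>D\<rangle>\<rangle>\<^sup>t \<phi>\<parallel>\<close> for a Schwartz function \<open>\<phi>\<close>. A distribution \<open>u\<close>
  belongs to \<open>\<H>\<^sup>s\<close> with norm at most \<open>A\<close> if and only if \<open>|u(\<psi>)| \<le> A N\<^sub>-\<^sub>s(\<psi>)\<close> for all test functions
  \<open>\<psi>\<close> (lemmas \<open>H_norm_bound\<close> and \<open>H_norm_leI\<close>). One direction is the Cauchy--Schwarz inequality, the
  other is the Riesz representation theorem, together with the density of test functions, which
  makes the representing function unique. Everything is thereby reduced to inequalities for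
  \<open>N\<^sub>t\<close> on Schwartz functions.

  The inequality that carries the proof is \<open>localisation_inequality\<close>,
  \<open>\<integral> N\<^sub>t(\<chi>(\<cdot> + y) \<phi>)\<^sup>2 dy \<le> C N\<^sub>t(\<phi>)\<^sup>2\<close>. For a fixed frequency \<open>\<xi>\<close>, the transform of \<open>\<chi>(\<cdot> + y) \<phi>\<close> at \<open>\<xi>\<close> is,
  as a function of \<open>y\<close>, a Fourier transform. Plancherel's theorem in \<open>y\<close> thus evaluates the
  integral, and Peetre's inequality compares the weights. The inequality concerns all translations,
  where Plancherel's theorem on \<open>\<real>\<^sup>n\<close> is available. One passes to the lattice by averaging: the
  translates by lattice points of a small ball are disjoint, so some \<open>y\<close> in the ball satisfies
  \<open>\<Sum>\<^sub>\<gamma> N\<^sub>t(\<chi>(\<cdot> + y) \<phi>(\<cdot> + \<gamma>))\<^sup>2 \<le> C N\<^sub>t(\<phi>)\<^sup>2\<close> (\<open>localise_translates\<close>). Pairing with this inequality gives the dual one,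
  \<open>N\<^sub>t(\<Sum>\<^sub>\<gamma> f\<^sub>\<gamma>(\<cdot> - \<gamma>))\<^sup>2 \<le> C \<Sum>\<^sub>\<gamma> N\<^sub>t(f\<^sub>\<gamma>)\<^sup>2\<close> for functions \<open>f\<^sub>\<gamma>\<close> supported near \<open>K\<close> (\<open>superpose_translates\<close>).

  Let \<open>\<chi> = 1\<close> in a neighbourhood of \<open>K\<close>. Since \<open>u\<^sub>\<gamma>\<close> does not notice multiplication by \<open>\<chi>(\<cdot> + y)\<close> for small \<open>y\<close>,
  \<open>u(\<phi>) = \<Sum>\<^sub>\<gamma> u\<^sub>\<gamma>(\<chi>(\<cdot> + y) \<phi>(\<cdot> + \<gamma>))\<close>, and the first inequality with \<open>t = - s\<close> bounds \<open>u\<close> by the square sum of the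
  norms (\<open>upper_estimate\<close>). Conversely, test functions that attain half of the norms of the
  \<open>u\<^sub>\<gamma>\<close> are cut off near \<open>K\<close> and superposed. Because \<open>K - K\<close> contains no lattice point but \<open>0\<close>, each translate
  is seen by exactly one \<open>u\<^sub>\<gamma>\<close>, and the second inequality bounds the square sum by the norm of \<open>u\<close>
  (\<open>lower_estimate\<close>).
\<close>

section \<open>Smooth functions\<close>

definition pd :: "'n::finite \<Rightarrow> (real^'n \<Rightarrow> complex) \<Rightarrow> real^'n \<Rightarrow> complex" where
  "pd i f = (\<lambda>x. frechet_derivative f (at x) (axis i 1))"

lemma partials_Cons: "partials (i # is) f = pd i (partials is f)"
  by (simp add: pd_def)

lemma partials_snoc: "partials (is @ [i]) f = partials is (pd i f)"
  by (induction "is") (simp_all add: pd_def)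

text \<open>Iterated derivatives are never computed. To control all of them it suffices to exhibit a set of
functions that contains the given one and is closed under partial derivatives; smoothness, rapid
decay and slow growth are then checked on the members of that set.\<close>

lemma partials_in:
  assumes "f \<in> X" "\<And>h i. h \<in> X \<Longrightarrow> pd i h \<in> X"
  shows "partials is f \<in> X"
  using assms by (induction "is") (auto simp: partials_Cons simp del: partials.simps(2))

lemma smooth_coinduct:
  assumes "f \<in> X" "\<And>h i. h \<in> X \<Longrightarrow> pd i h \<in> X" "\<And>h x. h \<in> X \<Longrightarrow> h differentiable (at x)"
  shows "smooth f"
  unfolding smooth_def using partials_in[OF assms(1,2)] assms(3) by blast

lemma smooth_differentiable: "smooth f \<Longrightarrow> f differentiable (at x)"
  unfolding smooth_def by (metis partials.simps(1))

lemma smooth_pd: "smooth f \<Longrightarrow> smooth (pd i f)"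
  unfolding smooth_def by (metis partials_snoc)

lemma smooth_partials: "smooth f \<Longrightarrow> smooth (partials is f)"
  by (induction "is") (auto simp: partials_Cons smooth_pd simp del: partials.simps(2))

lemma smooth_continuous_on: "smooth f \<Longrightarrow> continuous_on S f"
  using smooth_differentiable
  by (metis continuous_at_imp_continuous_on differentiable_imp_continuous_within)

lemma smooth_measurable [measurable_dest]: "smooth f \<Longrightarrow> f \<in> borel_measurable borel"
  by (intro borel_measurable_continuous_onI smooth_continuous_on)

lemma differentiable_has_derivative:
  "f differentiable (at x) \<Longrightarrow> (f has_derivative frechet_derivative f (at x)) (at x)"
  by (simp add: frechet_derivative_works)

lemma pd_eq: "(f has_derivative f') (at x) \<Longrightarrow> pd i f x = f' (axis i 1)"
  by (simp add: pd_def frechet_derivative_at[symmetric])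

lemma pd_add:
  assumes "\<And>x. f differentiable (at x)" "\<And>x. g differentiable (at x)"
  shows "pd i (\<lambda>x. f x + g x) = (\<lambda>x. pd i f x + pd i g x)"
proof
  fix x show "pd i (\<lambda>x. f x + g x) x = pd i f x + pd i g x"
    using pd_eq[OF has_derivative_add[OF assms[THEN differentiable_has_derivative]]]
    by (simp add: pd_def)
qed

lemma pd_mult:
  assumes "\<And>x. f differentiable (at x)" "\<And>x. g differentiable (at x)"
  shows "pd i (\<lambda>x. f x * g x) = (\<lambda>x. f x * pd i g x + pd i f x * g x)"
proof
  fix x show "pd i (\<lambda>x. f x * g x) x = f x * pd i g x + pd i f x * g x"
    using pd_eq[OF has_derivative_mult[OF assms[THEN differentiable_has_derivative]]]
    by (simp add: pd_def)
qed

lemma has_derivative_affine: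
  assumes "\<And>x. f differentiable (at x)"
  shows "((\<lambda>x. f (e *\<^sub>R x + a)) has_derivative
    (\<lambda>h. frechet_derivative f (at (e *\<^sub>R x + a)) (e *\<^sub>R h))) (at x)"
proof -
  have "((\<lambda>x. e *\<^sub>R x + a) has_derivative (\<lambda>h. e *\<^sub>R h)) (at x)"
    by (auto intro!: derivative_eq_intros)
  from diff_chain_at[OF this differentiable_has_derivative[OF assms]]
  show ?thesis by (simp add: o_def)
qed

lemma pd_affine:
  assumes "\<And>x. f differentiable (at x)"
  shows "pd i (\<lambda>x. f (e *\<^sub>R x + a)) = (\<lambda>x. of_real e * pd i f (e *\<^sub>R x + a))"
proof
  fix x
  have "linear (frechet_derivative f (at (e *\<^sub>R x + a)))"
    using assms by (simp add: linear_frechet_derivative)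
  then show "pd i (\<lambda>x. f (e *\<^sub>R x + a)) x = of_real e * pd i f (e *\<^sub>R x + a)"
    using pd_eq[OF has_derivative_affine[OF assms, of e a x], of i]
    by (simp only: pd_def linear_scale) (simp add: scaleR_conv_of_real)
qed

lemma pd_cnj:
  assumes "\<And>x. f differentiable (at x)"
  shows "pd i (\<lambda>x. cnj (f x)) = (\<lambda>x. cnj (pd i f x))"
proof
  fix x show "pd i (\<lambda>x. cnj (f x)) x = cnj (pd i f x)"
    using pd_eq[OF has_derivative_cnj[OF assms[THEN differentiable_has_derivative]]]
    by (simp add: pd_def)
qed

lemma pd_const [simp]: "pd i (\<lambda>x. c) = (\<lambda>x. 0)"
  by (rule ext, rule pd_eq[THEN trans], rule has_derivative_const, simp)

lemma has_derivative_coord: "((\<lambda>x::real^'n. complex_of_real (x $ k)) has_derivative (\<lambda>h. of_real (h $ k))) (at x)"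
  by (intro has_derivative_of_real bounded_linear.has_derivative[OF bounded_linear_vec_nth] has_derivative_ident)

lemma pd_coord: "pd i (\<lambda>x::real^'n::finite. complex_of_real (x $ k)) = (\<lambda>x. if k = i then 1 else 0)"
  by (rule ext, rule pd_eq[THEN trans], rule has_derivative_coord) (auto simp: axis_def)

text \<open>By the product rule, if the partial derivatives of the generators lie in the algebra they
generate, then that algebra is closed under partial derivatives. It is therefore a suitable closed
set for every expression built from the generators.\<close>

inductive_set function_algebra :: "(real^'n::finite \<Rightarrow> complex) set \<Rightarrow> (real^'n \<Rightarrow> complex) set"
  for G where
    function_algebra_base: "g \<in> G \<Longrightarrow> g \<in> function_algebra G"
  | function_algebra_add: "f \<in> function_algebra G \<Longrightarrow> g \<in> function_algebra G \<Longrightarrow> (\<lambda>x. f x + g x) \<in> function_algebra G"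
  | function_algebra_mult: "f \<in> function_algebra G \<Longrightarrow> g \<in> function_algebra G \<Longrightarrow> (\<lambda>x. f x * g x) \<in> function_algebra G"

lemma function_algebra_differentiable:
  assumes G: "\<And>g x. g \<in> G \<Longrightarrow> g differentiable (at x)" and f: "f \<in> function_algebra G"
  shows "f differentiable (at x)"
  using f by (induction arbitrary: x) (auto simp: G intro: differentiable_add differentiable_mult)

lemma function_algebra_pd:
  assumes G: "\<And>g x. g \<in> G \<Longrightarrow> g differentiable (at x)" "\<And>g i. g \<in> G \<Longrightarrow> pd i g \<in> function_algebra G"
    and f: "f \<in> function_algebra G"
  shows "pd i f \<in> function_algebra G"
  using f
proof induction
  case (function_algebra_add f g)
  then show ?case using function_algebra_differentiable[OF G(1)] by (subst pd_add) (auto intro: function_algebra.function_algebra_add)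
next
  case (function_algebra_mult f g)
  then show ?case using function_algebra_differentiable[OF G(1)]
    by (subst pd_mult) (auto intro!: function_algebra.function_algebra_add function_algebra.function_algebra_mult)
qed (use G in auto)

lemma function_algebra_smooth:
  assumes "\<And>g x. g \<in> G \<Longrightarrow> g differentiable (at x)" "\<And>g i. g \<in> G \<Longrightarrow> pd i g \<in> function_algebra G"
    and "f \<in> function_algebra G"
  shows "smooth f"
  by (rule smooth_coinduct[of _ "function_algebra G"])
    (use assms function_algebra_differentiable[OF assms(1)] function_algebra_pd[OF assms(1,2)] in auto)

lemma smooth_function_algebra: "f \<in> function_algebra (Collect smooth) \<Longrightarrow> smooth f"
  by (rule function_algebra_smooth) (auto intro: smooth_differentiable smooth_pd function_algebra_base)

lemma smooth_add: "smooth f \<Longrightarrow> smooth g \<Longrightarrow> smooth (\<lambda>x. f x + g x)"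
  by (intro smooth_function_algebra function_algebra_add function_algebra_base) auto

lemma smooth_mult: "smooth f \<Longrightarrow> smooth g \<Longrightarrow> smooth (\<lambda>x. f x * g x)"
  by (intro smooth_function_algebra function_algebra_mult function_algebra_base) auto

lemma smooth_const: "smooth (\<lambda>x. c)"
  by (rule smooth_coinduct[of _ "{\<lambda>x. d | d. True}"]) auto

lemma smooth_sum: "(\<And>i. i \<in> I \<Longrightarrow> smooth (f i)) \<Longrightarrow> smooth (\<lambda>x. \<Sum>i\<in>I. f i x)"
  by (induction I rule: infinite_finite_induct) (auto intro: smooth_add smooth_const)

lemma smooth_prod: "(\<And>i. i \<in> I \<Longrightarrow> smooth (f i)) \<Longrightarrow> smooth (\<lambda>x. \<Prod>i\<in>I. f i x)"
  by (induction I rule: infinite_finite_induct) (auto intro: smooth_mult smooth_const)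

lemma smooth_coord: "smooth (\<lambda>x::real^'n::finite. complex_of_real (x $ k))"
proof (rule smooth_coinduct[of _ "insert (\<lambda>x. complex_of_real (x $ k)) {\<lambda>x. d | d. True}"], goal_cases)
  case (3 h x)
  then show ?case by (auto intro: differentiableI has_derivative_coord)
qed (auto simp: pd_coord)

lemma smooth_affine:
  fixes f :: "real^'n::finite \<Rightarrow> complex"
  assumes "smooth f" shows "smooth (\<lambda>x. f (e *\<^sub>R x + a))"
proof (rule smooth_coinduct[of _ "{\<lambda>x. c * f (e *\<^sub>R x + a) | c f. smooth f}"], goal_cases)
  case 1
  show ?case using assms by (auto intro!: exI[of _ 1] exI[of _ f])
next
  have D: "(\<lambda>x. f (e *\<^sub>R x + a)) differentiable (at x)" if "smooth f" for f :: "real^'n \<Rightarrow> complex" and x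
    using has_derivative_affine[OF smooth_differentiable[OF that]] by (auto simp: differentiable_def)
  case (2 h i)
  then obtain c f where h: "h = (\<lambda>x. c * f (e *\<^sub>R x + a))" "smooth f" by auto
  have "pd i h = (\<lambda>x. (c * of_real e) * pd i f (e *\<^sub>R x + a))"
    unfolding h using D[OF h(2)] smooth_differentiable[OF h(2)]
    by (subst pd_mult) (auto simp: pd_affine)
  then show ?case using smooth_pd[OF h(2)] by blast
next
  case (3 h x)
  then obtain c f where h: "h = (\<lambda>x. c * f (e *\<^sub>R x + a))" "smooth f" by auto
  then show ?case using has_derivative_affine[OF smooth_differentiable[OF h(2)], of e a x]
    unfolding h by (intro differentiable_mult) (auto simp: differentiable_def)
qed

lemma smooth_cnj: "smooth f \<Longrightarrow> smooth (\<lambda>x. cnj (f x))"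
proof (rule smooth_coinduct[of _ "{\<lambda>x. cnj (f x) | f. smooth f}"], goal_cases)
  case (2 h i) then show ?case using pd_cnj smooth_differentiable smooth_pd by blast
next
  case (3 h x)
  then show ?case using has_derivative_cnj differentiable_has_derivative smooth_differentiable
    unfolding differentiable_def by blast
qed auto

text \<open>The derivative of \<open>1/f\<close> is \<open>- \<partial>f (1/f)\<^sup>2\<close>, so \<open>1/f\<close> and the smooth functions generate an algebra that is
closed under differentiation.\<close>

lemma smooth_inverse:
  assumes f: "smooth f" "\<And>x. f x \<noteq> 0"
  shows "smooth (\<lambda>x. inverse (f x))"
proof -
  let ?G = "insert (\<lambda>x. inverse (f x)) (Collect smooth)"
  have der: "((\<lambda>x. inverse (f x)) has_derivative
      (\<lambda>h. - (inverse (f x) * frechet_derivative f (at x) h * inverse (f x)))) (at x)" for x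
    by (intro Deriv.has_derivative_inverse f differentiable_has_derivative smooth_differentiable)
  have "pd i (\<lambda>x. inverse (f x)) = (\<lambda>x. (- 1 * pd i f x) * (inverse (f x) * inverse (f x)))" for i
    by (rule ext, rule pd_eq[OF der, THEN trans]) (simp add: pd_def)
  moreover have "(\<lambda>x. (- 1 * pd i f x) * (inverse (f x) * inverse (f x))) \<in> function_algebra ?G" for i
    by (intro function_algebra_mult function_algebra_base) (auto intro: smooth_const smooth_pd f)
  ultimately have A: "pd i g \<in> function_algebra ?G" if "g \<in> ?G" for g i
    using that by (auto intro: function_algebra_base smooth_pd)
  have B: "g differentiable (at x)" if "g \<in> ?G" for g x
    using that by (auto intro: smooth_differentiable differentiableI[OF der])
  show ?thesis by (rule function_algebra_smooth[OF B A function_algebra_base]) auto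
qed


section \<open>Schwartz functions and functions of slow growth\<close>

definition rapid :: "(real^'n::finite \<Rightarrow> complex) \<Rightarrow> bool" where
  "rapid f \<longleftrightarrow> (\<forall>k. \<exists>C. \<forall>x. (1 + norm x) ^ k * norm (f x) \<le> C)"

definition poly_bounded :: "(real^'n::finite \<Rightarrow> complex) \<Rightarrow> bool" where
  "poly_bounded f \<longleftrightarrow> (\<exists>C k. \<forall>x. norm (f x) \<le> C * (1 + norm x) ^ k)"

text \<open>The multipliers of the Schwartz space, usually denoted by \<open>\<O>\<^sub>M\<close>.\<close>

definition slow :: "(real^'n::finite \<Rightarrow> complex) set" where
  "slow = {f. smooth f \<and> (\<forall>is. poly_bounded (partials is f))}"

lemma schwartz_iff:
  fixes f :: "real^'n::finite \<Rightarrow> complex"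
  shows "f \<in> schwartz \<longleftrightarrow> smooth f \<and> (\<forall>is. rapid (partials is f))"
proof -
  have "bounded (range (\<lambda>x. (1 + norm x) ^ k * norm (g x))) \<longleftrightarrow>
      (\<exists>C. \<forall>x. (1 + norm x) ^ k * norm (g x) \<le> C)" for k and g :: "real^'n \<Rightarrow> complex"
    by (auto simp: bounded_iff abs_mult)
  then show ?thesis by (auto simp: schwartz_def rapid_def)
qed

lemma schwartz_coinduct:
  assumes "f \<in> X" "\<And>h i. h \<in> X \<Longrightarrow> pd i h \<in> X" "\<And>h x. h \<in> X \<Longrightarrow> h differentiable (at x)"
    "\<And>h. h \<in> X \<Longrightarrow> rapid h"
  shows "f \<in> schwartz"
  using smooth_coinduct[OF assms(1-3)] partials_in[OF assms(1,2)] assms(4) by (auto simp: schwartz_iff)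

lemma slow_coinduct:
  assumes "f \<in> X" "\<And>h i. h \<in> X \<Longrightarrow> pd i h \<in> X" "\<And>h x. h \<in> X \<Longrightarrow> h differentiable (at x)"
    "\<And>h. h \<in> X \<Longrightarrow> poly_bounded h"
  shows "f \<in> slow"
  using smooth_coinduct[OF assms(1-3)] partials_in[OF assms(1,2)] assms(4) by (auto simp: slow_def)

lemma schwartz_smooth: "f \<in> schwartz \<Longrightarrow> smooth f" by (simp add: schwartz_iff)
lemma schwartz_rapid: "f \<in> schwartz \<Longrightarrow> rapid f" by (metis partials.simps(1) schwartz_iff)
lemma schwartz_pd: "f \<in> schwartz \<Longrightarrow> pd i f \<in> schwartz"
  by (auto simp: schwartz_iff smooth_pd simp flip: partials_snoc)
lemma schwartz_partials: "f \<in> schwartz \<Longrightarrow> partials is f \<in> schwartz"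
  by (rule partials_in) (auto intro: schwartz_pd)
lemma slow_smooth: "f \<in> slow \<Longrightarrow> smooth f" by (simp add: slow_def)
lemma slow_poly_bounded: "f \<in> slow \<Longrightarrow> poly_bounded f" by (metis (mono_tags) partials.simps(1) slow_def mem_Collect_eq)
lemma slow_pd: "f \<in> slow \<Longrightarrow> pd i f \<in> slow"
  by (auto simp: slow_def smooth_pd simp flip: partials_snoc)

lemma rapidD: assumes "rapid f" obtains C where "C > 0" "\<And>x. (1 + norm x) ^ k * norm (f x) \<le> C"
proof -
  obtain C where C: "\<And>x. (1 + norm x) ^ k * norm (f x) \<le> C" using assms by (auto simp: rapid_def)
  show thesis by (rule that[of "max C 1"]) (use C in \<open>auto simp: le_max_iff_disj\<close>)
qed

lemma poly_boundedD:
  assumes "poly_bounded f" obtains C k where "C > 0" "\<And>x. norm (f x) \<le> C * (1 + norm x) ^ k"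
proof -
  obtain C k where C: "\<And>x. norm (f x) \<le> C * (1 + norm x) ^ k" using assms by (auto simp: poly_bounded_def)
  show thesis
    by (rule that[of "max C 1" k], simp, rule order_trans[OF C]) (intro mult_right_mono, auto)
qed

lemma rapid_add: assumes "rapid f" "rapid g" shows "rapid (\<lambda>x. f x + g x)"
  unfolding rapid_def
proof
  fix k
  from rapidD[OF assms(1), where k=k] obtain C where C: "C > 0" "\<And>x. (1 + norm x) ^ k * norm (f x) \<le> C" by metis
  from rapidD[OF assms(2), where k=k] obtain D where D: "D > 0" "\<And>x. (1 + norm x) ^ k * norm (g x) \<le> D" by metis
  have "(1 + norm x) ^ k * norm (f x + g x) \<le> C + D" for x
  proof -
    have "(1 + norm x) ^ k * norm (f x + g x) \<le> (1 + norm x) ^ k * (norm (f x) + norm (g x))"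
      by (intro mult_left_mono norm_triangle_ineq) auto
    then show ?thesis using C(2)[of x] D(2)[of x] by (simp add: ring_distribs)
  qed
  then show "\<exists>C. \<forall>x. (1 + norm x) ^ k * norm (f x + g x) \<le> C" by blast
qed

lemma rapid_mult: assumes "poly_bounded f" "rapid g" shows "rapid (\<lambda>x. f x * g x)"
  unfolding rapid_def
proof
  fix k
  from poly_boundedD[OF assms(1)] obtain C l where C: "C > 0" "\<And>x. norm (f x) \<le> C * (1 + norm x) ^ l" by metis
  from rapidD[OF assms(2), where k="k+l"] obtain D where D: "\<And>x. (1 + norm x) ^ (k+l) * norm (g x) \<le> D" by metis
  have "(1 + norm x) ^ k * norm (f x * g x) \<le> C * D" for x
  proof -
    have "(1 + norm x) ^ k * norm (f x * g x) \<le> (1 + norm x) ^ k * ((C * (1 + norm x) ^ l) * norm (g x))"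
      unfolding norm_mult by (intro mult_left_mono mult_right_mono C) auto
    also have "\<dots> = C * ((1 + norm x) ^ (k + l) * norm (g x))" by (simp add: power_add mult_ac)
    also have "\<dots> \<le> C * D" using C(1) D by (intro mult_left_mono) auto
    finally show ?thesis .
  qed
  then show "\<exists>C. \<forall>x. (1 + norm x) ^ k * norm (f x * g x) \<le> C" by blast
qed

lemma poly_bounded_add: assumes "poly_bounded f" "poly_bounded g" shows "poly_bounded (\<lambda>x. f x + g x)"
proof -
  from poly_boundedD[OF assms(1)] obtain C k where C: "C > 0" "\<And>x. norm (f x) \<le> C * (1 + norm x) ^ k" by metis
  from poly_boundedD[OF assms(2)] obtain D l where D: "D > 0" "\<And>x. norm (g x) \<le> D * (1 + norm x) ^ l" by metis
  have "norm (f x + g x) \<le> (C + D) * (1 + norm x) ^ (k + l)" for x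
  proof -
    have "C * (1 + norm x) ^ k \<le> C * (1 + norm x) ^ (k + l)" "D * (1 + norm x) ^ l \<le> D * (1 + norm x) ^ (k + l)"
      using C(1) D(1) by (auto intro!: mult_left_mono power_increasing)
    then show ?thesis using norm_triangle_ineq[of "f x" "g x"] C(2)[of x] D(2)[of x] by (simp add: ring_distribs)
  qed
  then show ?thesis by (auto simp: poly_bounded_def)
qed

lemma poly_bounded_mult: assumes "poly_bounded f" "poly_bounded g" shows "poly_bounded (\<lambda>x. f x * g x)"
proof -
  from poly_boundedD[OF assms(1)] obtain C k where C: "C > 0" "\<And>x. norm (f x) \<le> C * (1 + norm x) ^ k" by metis
  from poly_boundedD[OF assms(2)] obtain D l where D: "D > 0" "\<And>x. norm (g x) \<le> D * (1 + norm x) ^ l" by metis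
  have "norm (f x * g x) \<le> (C * D) * (1 + norm x) ^ (k + l)" for x
  proof -
    have "norm (f x * g x) \<le> (C * (1 + norm x) ^ k) * (D * (1 + norm x) ^ l)"
      unfolding norm_mult using C D by (intro mult_mono) auto
    then show ?thesis by (simp add: power_add mult_ac)
  qed
  then show ?thesis by (auto simp: poly_bounded_def)
qed

lemma poly_bounded_const: "poly_bounded (\<lambda>x. c)"
  unfolding poly_bounded_def by (rule exI[of _ "norm c"], rule exI[of _ 0]) simp

lemma poly_bounded_coord: "poly_bounded (\<lambda>x::real^'n::finite. complex_of_real (x $ k))"
  unfolding poly_bounded_def
  by (rule exI[of _ 1], rule exI[of _ 1]) (auto intro: order_trans[OF component_le_norm_cart])

lemma function_algebra_slow:
  assumes "\<And>g x. g \<in> G \<Longrightarrow> g differentiable (at x)" "\<And>g i. g \<in> G \<Longrightarrow> pd i g \<in> function_algebra G"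
    "\<And>g. g \<in> G \<Longrightarrow> poly_bounded g" and "f \<in> function_algebra G"
  shows "f \<in> slow"
proof (rule slow_coinduct[of _ "function_algebra G"])
  fix h assume "h \<in> function_algebra G" then show "poly_bounded h"
    by induction (auto intro: assms poly_bounded_add poly_bounded_mult)
qed (use assms function_algebra_differentiable[OF assms(1)] function_algebra_pd[OF assms(1,2)] in auto)

lemma slow_function_algebra: "f \<in> function_algebra slow \<Longrightarrow> f \<in> slow"
  by (rule function_algebra_slow) (auto intro: slow_smooth smooth_differentiable slow_pd function_algebra_base slow_poly_bounded)

lemma slow_mult: "f \<in> slow \<Longrightarrow> g \<in> slow \<Longrightarrow> (\<lambda>x. f x * g x) \<in> slow"
  by (rule slow_function_algebra) (intro function_algebra_mult function_algebra_base)

lemma slow_const: "(\<lambda>x. c) \<in> slow"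
  by (rule slow_coinduct[of _ "{\<lambda>x. d | d. True}"]) (auto intro: poly_bounded_const)

lemma slow_coord: "(\<lambda>x::real^'n::finite. complex_of_real (x $ k)) \<in> slow"
proof (rule slow_coinduct[of _ "insert (\<lambda>x. complex_of_real (x $ k)) {\<lambda>x. d | d. True}"], goal_cases)
  case (3 h x)
  then show ?case by (auto intro: differentiableI has_derivative_coord)
qed (auto simp: pd_coord poly_bounded_const poly_bounded_coord)

lemma schwartz_slow: "f \<in> schwartz \<Longrightarrow> f \<in> slow"
proof (rule slow_coinduct[of _ schwartz])
  fix h :: "real^'n \<Rightarrow> complex" assume "h \<in> schwartz"
  from rapidD[OF schwartz_rapid[OF this], where k=0] obtain C where "\<And>x. norm (h x) \<le> C" by auto
  then show "poly_bounded h"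
    unfolding poly_bounded_def by (intro exI[of _ C] exI[of _ 0]) simp
qed (auto intro: schwartz_pd schwartz_smooth smooth_differentiable)

text \<open>Products of a slowly growing and a Schwartz function are not closed under derivatives, because of
the product rule, but their finite sums are.\<close>

inductive_set slow_schwartz_sums :: "(real^'n::finite \<Rightarrow> complex) set" where
    slow_schwartz_base: "f \<in> slow \<Longrightarrow> g \<in> schwartz \<Longrightarrow> (\<lambda>x. f x * g x) \<in> slow_schwartz_sums"
  | slow_schwartz_add: "f \<in> slow_schwartz_sums \<Longrightarrow> g \<in> slow_schwartz_sums \<Longrightarrow>
      (\<lambda>x. f x + g x) \<in> slow_schwartz_sums"

lemma slow_schwartz_sums_schwartz: "h \<in> slow_schwartz_sums \<Longrightarrow> h \<in> schwartz"
proof (rule schwartz_coinduct[of _ slow_schwartz_sums])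
  fix h :: "real^'n \<Rightarrow> complex" and x assume "h \<in> slow_schwartz_sums"
  then show D: "h differentiable (at x)" for x
    by induction (auto intro!: differentiable_add differentiable_mult
        intro: slow_smooth schwartz_smooth smooth_differentiable)
next
  fix h :: "real^'n \<Rightarrow> complex" assume "h \<in> slow_schwartz_sums"
  then show "rapid h"
    by induction (auto intro: rapid_add rapid_mult slow_poly_bounded schwartz_rapid)
next
  fix h :: "real^'n \<Rightarrow> complex" and i assume "h \<in> slow_schwartz_sums"
  then have "pd i h \<in> slow_schwartz_sums \<and> (\<forall>x. h differentiable (at x))"
  proof induction
    case (slow_schwartz_base f g)
    then have "f differentiable (at x)" "g differentiable (at x)" for x
      by (auto intro: slow_smooth schwartz_smooth smooth_differentiable)
    then show ?case using slow_schwartz_base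
      by (subst pd_mult) (auto intro!: slow_schwartz_sums.intros slow_pd schwartz_pd)
  next
    case (slow_schwartz_add f g)
    then show ?case by (subst pd_add) (auto intro: slow_schwartz_sums.intros)
  qed
  then show "pd i h \<in> slow_schwartz_sums" by blast
qed

lemma schwartz_mult_slow: "f \<in> slow \<Longrightarrow> g \<in> schwartz \<Longrightarrow> (\<lambda>x. f x * g x) \<in> schwartz"
  by (rule slow_schwartz_sums_schwartz, rule slow_schwartz_base)

lemma schwartz_mult: "f \<in> schwartz \<Longrightarrow> g \<in> schwartz \<Longrightarrow> (\<lambda>x. f x * g x) \<in> schwartz"
  by (intro schwartz_mult_slow schwartz_slow)

lemma schwartz_cmult: "g \<in> schwartz \<Longrightarrow> (\<lambda>x. c * g x) \<in> schwartz"
  by (intro schwartz_mult_slow slow_const)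

lemma schwartz_add: "f \<in> schwartz \<Longrightarrow> g \<in> schwartz \<Longrightarrow> (\<lambda>x. f x + g x) \<in> schwartz"
  using slow_schwartz_sums_schwartz[OF slow_schwartz_add[OF slow_schwartz_base slow_schwartz_base],
      of "\<lambda>x. 1" f "\<lambda>x. 1" g] by (simp add: slow_const)

lemma schwartz_zero: "(\<lambda>x. 0) \<in> schwartz"
  by (rule schwartz_coinduct[of _ "{\<lambda>x. 0}"]) (auto simp: rapid_def)

lemma schwartz_sum: "(\<And>i. i \<in> I \<Longrightarrow> f i \<in> schwartz) \<Longrightarrow> (\<lambda>x. \<Sum>i\<in>I. f i x) \<in> schwartz"
  by (induction I rule: infinite_finite_induct) (auto intro: schwartz_add schwartz_zero)

lemma rapid_affine:
  fixes f :: "real^'n::finite \<Rightarrow> complex"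
  assumes "rapid f" "e \<noteq> 0" shows "rapid (\<lambda>x. f (e *\<^sub>R x + a))"
  unfolding rapid_def
proof
  fix k
  define M where "M = 1 + (1 + norm a) / \<bar>e\<bar>"
  from rapidD[OF assms(1), where k=k] obtain C where C: "C > 0" "\<And>x. (1 + norm x) ^ k * norm (f x) \<le> C" by metis
  have M: "1 + norm x \<le> M * (1 + norm (e *\<^sub>R x + a))" for x :: "real^'n"
  proof -
    have "\<bar>e\<bar> * norm x \<le> norm (e *\<^sub>R x + a) + norm a"
      using norm_triangle_ineq4[of "e *\<^sub>R x + a" a] by simp
    then have "norm x \<le> (norm (e *\<^sub>R x + a) + norm a) / \<bar>e\<bar>" using assms(2) by (simp add: field_simps)
    also have "\<dots> \<le> ((1 + norm a) * (1 + norm (e *\<^sub>R x + a))) / \<bar>e\<bar>"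
      by (intro divide_right_mono) (auto simp: ring_distribs)
    finally have "norm x \<le> (1 + norm a) * (1 + norm (e *\<^sub>R x + a)) / \<bar>e\<bar>" .
    moreover have "M * (1 + norm (e *\<^sub>R x + a)) =
        (1 + norm (e *\<^sub>R x + a)) + (1 + norm a) * (1 + norm (e *\<^sub>R x + a)) / \<bar>e\<bar>"
      by (simp add: M_def distrib_right)
    ultimately show ?thesis using norm_ge_zero[of "e *\<^sub>R x + a"] by linarith
  qed
  have "(1 + norm x) ^ k * norm (f (e *\<^sub>R x + a)) \<le> M ^ k * C" for x
  proof -
    have "(1 + norm x) ^ k * norm (f (e *\<^sub>R x + a)) \<le> (M * (1 + norm (e *\<^sub>R x + a))) ^ k * norm (f (e *\<^sub>R x + a))"
      by (intro mult_right_mono power_mono M) auto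
    also have "\<dots> = M ^ k * ((1 + norm (e *\<^sub>R x + a)) ^ k * norm (f (e *\<^sub>R x + a)))" by (simp add: power_mult_distrib mult_ac)
    also have "\<dots> \<le> M ^ k * C" by (intro mult_left_mono C) (auto simp: M_def)
    finally show ?thesis .
  qed
  then show "\<exists>C. \<forall>x. (1 + norm x) ^ k * norm (f (e *\<^sub>R x + a)) \<le> C" by blast
qed

lemma schwartz_affine:
  fixes f :: "real^'n::finite \<Rightarrow> complex"
  assumes "f \<in> schwartz" "e \<noteq> 0" shows "(\<lambda>x. f (e *\<^sub>R x + a)) \<in> schwartz"
proof (rule schwartz_coinduct[of _ "{\<lambda>x. c * f (e *\<^sub>R x + a) | c f. f \<in> schwartz}"], goal_cases)
  case 1
  show ?case using assms by (auto intro!: exI[of _ 1] exI[of _ f])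
next
  case (2 h i)
  then obtain c f where h: "h = (\<lambda>x. c * f (e *\<^sub>R x + a))" "f \<in> schwartz" by auto
  note S = schwartz_smooth[OF h(2)]
  have "pd i h = (\<lambda>x. (c * of_real e) * pd i f (e *\<^sub>R x + a))"
    unfolding h using smooth_differentiable[OF smooth_affine[OF S]] smooth_differentiable[OF S]
    by (subst pd_mult) (auto simp: pd_affine)
  then show ?case using schwartz_pd[OF h(2)] by blast
next
  case (3 h x)
  then show ?case
    by (auto intro!: differentiable_mult intro: smooth_differentiable[OF smooth_affine] schwartz_smooth)
next
  case (4 h)
  then obtain c f where "h = (\<lambda>x. c * f (e *\<^sub>R x + a))" "f \<in> schwartz" by auto
  then show ?case using rapid_mult[OF poly_bounded_const rapid_affine[OF schwartz_rapid assms(2)]] by simp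
qed

lemma schwartz_translate: "f \<in> schwartz \<Longrightarrow> (\<lambda>x. f (x + a)) \<in> schwartz"
  using schwartz_affine[of f 1 a] by simp

lemma schwartz_cnj: "f \<in> schwartz \<Longrightarrow> (\<lambda>x. cnj (f x)) \<in> schwartz"
proof (rule schwartz_coinduct[of _ "{\<lambda>x. cnj (f x) | f. f \<in> schwartz}"], goal_cases)
  case (2 h i) then show ?case using pd_cnj smooth_differentiable schwartz_pd schwartz_smooth by blast
next
  case (3 h x) then show ?case by (auto intro: smooth_differentiable smooth_cnj schwartz_smooth)
next
  case (4 h)
  then obtain f where "f \<in> schwartz" "h = (\<lambda>x. cnj (f x))" by auto
  with schwartz_rapid[of f] show ?case by (simp add: rapid_def)
qed auto

section \<open>The symbols\<close>

definition block :: "('n::finite \<Rightarrow> 'j::finite) \<Rightarrow> 'j \<Rightarrow> real^'n \<Rightarrow> real" where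
  "block b l x = 1 + (\<Sum>k | b k = l. (x $ k)\<^sup>2)"

lemma block_ge_1: "block b l x \<ge> 1"
  by (auto simp: block_def intro: sum_nonneg)

lemma block_pos: "block b l x > 0"
  using block_ge_1[of b l x] by linarith

lemma bracket_block: "bracket b s x = (\<Prod>l\<in>UNIV. block b l x powr (s $ l / 2))"
  by (simp add: bracket_def block_def)

lemma bracket_pos: "bracket b s x > 0"
  unfolding bracket_block by (intro prod_pos) (simp add: block_pos less_imp_neq[symmetric])

lemma bracket_nonneg: "bracket b s x \<ge> 0"
  using bracket_pos[of b s x] by simp

lemma bracket_minus: "bracket b (- s) x = inverse (bracket b s x)"
  unfolding bracket_block by (simp add: powr_minus prod_inversef[symmetric])

lemma bracket_mult_minus [simp]:
  "bracket b s x * bracket b (- s) x = 1" "bracket b (- s) x * bracket b s x = 1"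
  using bracket_pos[of b s x] by (auto simp: bracket_minus)

lemma block_le: "block b l x \<le> (1 + norm x) ^ 2"
proof -
  have "(\<Sum>k | b k = l. (x $ k)\<^sup>2) \<le> (\<Sum>k\<in>UNIV. (x $ k)\<^sup>2)"
    by (rule sum_mono2) auto
  also have "\<dots> = norm x ^ 2"
    by (simp add: norm_vec_def L2_set_def sum_nonneg)
  finally show ?thesis unfolding block_def using norm_ge_zero[of x]
    by (simp add: power2_sum add_increasing2)
qed

lemma has_derivative_block_powr:
  "((\<lambda>x. complex_of_real (block b l x powr r)) has_derivative
    (\<lambda>h. of_real (r * block b l x powr (r - 1) * (\<Sum>k | b k = l. 2 * x $ k * h $ k)))) (at x)"
proof -
  have "((\<lambda>x. block b l x) has_derivative (\<lambda>h. (\<Sum>k | b k = l. 2 * x $ k * h $ k))) (at x)"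
    unfolding block_def
    by (auto intro!: derivative_eq_intros bounded_linear.has_derivative[OF bounded_linear_vec_nth]
        simp: mult_ac)
  then have "((\<lambda>x. block b l x powr r) has_derivative
      (\<lambda>h. r * block b l x powr (r - 1) * (\<Sum>k | b k = l. 2 * x $ k * h $ k))) (at x)"
    using block_pos[of b l x]
    by (auto intro!: derivative_eq_intros simp: powr_diff)
  from has_derivative_of_real[OF this] show ?thesis .
qed

lemma poly_bounded_block_powr: "poly_bounded (\<lambda>x. complex_of_real (block b l x powr r))"
proof -
  define k where "k = nat \<lceil>\<bar>r\<bar>\<rceil>"
  have "norm (complex_of_real (block b l x powr r)) \<le> 1 * (1 + norm x) ^ (2 * k)" for x
  proof -
    have "block b l x powr r \<le> block b l x powr (real k)"
      using block_ge_1[of b l x] by (intro powr_mono) (auto simp: k_def, linarith)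
    also have "\<dots> = block b l x ^ k" using block_pos[of b l x] by (simp add: powr_realpow)
    also have "\<dots> \<le> ((1 + norm x) ^ 2) ^ k"
      using block_pos[of b l x] by (intro power_mono block_le) simp
    finally show ?thesis by (simp add: power_mult)
  qed
  then show ?thesis unfolding poly_bounded_def by blast
qed

text \<open>The derivative of \<open>(1 + |x\<^sub>l|\<^sup>2)\<^sup>r\<close> in a direction of the block \<open>l\<close> is \<open>2 r x\<^sub>i (1 + |x\<^sub>l|\<^sup>2)\<^sup>r\<^sup>-\<^sup>1\<close>. Hence
the powers with all real exponents have to be taken as generators together, along with the
coordinates.\<close>

lemma slow_bracket: "(\<lambda>x. complex_of_real (bracket b s x)) \<in> slow"
proof -
  let ?G = "{\<lambda>x. complex_of_real (block b l x powr r) | l r. True} \<union> slow"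
  have B: "(\<lambda>x. complex_of_real (block b l x powr r)) \<in> slow" for l r
  proof (rule function_algebra_slow[of ?G])
    fix g i assume "g \<in> ?G"
    then consider l r where "g = (\<lambda>x. complex_of_real (block b l x powr r))" | "g \<in> slow" by auto
    then show "pd i g \<in> function_algebra ?G"
    proof cases
      case 1
      have "pd i g = (\<lambda>x. (of_real (if b i = l then 2 * r else 0) * of_real (x $ i)) *
          of_real (block b l x powr (r - 1)))"
      proof
        fix x
        have "(\<Sum>k | b k = l. 2 * x $ k * (axis i (1::real)) $ k) = (if b i = l then 2 * x $ i else 0)"
          by (auto simp: axis_def if_distrib cong: if_cong)
        then show "pd i g x = (of_real (if b i = l then 2 * r else 0) * of_real (x $ i)) *
          of_real (block b l x powr (r - 1))"
          unfolding 1 by (subst pd_eq[OF has_derivative_block_powr]) simp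
      qed
      also have "\<dots> \<in> function_algebra ?G"
        by (intro function_algebra_mult function_algebra_base) (auto intro: slow_const slow_coord)
      finally show ?thesis .
    qed (auto intro: slow_pd function_algebra_base)
  qed (auto intro: function_algebra_base smooth_differentiable slow_smooth slow_poly_bounded poly_bounded_block_powr
      differentiableI[OF has_derivative_block_powr])
  have "(\<lambda>x. \<Prod>l\<in>L. complex_of_real (block b l x powr (s $ l / 2))) \<in> slow" for L
    by (induction L rule: infinite_finite_induct) (auto intro: slow_mult B slow_const)
  from this[of UNIV] show ?thesis by (simp add: bracket_block[abs_def])
qed

lemma block_peetre: "block b l (x + y) \<le> 2 * block b l x * block b l y"
proof -
  let ?f = "\<lambda>x. \<Sum>k | b k = l. (x $ k)\<^sup>2"
  have "?f (x + y) \<le> (\<Sum>k | b k = l. 2 * (x $ k)\<^sup>2 + 2 * (y $ k)\<^sup>2)"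
  proof (intro sum_mono)
    fix k show "((x + y) $ k)\<^sup>2 \<le> 2 * (x $ k)\<^sup>2 + 2 * (y $ k)\<^sup>2"
      using sum_squares_bound[of "x $ k" "y $ k"] by (simp add: power2_sum)
  qed
  also have "\<dots> = 2 * ?f x + 2 * ?f y" by (simp add: sum.distrib sum_distrib_left)
  finally have "block b l (x + y) \<le> 1 + 2 * ?f x + 2 * ?f y" by (simp add: block_def)
  moreover have "0 \<le> ?f x" "0 \<le> ?f y" by (auto intro: sum_nonneg)
  then have "0 \<le> ?f x * ?f y" by simp
  ultimately show ?thesis by (simp add: block_def algebra_simps)
qed

text \<open>Peetre's inequality for one block. If \<open>r < 0\<close>, the elementary inequality is applied to
\<open>x = (x + y) + (- y)\<close> with the exponent \<open>- r\<close>.\<close>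

lemma block_powr_peetre:
  "block b l (x + y) powr r \<le> 2 powr \<bar>r\<bar> * block b l x powr r * block b l y powr \<bar>r\<bar>"
proof (cases "r \<ge> 0")
  case True
  have "block b l (x + y) powr r \<le> (2 * block b l x * block b l y) powr r"
    using True block_pos[of b l "x+y"] by (intro powr_mono2 block_peetre) auto
  then show ?thesis using True block_pos[of b l x] block_pos[of b l y] by (simp add: powr_mult)
next
  case False
  have e: "block b l (- y) = block b l y" by (simp add: block_def)
  have "block b l x powr (- r) \<le> (2 * block b l (x + y) * block b l y) powr (- r)"
    using False block_pos[of b l x] block_peetre[of b l "x + y" "- y"]
    by (intro powr_mono2) (auto simp: e)
  then have "block b l x powr (- r) \<le> 2 powr \<bar>r\<bar> * block b l (x + y) powr (- r) * block b l y powr \<bar>r\<bar>"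
    using False block_pos[of b l "x+y"] block_pos[of b l y] by (simp add: powr_mult)
  then have "(block b l x powr (- r)) * (block b l x powr r * block b l (x + y) powr r) \<le>
     (2 powr \<bar>r\<bar> * block b l (x + y) powr (- r) * block b l y powr \<bar>r\<bar>) *
     (block b l x powr r * block b l (x + y) powr r)"
    by (intro mult_right_mono) auto
  then show ?thesis using block_pos[of b l "x+y"] block_pos[of b l x]
    by (simp add: powr_minus field_simps)
qed

text \<open>This is what allows the weight at \<open>x + y\<close> to be replaced by the weight at \<open>x\<close>, at the price of a
factor that grows polynomially in \<open>y\<close> and is absorbed by a rapidly decreasing function.\<close>

lemma bracket_peetre:
  "bracket b s (x + y) \<le> 2 powr (\<Sum>l\<in>UNIV. \<bar>s $ l\<bar> / 2) * bracket b s x * bracket b (\<chi> l. \<bar>s $ l\<bar>) y"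
proof -
  have "bracket b s (x + y) \<le> (\<Prod>l\<in>UNIV. 2 powr \<bar>s $ l / 2\<bar> * block b l x powr (s $ l / 2) *
      block b l y powr \<bar>s $ l / 2\<bar>)"
    unfolding bracket_block by (intro prod_mono conjI block_powr_peetre) simp
  then show ?thesis by (simp add: bracket_block prod.distrib powr_sum)
qed


section \<open>Test functions\<close>

lemma fun_support_closed: "closed (fun_support f)"
  by (simp add: fun_support_def)

lemma fun_support_zero: "x \<notin> fun_support f \<Longrightarrow> f x = 0"
  using closure_subset[of "{x. f x \<noteq> 0}"] by (auto simp: fun_support_def)

lemma fun_supportI: "closed S \<Longrightarrow> (\<And>x. x \<notin> S \<Longrightarrow> f x = 0) \<Longrightarrow> fun_support f \<subseteq> S"
  unfolding fun_support_def by (rule closure_minimal) auto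

lemma test_functionI:
  assumes "smooth f" "compact S" "\<And>x. x \<notin> S \<Longrightarrow> f x = 0"
  shows "f \<in> test_functions"
proof -
  have "fun_support f \<subseteq> S" by (rule fun_supportI) (use assms compact_imp_closed in auto)
  then have "compact (fun_support f)"
    using assms(2) fun_support_closed by (metis compact_Int_closed inf.absorb_iff2)
  then show ?thesis using assms(1) by (simp add: test_functions_def)
qed

lemma test_smooth: "f \<in> test_functions \<Longrightarrow> smooth f" by (simp add: test_functions_def)
lemma test_compact: "f \<in> test_functions \<Longrightarrow> compact (fun_support f)" by (simp add: test_functions_def)

text \<open>Derivatives vanish off the support, which is compact, so each weighted derivative is a continuous
function on a compact set.\<close>

lemma test_schwartz:
  fixes f :: "real^'n::finite \<Rightarrow> complex"
  assumes f: "f \<in> test_functions" shows "f \<in> schwartz"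
proof (rule schwartz_coinduct[of _ "{h. smooth h \<and> (\<forall>x. x \<notin> fun_support f \<longrightarrow> h x = 0)}"])
  fix h :: "real^'n \<Rightarrow> complex" and i assume h: "h \<in> {h. smooth h \<and> (\<forall>x. x \<notin> fun_support f \<longrightarrow> h x = 0)}"
  have "pd i h x = 0" if "x \<notin> fun_support f" for x
  proof -
    have "(h has_derivative (\<lambda>_. 0)) (at x)"
      by (rule has_derivative_transform_within_open[of "\<lambda>_. 0" _ _ _ "- fun_support f"])
        (use h that fun_support_closed in auto)
    from pd_eq[OF this] show ?thesis by simp
  qed
  then show "pd i h \<in> {h. smooth h \<and> (\<forall>x. x \<notin> fun_support f \<longrightarrow> h x = 0)}"
    using h by (auto intro: smooth_pd)
next
  fix h :: "real^'n \<Rightarrow> complex" assume h: "h \<in> {h. smooth h \<and> (\<forall>x. x \<notin> fun_support f \<longrightarrow> h x = 0)}"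
  show "rapid h" unfolding rapid_def
  proof
    fix k
    have "continuous_on (fun_support f) (\<lambda>x. (1 + norm x) ^ k * norm (h x))"
      by (intro continuous_intros smooth_continuous_on) (use h in auto)
    then have "bounded ((\<lambda>x. (1 + norm x) ^ k * norm (h x)) ` fun_support f)"
      by (intro compact_imp_bounded compact_continuous_image test_compact f)
    then obtain C where C: "\<And>x. x \<in> fun_support f \<Longrightarrow> (1 + norm x) ^ k * norm (h x) \<le> C"
      unfolding bounded_iff by (force simp: abs_mult)
    have "(1 + norm x) ^ k * norm (h x) \<le> max C 0" for x
      using C[of x] h by (cases "x \<in> fun_support f") (auto simp: le_max_iff_disj)
    then show "\<exists>C. \<forall>x. (1 + norm x) ^ k * norm (h x) \<le> C" by blast
  qed
qed (use f in \<open>auto intro: test_smooth fun_support_zero smooth_differentiable\<close>)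

lemma test_mult_right: "f \<in> test_functions \<Longrightarrow> smooth g \<Longrightarrow> (\<lambda>x. f x * g x) \<in> test_functions"
  by (rule test_functionI[of _ "fun_support f"]) (auto intro: smooth_mult test_smooth test_compact simp: fun_support_zero)

lemma test_add: "f \<in> test_functions \<Longrightarrow> g \<in> test_functions \<Longrightarrow> (\<lambda>x. f x + g x) \<in> test_functions"
  by (rule test_functionI[of _ "fun_support f \<union> fun_support g"])
    (auto intro: smooth_add test_smooth test_compact simp: fun_support_zero)

lemma test_cmult: "f \<in> test_functions \<Longrightarrow> (\<lambda>x. c * f x) \<in> test_functions"
  using test_mult_right[OF _ smooth_const, of f c] by (simp add: mult.commute)

lemma test_zero: "(\<lambda>x. 0) \<in> test_functions"
  by (rule test_functionI[of _ "{}"]) (auto intro: smooth_const)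

lemma test_sum: "(\<And>i. i \<in> I \<Longrightarrow> f i \<in> test_functions) \<Longrightarrow> (\<lambda>x. \<Sum>i\<in>I. f i x) \<in> test_functions"
  by (induction I rule: infinite_finite_induct) (auto intro: test_add test_zero)

lemma fun_support_mult_left: "fun_support (\<lambda>x. f x * g x) \<subseteq> fun_support f"
  by (rule fun_supportI) (auto simp: fun_support_closed fun_support_zero)

lemma test_affine:
  fixes f :: "real^'n::finite \<Rightarrow> complex"
  assumes "f \<in> test_functions" "e \<noteq> 0" shows "(\<lambda>x. f (e *\<^sub>R x + a)) \<in> test_functions"
proof (rule test_functionI[of _ "(\<lambda>x. (1 / e) *\<^sub>R x + (- 1 / e) *\<^sub>R a) ` fun_support f"])
  show "compact ((\<lambda>x. (1 / e) *\<^sub>R x + (- 1 / e) *\<^sub>R a) ` fun_support f)"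
    by (intro compact_continuous_image continuous_intros test_compact assms)
  fix x assume "x \<notin> (\<lambda>x. (1 / e) *\<^sub>R x + (- 1 / e) *\<^sub>R a) ` fun_support f"
  moreover have "x = (1 / e) *\<^sub>R (e *\<^sub>R x + a) + (- 1 / e) *\<^sub>R a"
    using assms(2) by (simp add: scaleR_add_right)
  ultimately show "f (e *\<^sub>R x + a) = 0" by (metis fun_support_zero image_eqI)
qed (use assms in \<open>auto intro: smooth_affine test_smooth\<close>)

lemma test_translate: "f \<in> test_functions \<Longrightarrow> (\<lambda>x. f (x + a)) \<in> test_functions"
  using test_affine[of f 1 a] by simp


section \<open>Smooth cut-off functions\<close>

text \<open>The classical function that is flat at the origin. The powers \<open>t\<^sup>-\<^sup>k\<close> occur because each derivative
of \<open>exp (- 1/t)\<close> produces them.\<close>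

definition flat_exp :: "nat \<Rightarrow> real \<Rightarrow> real" where
  "flat_exp k t = (if t > 0 then exp (- 1 / t) / t ^ k else 0)"

text \<open>One term of the exponential series already gives \<open>exp (1/t) \<ge> t\<^sup>-\<^sup>k\<^sup>-\<^sup>2 / (k + 2)!\<close>. The quadratic bound
yields the vanishing derivative at the origin.\<close>

lemma flat_exp_bound: "\<bar>flat_exp k t\<bar> \<le> fact (k + 2) * t\<^sup>2"
proof (cases "t > 0")
  case True
  define F :: real where "F = fact (k + 2)"
  have "F > 0" by (simp add: F_def del: fact_Suc)
  have "(1 / t) ^ (k + 2) / F \<le> exp (1 / t)"
  proof -
    have "(\<Sum>n\<in>{k+2}. (1 / t) ^ n /\<^sub>R fact n) \<le> (\<Sum>n. (1 / t) ^ n /\<^sub>R fact n)"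
      using True by (intro sum_le_suminf summable_exp_generic) auto
    then show ?thesis by (simp add: exp_def F_def divide_inverse mult.commute del: fact_Suc)
  qed
  then have "exp (- 1 / t) / t ^ k \<le> F * t\<^sup>2"
    using True \<open>F > 0\<close> by (simp add: exp_minus field_simps power_add power2_eq_square)
  then show ?thesis using True by (simp add: flat_exp_def F_def del: fact_Suc)
qed (auto simp: flat_exp_def)

lemma DERIV_flat_exp: "(flat_exp k has_real_derivative (flat_exp (k + 2) t - real k * flat_exp (k + 1) t)) (at t)"
proof -
  consider "t > 0" | "t < 0" | "t = 0" by linarith
  then show ?thesis
  proof cases
    case 1
    have "((\<lambda>t. exp (- 1 / t) / t ^ k) has_real_derivative (flat_exp (k + 2) t - real k * flat_exp (k + 1) t)) (at t)"
      using 1 by (auto intro!: derivative_eq_intros simp: flat_exp_def field_simps power2_eq_square)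
        (cases k; simp add: field_simps)
    then show ?thesis
      by (rule DERIV_cong_ev[THEN iffD1, rotated -1])
        (use 1 in \<open>auto simp: flat_exp_def eventually_nhds intro!: exI[of _ "{0<..}"]\<close>)
  next
    case 2
    have "((\<lambda>t. 0) has_real_derivative (flat_exp (k + 2) t - real k * flat_exp (k + 1) t)) (at t)"
      using 2 by (simp add: flat_exp_def)
    then show ?thesis
      by (rule DERIV_cong_ev[THEN iffD1, rotated -1])
        (use 2 in \<open>auto simp: flat_exp_def eventually_nhds intro!: exI[of _ "{..<0}"]\<close>)
  next
    case 3
    have "((\<lambda>h. (flat_exp k (0 + h) - flat_exp k 0) / h) \<longlongrightarrow> 0) (at 0)"
    proof (rule tendsto_0_le[of "\<lambda>h. h" _ _ "fact (k + 2)"])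
      show "\<forall>\<^sub>F h in at 0. norm ((flat_exp k (0 + h) - flat_exp k 0) / h) \<le> norm h * fact (k + 2)"
      proof (rule eventually_at_filter[THEN iffD2], rule always_eventually, safe)
        fix h :: real assume "h \<noteq> 0"
        then show "norm ((flat_exp k (0 + h) - flat_exp k 0) / h) \<le> norm h * fact (k + 2)"
        proof -
          have "\<bar>flat_exp k h\<bar> / \<bar>h\<bar> \<le> fact (k + 2) * h\<^sup>2 / \<bar>h\<bar>"
            by (intro divide_right_mono flat_exp_bound) simp
          also have "\<dots> = \<bar>h\<bar> * fact (k + 2)"
            using \<open>h \<noteq> 0\<close> by (cases "h > 0") (simp_all add: power2_eq_square del: fact_Suc)
          finally show ?thesis by (simp add: flat_exp_def[of k 0] del: fact_Suc)
        qed
      qed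
    qed (rule tendsto_ident_at)
    then have "(flat_exp k has_real_derivative 0) (at 0)" by (simp only: DERIV_def)
    then show ?thesis unfolding 3 by (simp add: flat_exp_def[of _ 0])
  qed
qed

lemma smooth_flat_exp: "smooth (\<lambda>x::real^'n::finite. complex_of_real (flat_exp k (c * (1 - x \<bullet> x))))"
proof -
  let ?B = "\<lambda>k (x::real^'n). complex_of_real (flat_exp k (c * (1 - x \<bullet> x)))"
  let ?G = "range ?B \<union> Collect smooth"
  have der: "(?B k has_derivative (\<lambda>h. of_real ((flat_exp (k + 2) (c * (1 - x \<bullet> x)) -
      real k * flat_exp (k + 1) (c * (1 - x \<bullet> x))) * (c * (- (2 * (x \<bullet> h))))))) (at x)" for k x
  proof -
    have "((\<lambda>x. c * (1 - x \<bullet> x)) has_derivative (\<lambda>h. c * (- (2 * (x \<bullet> h))))) (at x)"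
      by (auto intro!: derivative_eq_intros simp: inner_commute)
    from has_derivative_compose[OF this DERIV_flat_exp[of k, unfolded has_field_derivative_def]]
    show ?thesis by (rule has_derivative_of_real)
  qed
  show ?thesis
  proof (rule function_algebra_smooth[of ?G])
    fix g i assume "g \<in> ?G"
    then consider k where "g = ?B k" | "smooth g" by auto
    then show "pd i g \<in> function_algebra ?G"
    proof cases
      case 1
      have "pd i g = (\<lambda>x. (?B (k + 2) x + (of_real (- real k)) * ?B (k + 1) x) * (of_real (- 2 * c) * of_real (x $ i)))"
        unfolding 1 by (rule ext, subst pd_eq[OF der]) (simp add: inner_axis)
      also have "\<dots> \<in> function_algebra ?G"
        by (intro function_algebra_mult function_algebra_base function_algebra_add) (auto intro: smooth_const smooth_coord)
      finally show ?thesis .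
    qed (auto intro: smooth_pd function_algebra_base)
  qed (auto intro: function_algebra_base smooth_differentiable differentiableI[OF der])
qed

lemma smooth_flat_exp_ball:
  assumes "r \<noteq> 0"
  shows "smooth (\<lambda>x::real^'n::finite. complex_of_real (flat_exp 0 (c * (1 - (norm (x - a) / r)\<^sup>2))))"
proof -
  have "(1 / r) *\<^sub>R x + (- 1 / r) *\<^sub>R a = (1 / r) *\<^sub>R (x - a)" for x :: "real^'n"
    by (simp add: scaleR_diff_right)
  with smooth_affine[OF smooth_flat_exp[of 0 c], of "1 / r" "(- 1 / r) *\<^sub>R a"] show ?thesis
    by (simp add: power2_norm_eq_inner[symmetric] power_divide)
qed

lemma flat_exp_0_nonneg: "flat_exp 0 t \<ge> 0" by (simp add: flat_exp_def)
lemma flat_exp_0_eq_0: "flat_exp 0 t = 0 \<longleftrightarrow> t \<le> 0" by (auto simp: flat_exp_def)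

text \<open>Cover \<open>K\<close> by finitely many balls of half the radius of balls inside \<open>U\<close>. Let \<open>P\<close> be a sum of bumps
that is positive exactly on the union of the large open balls, and \<open>Q\<close> a product that vanishes
exactly on the union of the small closed balls. Then \<open>P + Q\<close> has no zero and \<open>P / (P + Q)\<close> is the
cut-off function.\<close>

lemma cutoff_exists:
  fixes K :: "(real^'n::finite) set"
  assumes "compact K" "open U" "K \<subseteq> U"
  obtains \<eta> :: "real^'n \<Rightarrow> real" and V where
    "(\<lambda>x. complex_of_real (\<eta> x)) \<in> test_functions" "fun_support (\<lambda>x. complex_of_real (\<eta> x)) \<subseteq> U"
    "open V" "K \<subseteq> V" "\<And>x. x \<in> V \<Longrightarrow> \<eta> x = 1" "\<And>x. 0 \<le> \<eta> x" "\<And>x. \<eta> x \<le> 1"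
proof -
  have "\<exists>r>0. cball x r \<subseteq> U" if "x \<in> K" for x using assms that open_contains_cball by blast
  then obtain r where r: "\<And>x. x \<in> K \<Longrightarrow> r x > 0" "\<And>x. x \<in> K \<Longrightarrow> cball x (r x) \<subseteq> U" by metis
  have "K \<subseteq> (\<Union>x\<in>K. ball x (r x / 2))" using r by force
  then obtain A where A: "A \<subseteq> K" "finite A" "K \<subseteq> (\<Union>x\<in>A. ball x (r x / 2))"
    using compactE_image[OF assms(1), of K "\<lambda>x. ball x (r x / 2)"] by auto
  have rA: "a \<in> A \<Longrightarrow> r a > 0" for a using A(1) r(1) by blast
  define P where "P x = (\<Sum>a\<in>A. flat_exp 0 (1 * (1 - (norm (x - a) / r a)\<^sup>2)))" for x :: "real^'n"
  define Q where "Q x = (\<Prod>a\<in>A. flat_exp 0 ((- 1) * (1 - (norm (x - a) / (r a / 2))\<^sup>2)))" for x :: "real^'n"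
  have P0: "P x \<ge> 0" "Q x \<ge> 0" for x by (auto simp: P_def Q_def flat_exp_0_nonneg sum_nonneg prod_nonneg)
  have c1: "1 - (t / s)\<^sup>2 > 0 \<longleftrightarrow> t < s" if "t \<ge> 0" "s > 0" for t s :: real
    using that by (auto simp: field_simps power2_eq_square) (smt (verit) mult_mono mult_strict_mono')+
  have Ppos: "P x > 0 \<longleftrightarrow> (\<exists>a\<in>A. norm (x - a) < r a)" for x
  proof -
    have "P x = 0 \<longleftrightarrow> (\<forall>a\<in>A. \<not> norm (x - a) < r a)"
    proof -
      have "flat_exp 0 (1 * (1 - (norm (x - a) / r a)\<^sup>2)) = 0 \<longleftrightarrow> \<not> norm (x - a) < r a" if "a \<in> A" for a
        unfolding flat_exp_0_eq_0 c1[OF norm_ge_zero rA[OF that], symmetric] by auto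
      then show ?thesis unfolding P_def using sum_nonneg_eq_0_iff[OF A(2) flat_exp_0_nonneg] by simp
    qed
    then show ?thesis using P0(1)[of x] by auto
  qed
  have Q0: "Q x = 0 \<longleftrightarrow> (\<exists>a\<in>A. norm (x - a) \<le> r a / 2)" for x
  proof -
    have "(- 1) * (1 - (t / s)\<^sup>2) \<le> 0 \<longleftrightarrow> t \<le> s" if "t \<ge> 0" "s > 0" for t s :: real
      using that abs_le_square_iff[of "t/s" 1] by (simp add: field_simps)
    then show ?thesis unfolding Q_def using A(2) rA by (auto simp: flat_exp_0_eq_0 simp del: mult_minus1)
  qed
  have PQ: "P x + Q x > 0" for x
  proof (cases "Q x = 0")
    case True
    then have "P x > 0" unfolding Q0 Ppos using rA by force
    then show ?thesis using True by simp
  qed (use P0[of x] in linarith)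
  define \<eta> where "\<eta> x = P x * inverse (P x + Q x)" for x
  have sP: "smooth (\<lambda>x. complex_of_real (P x))"
    unfolding P_def of_real_sum by (intro smooth_sum smooth_flat_exp_ball) (use rA in force)
  have sQ: "smooth (\<lambda>x. complex_of_real (Q x))"
    unfolding Q_def of_real_prod by (intro smooth_prod smooth_flat_exp_ball) (use rA in force)
  have sc: "smooth (\<lambda>x. complex_of_real (\<eta> x))"
    unfolding \<eta>_def of_real_mult of_real_inverse of_real_add
    by (intro smooth_mult smooth_inverse smooth_add sP sQ) (use PQ in \<open>metis less_irrefl of_real_add of_real_eq_0_iff\<close>)
  define S where "S = (\<Union>a\<in>A. cball a (r a))"
  have S: "compact S" "S \<subseteq> U" using A r(2) by (auto simp: S_def)
  have z: "complex_of_real (\<eta> x) = 0" if "x \<notin> S" for x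
  proof -
    have "\<not> P x > 0" using that unfolding Ppos S_def by (force simp: dist_norm norm_minus_commute)
    then show ?thesis using P0(1)[of x] by (simp add: \<eta>_def)
  qed
  show thesis
  proof (rule that)
    show "(\<lambda>x. complex_of_real (\<eta> x)) \<in> test_functions" by (rule test_functionI[OF sc S(1) z])
    have "fun_support (\<lambda>x. complex_of_real (\<eta> x)) \<subseteq> S"
      by (rule fun_supportI) (use z S compact_imp_closed in auto)
    then show "fun_support (\<lambda>x. complex_of_real (\<eta> x)) \<subseteq> U" using S by simp
    show "open (\<Union>x\<in>A. ball x (r x / 2))" by auto
    show "\<eta> x = 1" if "x \<in> (\<Union>x\<in>A. ball x (r x / 2))" for x
    proof -
      have "Q x = 0" unfolding Q0 using that by (force simp: dist_norm norm_minus_commute)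
      then show ?thesis using PQ[of x] by (simp add: \<eta>_def)
    qed
    show "0 \<le> \<eta> x" "\<eta> x \<le> 1" for x using P0[of x] PQ[of x] by (auto simp: \<eta>_def field_simps)
  qed (use A in auto)
qed

section \<open>Integration on Euclidean space\<close>

lemma lborel_affine_integral:
  fixes f :: "'a::euclidean_space \<Rightarrow> complex"
  assumes [measurable]: "f \<in> borel_measurable borel" and c: "c \<noteq> 0"
  shows "(LINT x|lborel. f x) = of_real (\<bar>c\<bar> ^ DIM('a)) * (LINT x|lborel. f (a + c *\<^sub>R x))"
  by (subst lborel_affine[OF c, of a])
    (simp add: integral_density integral_distr scaleR_conv_of_real)

lemma lborel_affine_nn_integral:
  fixes f :: "'a::euclidean_space \<Rightarrow> ennreal"
  assumes [measurable]: "f \<in> borel_measurable borel" and c: "c \<noteq> 0"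
  shows "(\<integral>\<^sup>+x. f x \<partial>lborel) = ennreal (\<bar>c\<bar> ^ DIM('a)) * (\<integral>\<^sup>+x. f (a + c *\<^sub>R x) \<partial>lborel)"
  by (subst lborel_affine[OF c, of a])
    (simp add: nn_integral_density nn_integral_distr nn_integral_cmult ennreal_power)

lemma lborel_translate_integral:
  fixes f :: "'a::euclidean_space \<Rightarrow> complex"
  assumes "f \<in> borel_measurable borel"
  shows "(LINT x|lborel. f (x + a)) = (LINT x|lborel. f x)"
  using lborel_affine_integral[OF assms, of 1 a] by (simp add: add.commute)

lemma lborel_reflect_integral:
  fixes f :: "'a::euclidean_space \<Rightarrow> complex"
  assumes "f \<in> borel_measurable borel"
  shows "(LINT x|lborel. f (- x)) = (LINT x|lborel. f x)"
  using lborel_affine_integral[OF assms, of "- 1" 0] by simp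

lemma lborel_translate_nn_integral:
  fixes f :: "'a::euclidean_space \<Rightarrow> ennreal"
  assumes "f \<in> borel_measurable borel"
  shows "(\<integral>\<^sup>+x. f (x + a) \<partial>lborel) = (\<integral>\<^sup>+x. f x \<partial>lborel)"
  using lborel_affine_nn_integral[OF assms, of 1 a] by (simp add: add.commute)

lemma lborel_integral_prod:
  fixes f :: "'a::euclidean_space \<Rightarrow> real \<Rightarrow> complex"
  assumes "\<And>b. b \<in> Basis \<Longrightarrow> integrable lborel (f b)"
  shows "integrable lborel (\<lambda>x::'a. \<Prod>b\<in>Basis. f b (x \<bullet> b))"
    and "(LINT x|lborel. (\<Prod>b\<in>Basis. f b (x \<bullet> b))) = (\<Prod>b\<in>Basis. LINT x|lborel. f b x)"
proof -
  interpret product_sigma_finite "\<lambda>b::'a. lborel :: real measure" ..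
  have [measurable]: "f b \<in> borel_measurable borel" if "b \<in> Basis" for b
    using assms[OF that] by (simp add: borel_measurable_integrable)
  have e: "(\<Prod>b\<in>Basis. f b ((\<Sum>c\<in>Basis. y c *\<^sub>R c) \<bullet> b)) = (\<Prod>b\<in>Basis. f b (y b))" for y
    by (intro prod.cong) auto
  show "integrable lborel (\<lambda>x::'a. \<Prod>b\<in>Basis. f b (x \<bullet> b))"
    unfolding lborel_eq[where 'a='a] by (subst integrable_distr_eq) (auto simp: e intro!: product_integrable_prod assms)
  show "(LINT x|lborel. (\<Prod>b\<in>Basis. f b (x \<bullet> b))) = (\<Prod>b\<in>Basis. LINT x|lborel. f b x)"
    unfolding lborel_eq[where 'a='a] by (subst integral_distr) (auto simp: e intro!: product_integral_prod assms)
qed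

text \<open>An integrable power of \<open>1 + |x|\<close>: as \<open>1 + x\<^sub>i\<^sup>2 \<le> (1 + |x|)\<^sup>2\<close>, it is at most \<open>\<Prod>\<^sub>i 1 / (1 + x\<^sub>i\<^sup>2)\<close>.\<close>

abbreviation weight :: "real^'n::finite \<Rightarrow> real" where
  "weight x \<equiv> inverse ((1 + norm x) ^ (2 * CARD('n)))"

lemma weight_integrable: "integrable lborel (weight :: real^'n::finite \<Rightarrow> real)"
proof -
  have 1: "integrable lborel (\<lambda>t::real. complex_of_real (inverse (1 + t\<^sup>2)))"
    using integrable_inverse_1_plus_square by (intro integrable_of_real) (simp add: set_integrable_def)
  have "integrable lborel (\<lambda>x::real^'n. \<Prod>b\<in>Basis. complex_of_real (inverse (1 + (x \<bullet> b)\<^sup>2)))"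
    by (rule lborel_integral_prod(1)[OF 1])
  then show ?thesis
  proof (rule Bochner_Integration.integrable_bound)
    have "norm (weight x) \<le> norm (\<Prod>b\<in>Basis. complex_of_real (inverse (1 + (x \<bullet> b)\<^sup>2)))" for x :: "real^'n"
    proof -
      have "(\<Prod>b\<in>Basis. (1 + (x \<bullet> b)\<^sup>2)) \<le> (\<Prod>b\<in>(Basis::(real^'n) set). (1 + norm x) ^ 2)"
      proof (intro prod_mono conjI)
        fix b :: "real^'n" assume "b \<in> Basis"
        then have "(x \<bullet> b)\<^sup>2 \<le> (norm x)\<^sup>2" using Basis_le_norm[of b x] by (metis abs_ge_zero power2_abs power_mono)
        then show "1 + (x \<bullet> b)\<^sup>2 \<le> (1 + norm x)\<^sup>2" using norm_ge_zero[of x] by (simp add: power2_sum add_increasing2)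
      qed (simp add: add_nonneg_nonneg)
      also have "\<dots> = (1 + norm x) ^ (2 * CARD('n))" by (simp add: power_mult)
      finally have "inverse ((1 + norm x) ^ (2 * CARD('n))) \<le> inverse (\<Prod>b\<in>Basis. (1 + (x \<bullet> b)\<^sup>2))"
        by (intro le_imp_inverse_le prod_pos) (auto simp: add_pos_nonneg)
      also have "\<dots> = \<bar>\<Prod>b\<in>Basis. inverse (1 + (x \<bullet> b)\<^sup>2)\<bar>"
        by (subst abs_of_nonneg) (auto intro!: prod_nonneg simp: o_def simp flip: prod_inversef)
      also have "\<dots> = norm (\<Prod>b\<in>Basis. complex_of_real (inverse (1 + (x \<bullet> b)\<^sup>2)))"
        unfolding of_real_prod[symmetric] norm_of_real ..
      finally show ?thesis by (simp add: abs_of_nonneg)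
    qed
    then show "AE x::real^'n in lborel. norm (weight x) \<le> norm (\<Prod>b\<in>Basis. complex_of_real (inverse (1 + (x \<bullet> b)\<^sup>2)))"
      by simp
  qed measurable
qed

lemma rapid_integrable:
  fixes f :: "real^'n::finite \<Rightarrow> complex"
  assumes "rapid f" "f \<in> borel_measurable borel" shows "integrable lborel f"
proof -
  from rapidD[OF assms(1), of "2 * CARD('n)"] obtain C
    where C: "C > 0" "\<And>x. (1 + norm x) ^ (2 * CARD('n)) * norm (f x) \<le> C" by metis
  have "integrable lborel (\<lambda>x::real^'n. C * weight x)" by (intro integrable_mult_right weight_integrable)
  then show ?thesis
  proof (rule Bochner_Integration.integrable_bound)
    show "AE x in lborel. norm (f x) \<le> norm (C * weight x)"
    proof (intro always_eventually allI)
      fix x :: "real^'n"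
      have "(1 + norm x) ^ (2 * CARD('n)) > 0" by (simp add: add_pos_nonneg)
      then show "norm (f x) \<le> norm (C * weight x)" using C(1) C(2)[of x]
        by (simp add: abs_mult field_simps)
    qed
  qed (use assms in simp)
qed

lemma schwartz_measurable [measurable_dest]: "f \<in> schwartz \<Longrightarrow> f \<in> borel_measurable borel"
  by (intro smooth_measurable schwartz_smooth)

lemma schwartz_integrable: "f \<in> schwartz \<Longrightarrow> integrable lborel f"
  by (intro rapid_integrable schwartz_rapid schwartz_measurable)


section \<open>The Fourier transform on Schwartz functions\<close>

lemma norm_exp_i [simp]: "norm (exp (- (\<i> * complex_of_real t))) = 1" "norm (exp (\<i> * complex_of_real t)) = 1"
  by (simp_all add: norm_exp_eq_Re)

lemma integrable_exp_mult:
  assumes "integrable lborel f"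
  shows "integrable lborel (\<lambda>x. exp (- \<i> * of_real (x \<bullet> \<xi>)) * f x)"
    "integrable lborel (\<lambda>x. exp (\<i> * of_real (x \<bullet> \<xi>)) * f x)"
proof -
  have [measurable]: "f \<in> borel_measurable borel" using assms by auto
  show "integrable lborel (\<lambda>x. exp (- \<i> * of_real (x \<bullet> \<xi>)) * f x)"
    by (rule Bochner_Integration.integrable_bound[OF assms]) (auto simp: norm_mult)
  show "integrable lborel (\<lambda>x. exp (\<i> * of_real (x \<bullet> \<xi>)) * f x)"
    by (rule Bochner_Integration.integrable_bound[OF assms]) (auto simp: norm_mult)
qed

lemma fourier_bound: "norm (fourier f \<xi>) \<le> (LINT x|lborel. norm (f x))"
proof -
  have "norm (fourier f \<xi>) \<le> (LINT x|lborel. norm (exp (- \<i> * of_real (x \<bullet> \<xi>)) * f x))"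
    unfolding fourier_def by (rule integral_norm_bound)
  then show ?thesis by (simp add: norm_mult)
qed

lemma fourier_add:
  "integrable lborel f \<Longrightarrow> integrable lborel g \<Longrightarrow> fourier (\<lambda>x. f x + g x) = (\<lambda>\<xi>. fourier f \<xi> + fourier g \<xi>)"
  unfolding fourier_def by (simp only: distrib_left Bochner_Integration.integral_add integrable_exp_mult)

lemma fourier_cmult: "fourier (\<lambda>x. c * f x) = (\<lambda>\<xi>. c * fourier f \<xi>)"
  unfolding fourier_def by (simp add: mult.left_commute)

lemma inverse_fourier_fourier:
  fixes f :: "real^'n::finite \<Rightarrow> complex"
  shows "inverse_fourier f x = of_real (1 / (2 * pi) ^ CARD('n)) * fourier f (- x)"
  unfolding inverse_fourier_def fourier_def by (simp add: inner_commute)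

lemma fourier_translate:
  assumes [measurable]: "f \<in> borel_measurable borel"
  shows "fourier (\<lambda>x. f (x + a)) \<xi> = exp (\<i> * of_real (a \<bullet> \<xi>)) * fourier f \<xi>"
proof -
  have "fourier (\<lambda>x. f (x + a)) \<xi> =
      (LINT x|lborel. exp (\<i> * of_real (a \<bullet> \<xi>)) * (exp (- \<i> * of_real ((x + a) \<bullet> \<xi>)) * f (x + a)))"
    unfolding fourier_def
    by (intro Bochner_Integration.integral_cong) (auto simp: inner_add_left exp_diff exp_minus field_simps exp_add ring_distribs)
  also have "\<dots> = exp (\<i> * of_real (a \<bullet> \<xi>)) * (LINT x|lborel. exp (- \<i> * of_real ((x + a) \<bullet> \<xi>)) * f (x + a))"
    by simp
  also have "\<dots> = exp (\<i> * of_real (a \<bullet> \<xi>)) * fourier f \<xi>"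
    unfolding fourier_def
    by (subst lborel_translate_integral[of "\<lambda>x. exp (- \<i> * of_real (x \<bullet> \<xi>)) * f x"]) auto
  finally show ?thesis .
qed

text \<open>The estimate \<open>|e\<^sup>-\<^sup>i\<^sup>t - 1 + i t| \<le> t\<^sup>2\<close> with \<open>t = \<langle>x, h\<rangle>\<close> bounds the remainder by \<open>|h|\<^sup>2 \<integral> |x|\<^sup>2 |f(x)| dx\<close>.\<close>

lemma fourier_has_derivative:
  fixes f :: "real^'n::finite \<Rightarrow> complex"
  assumes f: "f \<in> schwartz"
  shows "(fourier f has_derivative (\<lambda>h. \<Sum>i\<in>UNIV. of_real (h $ i) * fourier (\<lambda>x. - \<i> * of_real (x $ i) * f x) \<xi>)) (at \<xi>)"
proof -
  define D where "D h = (\<Sum>i\<in>UNIV. of_real (h $ i) * fourier (\<lambda>x. - \<i> * of_real (x $ i) * f x) \<xi>)" for h :: "real^'n"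
  define C where "C = (LINT x|lborel. norm ((norm x)\<^sup>2 * f x))"
  note [measurable] = schwartz_measurable[OF f]
  have xf: "(\<lambda>x. - \<i> * of_real (x $ i) * f x) \<in> schwartz" for i
    by (intro schwartz_mult_slow slow_mult slow_const slow_coord f)
  have x2f: "integrable lborel (\<lambda>x. complex_of_real ((norm x)\<^sup>2) * f x)"
  proof -
    have "integrable lborel (\<lambda>x. \<Sum>i\<in>UNIV. of_real (x $ i) * (of_real (x $ i) * f x))"
      by (intro schwartz_integrable schwartz_sum schwartz_mult_slow slow_coord f)
    moreover have "(\<Sum>i\<in>UNIV. of_real (x $ i) * (of_real (x $ i) * f x)) = complex_of_real ((norm x)\<^sup>2) * f x" for x
      by (simp add: norm_vec_def L2_set_def sum_nonneg power2_eq_square sum_distrib_right mult.assoc)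
    ultimately show ?thesis by simp
  qed
  have bl: "bounded_linear D"
    unfolding D_def by (intro bounded_linear_sum bounded_linear_mult_left[THEN bounded_linear_compose] bounded_linear_of_real[THEN bounded_linear_compose] bounded_linear_vec_nth)
  have est: "norm (fourier f (\<xi> + h) - fourier f \<xi> - D h) \<le> C * (norm h)\<^sup>2" for h
  proof -
    let ?e = "\<lambda>x. exp (- \<i> * of_real (x \<bullet> \<xi>))"
    have Dh: "D h = (LINT x|lborel. ?e x * (- \<i> * of_real (x \<bullet> h) * f x))"
    proof -
      have "D h = (\<Sum>i\<in>UNIV. LINT x|lborel. of_real (h $ i) * (?e x * (- \<i> * of_real (x $ i) * f x)))"
        unfolding D_def fourier_def by simp
      also have "\<dots> = (LINT x|lborel. (\<Sum>i\<in>UNIV. of_real (h $ i) * (?e x * (- \<i> * of_real (x $ i) * f x))))"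
        by (rule Bochner_Integration.integral_sum[symmetric])
          (intro integrable_mult_right integrable_exp_mult schwartz_integrable xf)
      also have "\<dots> = (LINT x|lborel. ?e x * (- \<i> * of_real (x \<bullet> h) * f x))"
        by (intro Bochner_Integration.integral_cong refl)
          (simp add: inner_vec_def sum_distrib_left sum_distrib_right mult_ac)
      finally show ?thesis .
    qed
    have ih: "integrable lborel (\<lambda>x. ?e x * (- \<i> * of_real (x \<bullet> h) * f x))"
    proof -
      have "integrable lborel (\<lambda>x. \<Sum>i\<in>UNIV. of_real (h $ i) * (?e x * (- \<i> * of_real (x $ i) * f x)))"
        by (intro Bochner_Integration.integrable_sum integrable_mult_right integrable_exp_mult schwartz_integrable xf)
      moreover have "(\<Sum>i\<in>UNIV. of_real (h $ i) * (?e x * (- \<i> * of_real (x $ i) * f x))) = ?e x * (- \<i> * of_real (x \<bullet> h) * f x)" for x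
        by (simp add: inner_vec_def sum_distrib_left sum_distrib_right mult_ac)
      ultimately show ?thesis by simp
    qed
    have "fourier f (\<xi> + h) - fourier f \<xi> - D h =
       (LINT x|lborel. exp (- \<i> * of_real (x \<bullet> (\<xi> + h))) * f x - ?e x * f x - ?e x * (- \<i> * of_real (x \<bullet> h) * f x))"
      unfolding Dh fourier_def
      by (simp only: Bochner_Integration.integral_diff Bochner_Integration.integrable_diff integrable_exp_mult(1)[OF schwartz_integrable[OF f]] ih)
    also have "norm \<dots> \<le> (LINT x|lborel. (norm h)\<^sup>2 * norm (complex_of_real ((norm x)\<^sup>2) * f x))"
    proof (rule Bochner_Integration.integral_norm_bound_integral)
      show "integrable lborel (\<lambda>x. exp (- \<i> * of_real (x \<bullet> (\<xi> + h))) * f x - ?e x * f x - ?e x * (- \<i> * of_real (x \<bullet> h) * f x))"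
        by (intro Bochner_Integration.integrable_diff ih integrable_exp_mult schwartz_integrable f)
      show "integrable lborel (\<lambda>x. (norm h)\<^sup>2 * norm (complex_of_real ((norm x)\<^sup>2) * f x))"
        by (intro integrable_mult_right integrable_norm x2f)
      fix x :: "real^'n"
      let ?t = "- (x \<bullet> h)"
      have "exp (- \<i> * of_real (x \<bullet> (\<xi> + h))) * f x - ?e x * f x - ?e x * (- \<i> * of_real (x \<bullet> h) * f x)
          = ?e x * f x * (iexp ?t - (\<Sum>k\<le>1. (\<i> * ?t) ^ k / fact k))"
        by (simp add: inner_add_right exp_diff exp_minus exp_add ring_distribs field_simps)
      also have "norm \<dots> \<le> norm (f x) * (\<bar>?t\<bar> ^ 2 / 2)"
        using iexp_approx1[of ?t 1] unfolding Suc_1 fact_2 norm_mult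
        by (intro mult_mono) auto
      also have "\<dots> \<le> norm (f x) * (norm x * norm h)\<^sup>2"
      proof (intro mult_left_mono)
        have "\<bar>?t\<bar> ^ 2 \<le> (norm x * norm h)\<^sup>2"
          by (intro power_mono) (auto intro: Cauchy_Schwarz_ineq2)
        then show "\<bar>?t\<bar> ^ 2 / 2 \<le> (norm x * norm h)\<^sup>2" by (smt (verit) field_sum_of_halves zero_le_power2)
      qed simp
      finally show "norm (exp (- \<i> * of_real (x \<bullet> (\<xi> + h))) * f x - ?e x * f x - ?e x * (- \<i> * of_real (x \<bullet> h) * f x))
          \<le> (norm h)\<^sup>2 * norm (complex_of_real ((norm x)\<^sup>2) * f x)"
        by (simp add: norm_mult power_mult_distrib mult_ac norm_power)
    qed
    also have "\<dots> = C * (norm h)\<^sup>2" by (simp add: C_def norm_mult norm_power mult.commute)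
    finally show ?thesis .
  qed
  have "((\<lambda>h. norm (fourier f (\<xi> + h) - fourier f \<xi> - D h) / norm h) \<longlongrightarrow> 0) (at 0)"
  proof (rule tendsto_0_le[of "\<lambda>h. norm h" _ _ C])
    show "((\<lambda>h. norm h) \<longlongrightarrow> 0) (at (0::real^'n))" by (intro tendsto_norm_zero tendsto_ident_at)
    show "\<forall>\<^sub>F h in at 0. norm (norm (fourier f (\<xi> + h) - fourier f \<xi> - D h) / norm h) \<le> norm (norm h) * C"
    proof (rule eventually_at_filter[THEN iffD2], rule always_eventually, safe)
      fix h :: "real^'n" assume "h \<noteq> 0"
      then show "norm (norm (fourier f (\<xi> + h) - fourier f \<xi> - D h) / norm h) \<le> norm (norm h) * C"
        using est[of h] by (simp add: field_simps power2_eq_square)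
    qed
  qed
  with bl show ?thesis unfolding D_def by (simp add: has_derivative_at)
qed

lemma pd_fourier:
  assumes f: "f \<in> schwartz" shows "pd i (fourier f) = fourier (\<lambda>x. - \<i> * of_real (x $ i) * f x)"
proof
  fix \<xi>
  let ?G = "\<lambda>k. fourier (\<lambda>x. - \<i> * of_real (x $ k) * f x) \<xi>"
  have "(\<Sum>k\<in>UNIV. of_real (axis i 1 $ k) * ?G k) = (\<Sum>k\<in>UNIV. if k = i then ?G k else 0)"
    by (intro sum.cong) (auto simp: axis_def)
  then show "pd i (fourier f) \<xi> = ?G i"
    unfolding pd_eq[OF fourier_has_derivative[OF f]] by simp
qed

text \<open>The transform of the difference quotient of \<open>f\<close> along the \<open>i\<close>-th axis is
\<open>(e\<^sup>i\<^sup>h\<^sup>\<xi>\<^sup>i - 1) / h\<close> times the transform of \<open>f\<close>. As \<open>h \<rightarrow> 0\<close>, dominated convergence applies on the left,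
the quotients being bounded through the mean value theorem.\<close>

lemma fourier_pd:
  fixes f :: "real^'n::finite \<Rightarrow> complex"
  assumes f: "f \<in> schwartz" shows "fourier (pd i f) \<xi> = \<i> * of_real (\<xi> $ i) * fourier f \<xi>"
proof -
  note [measurable] = schwartz_measurable[OF f] schwartz_measurable[OF schwartz_pd[OF f]]
  define v :: "real^'n" where "v = axis i 1"
  define h where "h k = inverse (real (Suc k))" for k
  have h: "0 < h k" "h k \<le> 1" for k by (auto simp: h_def field_simps)
  have h0: "filterlim h (at 0) sequentially"
    unfolding h_def filterlim_at using LIMSEQ_inverse_real_of_nat by auto
  let ?e = "\<lambda>x. exp (- \<i> * of_real (x \<bullet> \<xi>))"
  from rapidD[OF schwartz_rapid[OF schwartz_pd[OF f]], where k="2 * CARD('n)"] obtain C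
    where C: "C > 0" "\<And>x. (1 + norm x) ^ (2 * CARD('n)) * norm (pd i f x) \<le> C" by metis
  have der: "((\<lambda>t. f (x + t *\<^sub>R v)) has_derivative (\<lambda>s. of_real s * pd i f (x + t *\<^sub>R v))) (at t)" for x t
  proof -
    have D: "f differentiable (at (x + t *\<^sub>R v))" using f by (intro smooth_differentiable schwartz_smooth)
    have "((\<lambda>t. x + t *\<^sub>R v) has_derivative (\<lambda>s. s *\<^sub>R v)) (at t)" by (auto intro!: derivative_eq_intros)
    from diff_chain_at[OF this differentiable_has_derivative[OF D]]
    have "((\<lambda>t. f (x + t *\<^sub>R v)) has_derivative (\<lambda>s. frechet_derivative f (at (x + t *\<^sub>R v)) (s *\<^sub>R v))) (at t)"
      by (simp add: o_def)
    moreover have "frechet_derivative f (at (x + t *\<^sub>R v)) (s *\<^sub>R v) = of_real s * pd i f (x + t *\<^sub>R v)" for s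
      by (simp only: linear_scale[OF linear_frechet_derivative[OF D]]) (simp add: pd_def v_def scaleR_conv_of_real)
    ultimately show ?thesis by simp
  qed
  have conv: "(\<lambda>k. (f (x + h k *\<^sub>R v) - f x) / of_real (h k)) \<longlonglongrightarrow> pd i f x" for x
  proof -
    have "((\<lambda>t. f (x + t *\<^sub>R v)) has_vector_derivative pd i f x) (at 0)"
      using der[of x 0] by (simp add: has_vector_derivative_def scaleR_conv_of_real)
    then have "((\<lambda>t. norm (f (x + t *\<^sub>R v) - f x - t *\<^sub>R pd i f x) / \<bar>t\<bar>) \<longlongrightarrow> 0) (at 0)"
      by (simp add: has_vector_derivative_def has_derivative_at)
    then have "((\<lambda>t. norm ((f (x + t *\<^sub>R v) - f x) /\<^sub>R t - pd i f x)) \<longlongrightarrow> 0) (at 0)"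
    proof (rule Lim_transform_eventually)
      have "norm (f (x + t *\<^sub>R v) - f x - t *\<^sub>R pd i f x) / \<bar>t\<bar> = norm ((f (x + t *\<^sub>R v) - f x) /\<^sub>R t - pd i f x)"
        if "t \<noteq> 0" for t
      proof -
        have "(f (x + t *\<^sub>R v) - f x) /\<^sub>R t - pd i f x = (f (x + t *\<^sub>R v) - f x - t *\<^sub>R pd i f x) /\<^sub>R t"
          using that by (simp add: scaleR_diff_right)
        then show ?thesis by (simp add: divide_inverse mult.commute)
      qed
      then show "\<forall>\<^sub>F t in at 0. norm (f (x + t *\<^sub>R v) - f x - t *\<^sub>R pd i f x) / \<bar>t\<bar> =
          norm ((f (x + t *\<^sub>R v) - f x) /\<^sub>R t - pd i f x)"
        by (auto simp: eventually_at_filter)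
    qed
    then have "((\<lambda>t. (f (x + t *\<^sub>R v) - f x) /\<^sub>R t) \<longlongrightarrow> pd i f x) (at 0)"
      by (simp add: tendsto_norm_zero_iff LIM_zero_iff)
    from filterlim_compose[OF this h0] show ?thesis
      by (simp add: scaleR_conv_of_real divide_inverse mult.commute)
  qed
  have bound: "norm ((f (x + h k *\<^sub>R v) - f x) / of_real (h k)) \<le> 2 ^ (2 * CARD('n)) * C * weight x" for x k
  proof -
    have "continuous_on {0..h k} (\<lambda>t. f (x + t *\<^sub>R v))"
      using der by (intro continuous_at_imp_continuous_on) (blast intro: has_derivative_continuous)
    from mvt_general[OF h(1)[of k] this der]
    obtain t where t: "0 < t" "t < h k" and
      le: "norm (f (x + h k *\<^sub>R v) - f x) \<le> norm (of_real (h k) * pd i f (x + t *\<^sub>R v))" by auto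
    have "norm ((f (x + h k *\<^sub>R v) - f x) / of_real (h k)) \<le> norm (pd i f (x + t *\<^sub>R v))"
      using le h(1)[of k] by (simp add: norm_mult norm_divide field_simps)
    also have "\<dots> \<le> C * weight (x + t *\<^sub>R v)"
    proof -
      have "(1 + norm (x + t *\<^sub>R v)) ^ (2 * CARD('n)) > 0" by (simp add: add_pos_nonneg)
      then show ?thesis using C(2)[of "x + t *\<^sub>R v"] by (simp add: field_simps)
    qed
    also have "\<dots> \<le> C * (2 ^ (2 * CARD('n)) * weight x)"
    proof (intro mult_left_mono)
      have "norm (t *\<^sub>R v) \<le> 1" using t h(2)[of k] by (simp add: v_def)
      moreover define N where "N = norm (x + t *\<^sub>R v)"
      ultimately have "norm x \<le> N + 1" using norm_triangle_ineq4[of "x + t *\<^sub>R v" "t *\<^sub>R v"] by simp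
      moreover have "N \<ge> 0" by (simp add: N_def)
      ultimately have "1 + norm x \<le> (N + 1) + (N + 1)" by (intro add_mono) auto
      then have "1 + norm x \<le> 2 * (1 + norm (x + t *\<^sub>R v))" unfolding N_def[symmetric] by simp
      then have "(1 + norm x) ^ (2 * CARD('n)) \<le> 2 ^ (2 * CARD('n)) * (1 + norm (x + t *\<^sub>R v)) ^ (2 * CARD('n))"
        unfolding power_mult_distrib[symmetric] by (intro power_mono) auto
      moreover have "(1 + norm x) ^ (2 * CARD('n)) > 0" "(1 + norm (x + t *\<^sub>R v)) ^ (2 * CARD('n)) > 0"
        by (simp_all add: add_pos_nonneg)
      ultimately show "weight (x + t *\<^sub>R v) \<le> 2 ^ (2 * CARD('n)) * weight x"
        by (simp add: field_simps)
    qed (use C in simp)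
    finally show ?thesis by (simp add: mult_ac)
  qed
  have L1: "(\<lambda>k. LINT x|lborel. ?e x * ((f (x + h k *\<^sub>R v) - f x) / of_real (h k))) \<longlonglongrightarrow> (LINT x|lborel. ?e x * pd i f x)"
  proof (rule integral_dominated_convergence[where w="\<lambda>x. 2 ^ (2 * CARD('n)) * C * weight x"])
    show "integrable lborel (\<lambda>x::real^'n. 2 ^ (2 * CARD('n)) * C * weight x)"
      by (intro integrable_mult_right weight_integrable)
    show "AE x in lborel. (\<lambda>k. ?e x * ((f (x + h k *\<^sub>R v) - f x) / of_real (h k))) \<longlonglongrightarrow> ?e x * pd i f x"
      by (intro always_eventually allI tendsto_mult conv tendsto_const)
    show "AE x in lborel. norm (?e x * ((f (x + h k *\<^sub>R v) - f x) / of_real (h k))) \<le> 2 ^ (2 * CARD('n)) * C * weight x" for k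
    proof (intro always_eventually allI)
      fix x show "norm (?e x * ((f (x + h k *\<^sub>R v) - f x) / of_real (h k))) \<le> 2 ^ (2 * CARD('n)) * C * weight x"
        using bound[of x k] by (subst norm_mult) simp
    qed
  qed measurable
  have L2: "(LINT x|lborel. ?e x * ((f (x + h k *\<^sub>R v) - f x) / of_real (h k))) =
      ((exp (\<i> * of_real (\<xi> $ i) * of_real (h k)) - 1) / of_real (h k)) * fourier f \<xi>" for k
  proof -
    have "(LINT x|lborel. ?e x * ((f (x + h k *\<^sub>R v) - f x) / of_real (h k))) =
       (LINT x|lborel. (?e x * f (x + h k *\<^sub>R v) - ?e x * f x) / of_real (h k))"
      by (simp add: right_diff_distrib)
    also have "\<dots> = (fourier (\<lambda>x. f (x + h k *\<^sub>R v)) \<xi> - fourier f \<xi>) / of_real (h k)"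
      unfolding fourier_def
      by (subst Bochner_Integration.integral_diff[symmetric])
        (intro integrable_exp_mult schwartz_integrable schwartz_translate f, intro integrable_exp_mult schwartz_integrable f, simp)
    also have "\<dots> = ((exp (\<i> * of_real (\<xi> $ i) * of_real (h k)) - 1) / of_real (h k)) * fourier f \<xi>"
      by (subst fourier_translate) (simp_all add: v_def inner_axis' left_diff_distrib right_diff_distrib diff_divide_distrib mult_ac)
    finally show ?thesis .
  qed
  have L3: "(\<lambda>k. ((exp (\<i> * of_real (\<xi> $ i) * of_real (h k)) - 1) / of_real (h k)) * fourier f \<xi>) \<longlonglongrightarrow>
      (\<i> * of_real (\<xi> $ i)) * fourier f \<xi>"
  proof (intro tendsto_mult tendsto_const)
    have "((\<lambda>z. exp (\<i> * of_real (\<xi> $ i) * z)) has_field_derivative (\<i> * of_real (\<xi> $ i))) (at 0)"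
      by (auto intro!: derivative_eq_intros)
    then have "((\<lambda>z. (exp (\<i> * of_real (\<xi> $ i) * z) - 1) / z) \<longlongrightarrow> (\<i> * of_real (\<xi> $ i))) (at 0)"
      by (simp add: DERIV_def)
    moreover have "filterlim (\<lambda>k. complex_of_real (h k)) (at 0) sequentially"
    proof -
      have "h \<longlonglongrightarrow> 0" using h0 by (simp add: filterlim_at)
      from tendsto_of_real[OF this, where 'a=complex] h(1) show ?thesis
        by (auto simp: filterlim_at less_imp_neq[symmetric])
    qed
    ultimately show "(\<lambda>k. (exp (\<i> * of_real (\<xi> $ i) * of_real (h k)) - 1) / of_real (h k)) \<longlonglongrightarrow> (\<i> * of_real (\<xi> $ i))"
      by (rule filterlim_compose)
  qed
  show ?thesis unfolding fourier_def[of "pd i f"] by (rule LIMSEQ_unique[OF L1[unfolded L2] L3])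
qed

lemma fourier_partials_replicate:
  assumes f: "f \<in> schwartz"
  shows "fourier (partials (replicate k i) f) \<xi> = (\<i> * of_real (\<xi> $ i)) ^ k * fourier f \<xi>"
  by (induction k) (auto simp: partials_Cons fourier_pd schwartz_partials f simp del: partials.simps(2))

text \<open>The suprema in the seminorms are taken over bounded sets here, which is what membership in the
Schwartz space provides.\<close>

lemma seminorm_ge:
  fixes f :: "real^'n::finite \<Rightarrow> complex"
  assumes "f \<in> schwartz" "length is \<le> N"
  shows "(1 + norm x) ^ k * norm (partials is f x) \<le> seminorm k N f"
proof -
  let ?g = "\<lambda>is x. (1 + norm x) ^ k * norm (partials is f x)"
  have bdd: "bdd_above (range (?g is))" for "is"
    using assms(1) by (intro bounded_imp_bdd_above) (auto simp: schwartz_def)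
  have nn: "0 \<le> (SUP x. ?g is x)" for "is"
    by (rule order_trans[OF _ cSUP_upper[OF UNIV_I bdd, where x=0]]) simp
  have "?g is x \<le> (SUP x. ?g is x)" by (rule cSUP_upper[OF UNIV_I bdd])
  also have "\<dots> \<le> seminorm k N f"
    unfolding seminorm_def
  proof (rule member_le_sum)
    show "finite {is::'n list. length is \<le> N}" using finite_lists_length_le[of "UNIV::'n set" N] by simp
  qed (use assms nn in auto)
  finally show ?thesis .
qed

lemma seminorm_mono:
  fixes f :: "real^'n::finite \<Rightarrow> complex"
  assumes "f \<in> schwartz" "N \<le> M" shows "seminorm k N f \<le> seminorm k M f"
  unfolding seminorm_def
proof (rule sum_mono2)
  show "finite {is::'n list. length is \<le> M}" using finite_lists_length_le[of "UNIV::'n set" M] by simp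
  fix "is" :: "'n list"
  have bdd: "bdd_above (range (\<lambda>x. (1 + norm x) ^ k * norm (partials is f x)))"
    using assms(1) by (intro bounded_imp_bdd_above) (auto simp: schwartz_def)
  show "0 \<le> (SUP x. (1 + norm x) ^ k * norm (partials is f x))"
    by (rule order_trans[OF _ cSUP_upper[OF UNIV_I bdd, where x=0]]) simp
qed (use assms in auto)

lemma power_one_plus_norm_le:
  fixes \<xi> :: "real^'n::finite"
  shows "(1 + norm \<xi>) ^ k \<le> (real (CARD('n) + 1)) ^ k * (1 + (\<Sum>i\<in>UNIV. \<bar>\<xi> $ i\<bar> ^ k))"
proof -
  define M where "M = Max (insert 1 (range (\<lambda>i. \<bar>\<xi> $ i\<bar>)))"
  have M: "1 \<le> M" "\<bar>\<xi> $ i\<bar> \<le> M" for i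
    unfolding M_def by (rule Max_ge; simp)+
  have "norm \<xi> \<le> (\<Sum>i\<in>UNIV. \<bar>\<xi> $ i\<bar>)" by (rule norm_le_l1_cart)
  also have "\<dots> \<le> (\<Sum>i\<in>(UNIV::'n set). M)" by (intro sum_mono M)
  finally have "1 + norm \<xi> \<le> real (CARD('n) + 1) * M" using M(1) by (simp add: ring_distribs)
  then have "(1 + norm \<xi>) ^ k \<le> (real (CARD('n) + 1) * M) ^ k" by (intro power_mono) auto
  also have "\<dots> = (real (CARD('n) + 1)) ^ k * M ^ k" by (simp add: power_mult_distrib)
  also have "\<dots> \<le> (real (CARD('n) + 1)) ^ k * (1 + (\<Sum>i\<in>UNIV. \<bar>\<xi> $ i\<bar> ^ k))"
  proof (intro mult_left_mono)
    have "M \<in> insert 1 (range (\<lambda>i. \<bar>\<xi> $ i\<bar>))" unfolding M_def by (rule Max_in) auto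
    then consider "M = 1" | i where "M = \<bar>\<xi> $ i\<bar>" by auto
    then show "M ^ k \<le> 1 + (\<Sum>i\<in>UNIV. \<bar>\<xi> $ i\<bar> ^ k)"
    proof cases
      case 1 then show ?thesis by (simp add: sum_nonneg)
    next
      case (2 i)
      have "\<bar>\<xi> $ i\<bar> ^ k \<le> (\<Sum>i\<in>UNIV. \<bar>\<xi> $ i\<bar> ^ k)" by (rule member_le_sum) auto
      then show ?thesis using 2 by simp
    qed
  qed simp
  finally show ?thesis .
qed

text \<open>A bound by one fixed seminorm, rather than mere rapid decay, is required later to recognise
functionals as tempered distributions.\<close>

lemma fourier_decay:
  obtains C where "C \<ge> 0" "\<And>(f::real^'n::finite \<Rightarrow> complex) \<xi>. f \<in> schwartz \<Longrightarrow>
     (1 + norm \<xi>) ^ k * norm (fourier f \<xi>) \<le> C * seminorm (2 * CARD('n)) k f"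
proof -
  define W where "W = (LINT x|lborel. weight (x::real^'n))"
  have W: "W \<ge> 0" unfolding W_def by (intro Bochner_Integration.integral_nonneg) simp
  define C where "C = (real (CARD('n) + 1)) ^ k * (1 + real CARD('n)) * W"
  have "(1 + norm \<xi>) ^ k * norm (fourier f \<xi>) \<le> C * seminorm (2 * CARD('n)) k f"
    if f: "f \<in> schwartz" for f and \<xi> :: "real^'n"
  proof -
    let ?S = "seminorm (2 * CARD('n)) k f"
    have L1: "norm (fourier (partials is f) \<xi>) \<le> W * ?S" if "length is \<le> k" for "is"
    proof -
      have "norm (fourier (partials is f) \<xi>) \<le> (LINT x|lborel. norm (partials is f x))" by (rule fourier_bound)
      also have "\<dots> \<le> (LINT x|lborel. weight (x::real^'n) * ?S)"
      proof (intro integral_mono integrable_norm schwartz_integrable schwartz_partials f integrable_mult_left weight_integrable)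
        fix x :: "real^'n"
        have "(1 + norm x) ^ (2 * CARD('n)) > 0" by (simp add: add_pos_nonneg)
        then show "norm (partials is f x) \<le> weight x * ?S"
          using seminorm_ge[OF f that, of x "2 * CARD('n)"] by (simp add: field_simps)
      qed
      also have "\<dots> = W * ?S" by (simp add: W_def)
      finally show ?thesis .
    qed
    have "(1 + norm \<xi>) ^ k * norm (fourier f \<xi>) \<le>
       ((real (CARD('n) + 1)) ^ k * (1 + (\<Sum>i\<in>UNIV. \<bar>\<xi> $ i\<bar> ^ k))) * norm (fourier f \<xi>)"
      by (intro mult_right_mono power_one_plus_norm_le) simp
    also have "\<dots> = (real (CARD('n) + 1)) ^ k *
       (norm (fourier (partials [] f) \<xi>) + (\<Sum>i\<in>UNIV. norm (fourier (partials (replicate k i) f) \<xi>)))"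
      by (simp add: fourier_partials_replicate[OF f] norm_mult norm_power ring_distribs sum_distrib_right sum_distrib_left mult_ac)
    also have "\<dots> \<le> (real (CARD('n) + 1)) ^ k * (W * ?S + (\<Sum>i\<in>(UNIV::'n set). W * ?S))"
      by (intro mult_left_mono add_mono sum_mono L1) auto
    also have "\<dots> = C * ?S" by (simp add: C_def ring_distribs)
    finally show ?thesis .
  qed
  moreover have "C \<ge> 0" using W by (simp add: C_def)
  ultimately show ?thesis using that by blast
qed

text \<open>The Fourier transforms of Schwartz functions form a set closed under partial derivatives, since
differentiation corresponds to multiplication of \<open>f\<close> by \<open>- i x\<^sub>i\<close>.\<close>

lemma schwartz_fourier:
  fixes f :: "real^'n::finite \<Rightarrow> complex"
  assumes "f \<in> schwartz" shows "fourier f \<in> schwartz"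
proof (rule schwartz_coinduct[of _ "fourier ` schwartz"])
  fix h :: "real^'n \<Rightarrow> complex" assume "h \<in> fourier ` schwartz"
  then obtain g where g: "g \<in> schwartz" "h = fourier g" by auto
  show "h differentiable (at x)" for x
    unfolding g(2) by (rule differentiableI[OF fourier_has_derivative[OF g(1)]])
  show "pd i h \<in> fourier ` schwartz" for i
    unfolding g(2) pd_fourier[OF g(1)]
    by (intro imageI schwartz_mult_slow slow_mult slow_const slow_coord g)
  show "rapid h" unfolding rapid_def
  proof
    fix k
    obtain C where "\<And>(f::real^'n::finite \<Rightarrow> complex) \<xi>. f \<in> schwartz \<Longrightarrow>
      (1 + norm \<xi>) ^ k * norm (fourier f \<xi>) \<le> C * seminorm (2 * CARD('n)) k f"
      using fourier_decay[of k] by metis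
    then show "\<exists>C. \<forall>x. (1 + norm x) ^ k * norm (h x) \<le> C" unfolding g(2) using g(1) by blast
  qed
qed (use assms in auto)

lemma schwartz_reflect: "f \<in> schwartz \<Longrightarrow> (\<lambda>x. f (- x)) \<in> schwartz"
  using schwartz_affine[of f "- 1" 0] by simp

lemma schwartz_inverse_fourier: "f \<in> schwartz \<Longrightarrow> inverse_fourier f \<in> schwartz"
  unfolding inverse_fourier_fourier[abs_def] by (intro schwartz_cmult schwartz_reflect schwartz_fourier)

section \<open>Fourier inversion and the Plancherel theorem\<close>

text \<open>Every interchange of integrals in the Fourier calculus below has a kernel of modulus at most \<open>1\<close>
between two integrable functions.\<close>

lemma Fubini_kernel:
  fixes f :: "'a::euclidean_space \<Rightarrow> complex" and g :: "'b::euclidean_space \<Rightarrow> complex"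
  assumes f: "integrable lborel f" and g: "integrable lborel g"
    and K[measurable]: "(\<lambda>(x, y). K x y) \<in> borel_measurable (lborel \<Otimes>\<^sub>M lborel)"
    and b: "\<And>x y. norm (K x y) \<le> 1"
  shows "(LINT x|lborel. f x * (LINT y|lborel. K x y * g y)) = (LINT y|lborel. g y * (LINT x|lborel. K x y * f x))"
proof -
  have [measurable]: "f \<in> borel_measurable borel" "g \<in> borel_measurable borel" using f g by auto
  have [measurable]: "K x \<in> borel_measurable borel" for x
    using measurable_compose[OF measurable_Pair1' K, of x] by simp
  have ig: "integrable lborel (\<lambda>y. K x y * g y)" for x
    by (rule Bochner_Integration.integrable_bound[OF g]) (use b in \<open>auto simp: norm_mult mult_left_le_one_le\<close>)
  have int: "integrable (lborel \<Otimes>\<^sub>M lborel) (\<lambda>(x, y). f x * (K x y * g y))"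
  proof (rule lborel_pair.Fubini_integrable)
    have le: "(LINT y|lborel. norm (K x y * g y)) \<le> (LINT y|lborel. norm (g y))" for x
      by (intro integral_mono integrable_norm ig g) (use b in \<open>auto simp: norm_mult mult_left_le_one_le\<close>)
    have "integrable lborel (\<lambda>x. norm (f x) * (LINT y|lborel. norm (K x y * g y)))"
    proof (rule Bochner_Integration.integrable_bound)
      show "integrable lborel (\<lambda>x. norm (f x) * (LINT y|lborel. norm (g y)))" by (intro integrable_mult_left integrable_norm f)
      show "AE x in lborel. norm (norm (f x) * (LINT y|lborel. norm (K x y * g y))) \<le> norm (norm (f x) * (LINT y|lborel. norm (g y)))"
        using le by (auto simp: abs_mult intro!: mult_left_mono abs_leI order_trans[OF _ le] always_eventually)
    qed measurable
    then show "integrable lborel (\<lambda>x. LINT y|lborel. norm (case (x, y) of (x, y) \<Rightarrow> f x * (K x y * g y)))"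
      by (simp add: norm_mult)
    show "AE x in lborel. integrable lborel (\<lambda>y. case (x, y) of (x, y) \<Rightarrow> f x * (K x y * g y))"
      using ig by auto
  qed measurable
  have "(LINT x|lborel. f x * (LINT y|lborel. K x y * g y)) = (LINT x|lborel. LINT y|lborel. f x * (K x y * g y))"
    by simp
  also have "\<dots> = (LINT y|lborel. LINT x|lborel. f x * (K x y * g y))"
    by (rule lborel_pair.Fubini_integral[OF int, symmetric])
  also have "\<dots> = (LINT y|lborel. LINT x|lborel. g y * (K x y * f x))"
    by (simp add: mult_ac)
  also have "\<dots> = (LINT y|lborel. g y * (LINT x|lborel. K x y * f x))" by simp
  finally show ?thesis .
qed

lemma fourier_multiplication_formula:
  assumes "integrable lborel f" "integrable lborel g"
  shows "(LINT x|lborel. fourier f x * g x) = (LINT x|lborel. f x * fourier g x)"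
proof -
  have "(LINT x|lborel. f x * (LINT y|lborel. exp (- \<i> * of_real (x \<bullet> y)) * g y)) =
      (LINT y|lborel. g y * (LINT x|lborel. exp (- \<i> * of_real (x \<bullet> y)) * f x))"
    by (rule Fubini_kernel[OF assms]) auto
  then show ?thesis unfolding fourier_def by (simp add: inner_commute mult.commute)
qed

definition gauss :: "real^'n::finite \<Rightarrow> complex" where
  "gauss x = of_real (exp (- (x \<bullet> x) / 2))"

text \<open>Up to normalisation this is the characteristic function of the standard normal distribution.\<close>

lemma gauss_1d:
  "integrable lborel (\<lambda>x. exp (- \<i> * of_real (x * t)) * complex_of_real (exp (- x\<^sup>2 / 2)))"
  "(LINT x|lborel. exp (- \<i> * of_real (x * t)) * complex_of_real (exp (- x\<^sup>2 / 2))) =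
    of_real (sqrt (2 * pi)) * of_real (exp (- t\<^sup>2 / 2))"
proof -
  let ?G = "\<lambda>x. complex_of_real (exp (- x\<^sup>2 / 2))"
  have G: "?G x = of_real (sqrt (2 * pi)) * of_real (std_normal_density x)" for x
  proof -
    have "exp (- x\<^sup>2 / 2) = sqrt (2 * pi) * std_normal_density x" by (simp add: std_normal_density_def)
    then show ?thesis by (simp only: of_real_mult)
  qed
  have "integrable lborel (\<lambda>x. of_real (sqrt (2 * pi)) * complex_of_real (std_normal_density x))"
    by (intro integrable_mult_right integrable_of_real integrable_normal_density) simp
  then have iG: "integrable lborel ?G" by (simp only: G)
  show "integrable lborel (\<lambda>x. exp (- \<i> * of_real (x * t)) * ?G x)"
    by (rule Bochner_Integration.integrable_bound[OF iG]) (auto simp: norm_mult)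
  have "char std_normal_distribution (- t) = of_real (exp (- t\<^sup>2 / 2))"
    by (simp add: char_std_normal_distribution)
  moreover have "char std_normal_distribution (- t) = (LINT x|lborel. std_normal_density x *\<^sub>R iexp (- t * x))"
    unfolding char_def by (subst integral_density) (auto simp: normal_density_nonneg)
  moreover have "(LINT x|lborel. exp (- \<i> * of_real (x * t)) * ?G x) =
      of_real (sqrt (2 * pi)) * (LINT x|lborel. std_normal_density x *\<^sub>R iexp (- t * x))"
    unfolding G by (subst integral_mult_right_zero[symmetric], intro Bochner_Integration.integral_cong)
      (auto simp: scaleR_conv_of_real mult_ac)
  ultimately show "(LINT x|lborel. exp (- \<i> * of_real (x * t)) * ?G x) = of_real (sqrt (2 * pi)) * of_real (exp (- t\<^sup>2 / 2))"
    by simp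
qed

lemma gauss_integrable: "integrable lborel (gauss :: real^'n::finite \<Rightarrow> complex)"
  and fourier_gauss: "fourier gauss (\<xi>::real^'n::finite) = of_real (sqrt (2 * pi) ^ CARD('n)) * gauss \<xi>"
proof -
  let ?f = "\<lambda>\<xi> (b::real^'n) t. exp (- \<i> * of_real (t * (\<xi> \<bullet> b))) * complex_of_real (exp (- t\<^sup>2 / 2))"
  have g: "gauss x = (\<Prod>b\<in>Basis. complex_of_real (exp (- (x \<bullet> b)\<^sup>2 / 2)))" for x :: "real^'n"
    unfolding gauss_def of_real_prod[symmetric] exp_sum[OF finite_Basis, symmetric]
    by (simp add: euclidean_inner[of x x] sum_negf sum_divide_distrib power2_eq_square)
  have e: "exp (- \<i> * of_real (x \<bullet> \<xi>)) * gauss x = (\<Prod>b\<in>Basis. ?f \<xi> b (x \<bullet> b))" for x \<xi> :: "real^'n"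
    unfolding g prod.distrib
    by (simp add: euclidean_inner[of x \<xi>] exp_sum[symmetric] sum_distrib_left sum_negf)
  show "integrable lborel (gauss :: real^'n \<Rightarrow> complex)"
    using lborel_integral_prod(1)[OF gauss_1d(1), of "\<lambda>b. 0"] by (simp add: g[abs_def])
  have "fourier gauss \<xi> = (\<Prod>b\<in>(Basis::(real^'n) set). of_real (sqrt (2 * pi)) * of_real (exp (- (\<xi> \<bullet> b)\<^sup>2 / 2)))"
    unfolding fourier_def e by (subst lborel_integral_prod(2)[OF gauss_1d(1)]) (simp only: gauss_1d(2))
  then show "fourier gauss \<xi> = of_real (sqrt (2 * pi) ^ CARD('n)) * gauss \<xi>"
    unfolding prod.distrib g by simp
qed

lemma integral_gauss: "(LINT x|lborel. gauss (x::real^'n::finite)) = of_real (sqrt (2 * pi) ^ CARD('n))"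
  using fourier_gauss[of "0::real^'n"] by (simp add: fourier_def gauss_def)

lemma gauss_norm_le: "norm (gauss x) \<le> 1"
  by (simp add: gauss_def)

lemma schwartz_bounded:
  assumes "f \<in> schwartz" obtains B where "B > 0" "\<And>x. norm (f x) \<le> B"
  using rapidD[OF schwartz_rapid[OF assms], where k=0] by (metis mult_1 power_0)

text \<open>The multiplication formula for the Gaussian and the dilated function \<open>y \<mapsto> f (x + e y)\<close>, followed
by the substitution \<open>\<eta> = e \<xi>\<close>.\<close>

lemma fourier_inversion_gauss:
  fixes f :: "real^'n::finite \<Rightarrow> complex"
  assumes f: "f \<in> schwartz" and e: "e > 0"
  shows "(LINT \<xi>|lborel. exp (\<i> * of_real (x \<bullet> \<xi>)) * fourier f \<xi> * gauss (e *\<^sub>R \<xi>)) =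
    of_real (sqrt (2 * pi) ^ CARD('n)) * (LINT y|lborel. f (x + e *\<^sub>R y) * gauss y)"
proof -
  note [measurable] = schwartz_measurable[OF f] schwartz_measurable[OF schwartz_fourier[OF f]]
  have gm[measurable]: "(gauss :: real^'n \<Rightarrow> complex) \<in> borel_measurable borel"
    using gauss_integrable[THEN borel_measurable_integrable] by simp
  define a where "a y = f (x + e *\<^sub>R y)" for y
  have aS: "a \<in> schwartz" unfolding a_def using schwartz_affine[OF f, of e x] e by (simp add: add.commute)
  have Fa: "of_real (e ^ CARD('n)) * fourier a \<eta> = exp (\<i> * of_real (x \<bullet> (\<eta> /\<^sub>R e))) * fourier f (\<eta> /\<^sub>R e)" for \<eta>
  proof -
    have "fourier f (\<eta> /\<^sub>R e) = of_real (e ^ CARD('n)) *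
        (LINT y|lborel. exp (- \<i> * of_real ((x + e *\<^sub>R y) \<bullet> (\<eta> /\<^sub>R e))) * f (x + e *\<^sub>R y))"
      unfolding fourier_def using e
      by (subst lborel_affine_integral[of _ e x]) auto
    also have "(LINT y|lborel. exp (- \<i> * of_real ((x + e *\<^sub>R y) \<bullet> (\<eta> /\<^sub>R e))) * f (x + e *\<^sub>R y)) =
        (LINT y|lborel. exp (- \<i> * of_real (x \<bullet> (\<eta> /\<^sub>R e))) * (exp (- \<i> * of_real (y \<bullet> \<eta>)) * a y))"
    proof (intro Bochner_Integration.integral_cong refl)
      fix y
      have "(x + e *\<^sub>R y) \<bullet> (\<eta> /\<^sub>R e) = x \<bullet> (\<eta> /\<^sub>R e) + y \<bullet> \<eta>"
        using e by (simp add: inner_add_left field_simps)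
      then show "exp (- \<i> * of_real ((x + e *\<^sub>R y) \<bullet> (\<eta> /\<^sub>R e))) * f (x + e *\<^sub>R y) =
          exp (- \<i> * of_real (x \<bullet> (\<eta> /\<^sub>R e))) * (exp (- \<i> * of_real (y \<bullet> \<eta>)) * a y)"
        by (simp only: a_def of_real_add distrib_left exp_add mult.assoc)
    qed
    also have "\<dots> = exp (- \<i> * of_real (x \<bullet> (\<eta> /\<^sub>R e))) * fourier a \<eta>"
      unfolding fourier_def by simp
    finally show ?thesis by (simp add: exp_minus)
  qed
  have "(LINT \<xi>|lborel. exp (\<i> * of_real (x \<bullet> \<xi>)) * fourier f \<xi> * gauss (e *\<^sub>R \<xi>)) =
     of_real (e ^ CARD('n)) * (LINT \<xi>|lborel. fourier a (e *\<^sub>R \<xi>) * gauss (e *\<^sub>R \<xi>))"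
  proof -
    have "exp (\<i> * of_real (x \<bullet> \<xi>)) * fourier f \<xi> = of_real (e ^ CARD('n)) * fourier a (e *\<^sub>R \<xi>)" for \<xi>
      using Fa[of "e *\<^sub>R \<xi>"] e by simp
    then show ?thesis by (simp add: mult.assoc)
  qed
  also have "\<dots> = (LINT \<eta>|lborel. fourier a \<eta> * gauss \<eta>)"
    using e schwartz_measurable[OF schwartz_fourier[OF aS]]
    by (subst lborel_affine_integral[of "\<lambda>\<eta>. fourier a \<eta> * gauss \<eta>" e 0]) auto
  also have "\<dots> = (LINT y|lborel. a y * fourier gauss y)"
    by (rule fourier_multiplication_formula[OF schwartz_integrable[OF aS] gauss_integrable])
  also have "\<dots> = of_real (sqrt (2 * pi) ^ CARD('n)) * (LINT y|lborel. a y * gauss y)"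
    unfolding fourier_gauss mult.left_commute[of _ "complex_of_real _"] by (rule integral_mult_right_zero)
  finally show ?thesis by (simp add: a_def)
qed

text \<open>Let \<open>e \<rightarrow> 0\<close> in the regularised formula. Both sides converge by dominated convergence, the right
one to \<open>f x\<close> times the integral of the Gaussian.\<close>

lemma inverse_fourier_fourier_id:
  fixes f :: "real^'n::finite \<Rightarrow> complex"
  assumes f: "f \<in> schwartz" shows "inverse_fourier (fourier f) = f"
proof
  fix x :: "real^'n"
  note [measurable] = schwartz_measurable[OF f] schwartz_measurable[OF schwartz_fourier[OF f]]
  have gm[measurable]: "(gauss :: real^'n \<Rightarrow> complex) \<in> borel_measurable borel"
    using gauss_integrable[THEN borel_measurable_integrable] by simp
  obtain B where B: "\<And>x. norm (f x) \<le> B" using schwartz_bounded[OF f] by metis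
  define e where "e k = inverse (real (Suc k))" for k
  have e: "e k > 0" for k by (simp add: e_def)
  have e0: "e \<longlonglongrightarrow> 0" unfolding e_def by (rule LIMSEQ_inverse_real_of_nat)
  have gc: "isCont (gauss :: real^'n \<Rightarrow> complex) y" for y
    unfolding gauss_def by (auto intro!: continuous_intros)
  have "(\<lambda>k. LINT \<xi>|lborel. exp (\<i> * of_real (x \<bullet> \<xi>)) * fourier f \<xi> * gauss (e k *\<^sub>R \<xi>)) \<longlonglongrightarrow>
     (LINT \<xi>|lborel. exp (\<i> * of_real (x \<bullet> \<xi>)) * fourier f \<xi> * gauss (0 *\<^sub>R \<xi>))"
  proof (rule integral_dominated_convergence[where w="\<lambda>\<xi>. norm (fourier f \<xi>)"])
    show "integrable lborel (\<lambda>\<xi>. norm (fourier f \<xi>))" by (intro integrable_norm schwartz_integrable schwartz_fourier f)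
    show "AE \<xi> in lborel. (\<lambda>k. exp (\<i> * of_real (x \<bullet> \<xi>)) * fourier f \<xi> * gauss (e k *\<^sub>R \<xi>)) \<longlonglongrightarrow>
        exp (\<i> * of_real (x \<bullet> \<xi>)) * fourier f \<xi> * gauss (0 *\<^sub>R \<xi>)"
      by (intro always_eventually allI tendsto_mult tendsto_const isCont_tendsto_compose[OF gc] tendsto_scaleR e0)
    show "AE \<xi> in lborel. norm (exp (\<i> * of_real (x \<bullet> \<xi>)) * fourier f \<xi> * gauss (e k *\<^sub>R \<xi>)) \<le> norm (fourier f \<xi>)" for k
      by (intro always_eventually allI) (simp add: norm_mult mult_right_le_one_le gauss_norm_le)
  qed measurable
  then have 1: "(\<lambda>k. LINT \<xi>|lborel. exp (\<i> * of_real (x \<bullet> \<xi>)) * fourier f \<xi> * gauss (e k *\<^sub>R \<xi>)) \<longlonglongrightarrow>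
     of_real ((2 * pi) ^ CARD('n)) * inverse_fourier (fourier f) x"
    by (simp add: gauss_def inverse_fourier_def)
  have "(\<lambda>k. LINT y|lborel. f (x + e k *\<^sub>R y) * gauss y) \<longlonglongrightarrow> (LINT y|lborel. f (x + 0 *\<^sub>R y) * gauss y)"
  proof (rule integral_dominated_convergence[where w="\<lambda>\<xi>. B * norm (gauss \<xi>)"])
    show "integrable lborel (\<lambda>\<xi>::real^'n. B * norm (gauss \<xi>))" by (intro integrable_mult_right integrable_norm gauss_integrable)
    have fc: "isCont f y" for y
      using f by (intro differentiable_imp_continuous_within smooth_differentiable schwartz_smooth)
    show "AE y in lborel. (\<lambda>k. f (x + e k *\<^sub>R y) * gauss y) \<longlonglongrightarrow> f (x + 0 *\<^sub>R y) * gauss y"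
      by (intro always_eventually allI tendsto_mult tendsto_const isCont_tendsto_compose[OF fc] tendsto_add tendsto_scaleR e0)
    show "AE y in lborel. norm (f (x + e k *\<^sub>R y) * gauss y) \<le> B * norm (gauss y)" for k
      by (intro always_eventually allI) (simp add: norm_mult mult_right_mono B)
  qed measurable
  then have 2: "(\<lambda>k. of_real (sqrt (2 * pi) ^ CARD('n)) * (LINT y|lborel. f (x + e k *\<^sub>R y) * gauss y)) \<longlonglongrightarrow>
     of_real (sqrt (2 * pi) ^ CARD('n)) * (f x * of_real (sqrt (2 * pi) ^ CARD('n)))"
    by (intro tendsto_mult tendsto_const) (simp add: integral_gauss)
  have 3: "of_real (sqrt (2 * pi) ^ CARD('n)) * (f x * of_real (sqrt (2 * pi) ^ CARD('n))) = of_real ((2 * pi) ^ CARD('n)) * f x"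
  proof -
    have "sqrt (2 * pi) ^ CARD('n) * sqrt (2 * pi) ^ CARD('n) = (2 * pi) ^ CARD('n)"
      unfolding power_mult_distrib[symmetric] by simp
    moreover have e: "of_real c * (z * of_real c) = complex_of_real (c * c) * z" for c z by simp
    ultimately show ?thesis by (simp only: e)
  qed
  have "of_real ((2 * pi) ^ CARD('n)) * inverse_fourier (fourier f) x = of_real ((2 * pi) ^ CARD('n)) * f x"
    by (rule LIMSEQ_unique[OF 1[unfolded fourier_inversion_gauss[OF f e]] 2[unfolded 3]])
  then show "inverse_fourier (fourier f) x = f x" by simp
qed

lemma fourier_reflect:
  assumes [measurable]: "f \<in> borel_measurable borel"
  shows "fourier (\<lambda>x. f (- x)) \<xi> = fourier f (- \<xi>)"
  unfolding fourier_def
  using lborel_reflect_integral[of "\<lambda>x. exp (- \<i> * of_real (x \<bullet> - \<xi>)) * f x"] by simp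

lemma fourier_inverse_fourier_id:
  fixes f :: "real^'n::finite \<Rightarrow> complex"
  assumes f: "f \<in> schwartz" shows "fourier (inverse_fourier f) = f"
proof
  fix x
  have "fourier (inverse_fourier f) x = of_real (1 / (2 * pi) ^ CARD('n)) * fourier (fourier f) (- x)"
    unfolding inverse_fourier_fourier[abs_def]
    by (simp only: fourier_cmult fourier_reflect[OF schwartz_measurable[OF schwartz_fourier[OF f]]])
  also have "\<dots> = inverse_fourier (fourier f) x" by (simp add: inverse_fourier_fourier)
  finally show "fourier (inverse_fourier f) x = f x" by (simp add: inverse_fourier_fourier_id[OF f])
qed

lemma cnj_fourier:
  fixes f :: "real^'n::finite \<Rightarrow> complex"
  assumes "f \<in> schwartz"
  shows "cnj (fourier f \<xi>) = of_real ((2 * pi) ^ CARD('n)) * inverse_fourier (\<lambda>x. cnj (f x)) \<xi>"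
proof -
  have "cnj (fourier f \<xi>) = (LINT x|lborel. cnj (exp (- \<i> * of_real (x \<bullet> \<xi>)) * f x))"
    unfolding fourier_def by (rule Bochner_Integration.integral_cnj[symmetric])
  then show ?thesis unfolding inverse_fourier_def by (simp add: exp_cnj inner_commute)
qed

text \<open>The conjugate of a Fourier transform is, up to a constant, the inverse transform of the conjugate.
The multiplication formula moves the remaining transform onto it, where inversion applies.\<close>

lemma plancherel_fourier:
  fixes f g :: "real^'n::finite \<Rightarrow> complex"
  assumes f: "f \<in> schwartz" and g: "g \<in> schwartz"
  shows "(LINT x|lborel. fourier f x * cnj (fourier g x)) = of_real ((2 * pi) ^ CARD('n)) * (LINT x|lborel. f x * cnj (g x))"
proof -
  have "(LINT x|lborel. fourier f x * cnj (fourier g x)) =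
     of_real ((2 * pi) ^ CARD('n)) * (LINT x|lborel. fourier f x * inverse_fourier (\<lambda>x. cnj (g x)) x)"
    unfolding cnj_fourier[OF g] mult.left_commute[of _ "complex_of_real _"] by (rule integral_mult_right_zero)
  also have "(LINT x|lborel. fourier f x * inverse_fourier (\<lambda>x. cnj (g x)) x) = (LINT x|lborel. f x * cnj (g x))"
    by (subst fourier_multiplication_formula)
      (simp_all add: schwartz_integrable f g schwartz_inverse_fourier schwartz_cnj fourier_inverse_fourier_id)
  finally show ?thesis .
qed

lemma plancherel_inverse_fourier:
  fixes f g :: "real^'n::finite \<Rightarrow> complex"
  assumes f: "f \<in> schwartz" and g: "g \<in> schwartz"
  shows "(LINT x|lborel. f x * cnj (g x)) =
    of_real ((2 * pi) ^ CARD('n)) * (LINT x|lborel. inverse_fourier f x * cnj (inverse_fourier g x))"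
  using plancherel_fourier[OF schwartz_inverse_fourier[OF f] schwartz_inverse_fourier[OF g]]
  by (simp add: fourier_inverse_fourier_id f g)

lemma nn_integral_norm_square:
  assumes "f \<in> schwartz"
  shows "(\<integral>\<^sup>+x. ennreal ((norm (f x))\<^sup>2) \<partial>lborel) = ennreal (LINT x|lborel. (norm (f x))\<^sup>2)"
    "integrable lborel (\<lambda>x. (norm (f x))\<^sup>2)"
    "complex_of_real (LINT x|lborel. (norm (f x))\<^sup>2) = (LINT x|lborel. f x * cnj (f x))"
proof -
  have i: "integrable lborel (\<lambda>x. f x * cnj (f x))"
    by (intro schwartz_integrable schwartz_mult schwartz_cnj assms)
  have e: "f x * cnj (f x) = complex_of_real ((norm (f x))\<^sup>2)" for x by (rule complex_norm_square[symmetric])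
  show i2: "integrable lborel (\<lambda>x. (norm (f x))\<^sup>2)"
    using integrable_norm[OF i] by (simp add: norm_mult power2_eq_square)
  then show "(\<integral>\<^sup>+x. ennreal ((norm (f x))\<^sup>2) \<partial>lborel) = ennreal (LINT x|lborel. (norm (f x))\<^sup>2)"
    by (intro nn_integral_eq_integral) auto
  show "complex_of_real (LINT x|lborel. (norm (f x))\<^sup>2) = (LINT x|lborel. f x * cnj (f x))"
    unfolding e by (simp flip: integral_complex_of_real)
qed

lemma plancherel_fourier_norm:
  fixes f :: "real^'n::finite \<Rightarrow> complex"
  assumes f: "f \<in> schwartz"
  shows "(\<integral>\<^sup>+x. ennreal ((norm (fourier f x))\<^sup>2) \<partial>lborel) =
    ennreal ((2 * pi) ^ CARD('n)) * (\<integral>\<^sup>+x. ennreal ((norm (f x))\<^sup>2) \<partial>lborel)"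
proof -
  have "complex_of_real (LINT x|lborel. (norm (fourier f x))\<^sup>2) =
      of_real ((2 * pi) ^ CARD('n)) * of_real (LINT x|lborel. (norm (f x))\<^sup>2)"
    by (simp only: nn_integral_norm_square(3) f schwartz_fourier plancherel_fourier)
  then have "(LINT x|lborel. (norm (fourier f x))\<^sup>2) = (2 * pi) ^ CARD('n) * (LINT x|lborel. (norm (f x))\<^sup>2)"
    unfolding of_real_mult[symmetric] of_real_eq_iff .
  then show ?thesis
    by (simp add: nn_integral_norm_square(1) f schwartz_fourier ennreal_mult)
qed

text \<open>The convolution theorem with a dilation in one factor: \<open>e = 1\<close> serves the localisation
inequality, and \<open>e \<rightarrow> 0\<close> the density of test functions.\<close>

lemma inverse_fourier_mult:
  fixes g f :: "real^'n::finite \<Rightarrow> complex"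
  assumes g: "g \<in> schwartz" and f: "f \<in> schwartz"
  shows "inverse_fourier (\<lambda>x. g (e *\<^sub>R x) * f x) \<xi> =
    (LINT \<zeta>|lborel. inverse_fourier g \<zeta> * inverse_fourier f (\<xi> - e *\<^sub>R \<zeta>))"
proof -
  let ?c = "complex_of_real (1 / (2 * pi) ^ CARD('n))"
  let ?K = "\<lambda>x \<zeta>. exp (\<i> * of_real (x \<bullet> (\<xi> - e *\<^sub>R \<zeta>)))"
  have gg: "g (e *\<^sub>R x) = (LINT \<zeta>|lborel. exp (- \<i> * of_real (\<zeta> \<bullet> (e *\<^sub>R x))) * inverse_fourier g \<zeta>)" for x
    using fourier_inverse_fourier_id[OF g] by (metis fourier_def)
  have "inverse_fourier (\<lambda>x. g (e *\<^sub>R x) * f x) \<xi> =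
      ?c * (LINT x|lborel. f x * (LINT \<zeta>|lborel. ?K x \<zeta> * inverse_fourier g \<zeta>))"
    unfolding inverse_fourier_def[of "\<lambda>x. g (e *\<^sub>R x) * f x"]
  proof (rule arg_cong2[where f="(*)"], rule refl, rule Bochner_Integration.integral_cong, rule refl)
    fix x
    have "exp (\<i> * of_real (\<xi> \<bullet> x)) * g (e *\<^sub>R x) =
      (LINT \<zeta>|lborel. exp (\<i> * of_real (\<xi> \<bullet> x)) * (exp (- \<i> * of_real (\<zeta> \<bullet> (e *\<^sub>R x))) * inverse_fourier g \<zeta>))"
      unfolding gg by (rule integral_mult_right_zero[symmetric])
    also have "\<dots> = (LINT \<zeta>|lborel. ?K x \<zeta> * inverse_fourier g \<zeta>)"
      by (intro Bochner_Integration.integral_cong refl)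
        (simp add: inner_diff_right inner_commute ring_distribs mult.assoc[symmetric] exp_add[symmetric])
    finally show "exp (\<i> * of_real (\<xi> \<bullet> x)) * (g (e *\<^sub>R x) * f x) = f x * (LINT \<zeta>|lborel. ?K x \<zeta> * inverse_fourier g \<zeta>)"
      by (simp add: mult_ac)
  qed
  also have "(LINT x|lborel. f x * (LINT \<zeta>|lborel. ?K x \<zeta> * inverse_fourier g \<zeta>)) =
      (LINT \<zeta>|lborel. inverse_fourier g \<zeta> * (LINT x|lborel. ?K x \<zeta> * f x))"
    by (rule Fubini_kernel) (auto intro!: schwartz_integrable schwartz_inverse_fourier f g)
  also have "?c * \<dots> = (LINT \<zeta>|lborel. inverse_fourier g \<zeta> * (?c * (LINT x|lborel. ?K x \<zeta> * f x)))"
    by (subst integral_mult_right_zero[symmetric]) (simp add: mult.left_commute)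
  also have "\<dots> = (LINT \<zeta>|lborel. inverse_fourier g \<zeta> * inverse_fourier f (\<xi> - e *\<^sub>R \<zeta>))"
    unfolding inverse_fourier_def[of f] by (simp add: inner_commute)
  finally show ?thesis .
qed

lemma inverse_fourier_translate:
  assumes [measurable]: "f \<in> borel_measurable borel"
  shows "inverse_fourier (\<lambda>x. f (x + a)) \<xi> = exp (- \<i> * of_real (a \<bullet> \<xi>)) * inverse_fourier f \<xi>"
  unfolding inverse_fourier_fourier by (simp add: fourier_translate)

lemma inverse_fourier_add:
  "f \<in> schwartz \<Longrightarrow> g \<in> schwartz \<Longrightarrow> inverse_fourier (\<lambda>x. f x + g x) = (\<lambda>\<xi>. inverse_fourier f \<xi> + inverse_fourier g \<xi>)"
  unfolding inverse_fourier_fourier[abs_def] by (simp add: fourier_add schwartz_integrable distrib_left)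

lemma inverse_fourier_cmult: "inverse_fourier (\<lambda>x. c * f x) = (\<lambda>\<xi>. c * inverse_fourier f \<xi>)"
  unfolding inverse_fourier_fourier[abs_def] by (simp add: fourier_cmult mult.left_commute)

section \<open>Square-integrable functions\<close>

definition square_integrable :: "('a::euclidean_space \<Rightarrow> complex) \<Rightarrow> bool" where
  "square_integrable f \<longleftrightarrow> f \<in> borel_measurable borel \<and> integrable lborel (\<lambda>x. (norm (f x))\<^sup>2)"

definition l2_norm :: "('a::euclidean_space \<Rightarrow> complex) \<Rightarrow> real" where
  "l2_norm f = sqrt (LINT x|lborel. (norm (f x))\<^sup>2)"

lemma l2_norm_nonneg [simp]: "l2_norm f \<ge> 0"
  by (simp add: l2_norm_def)

lemma l2_norm_sq: "(l2_norm f)\<^sup>2 = (LINT x|lborel. (norm (f x))\<^sup>2)"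
  by (simp add: l2_norm_def)

lemma square_integrable_measurable [measurable_dest]: "square_integrable f \<Longrightarrow> f \<in> borel_measurable borel"
  by (simp add: square_integrable_def)

lemma square_integrable_integrable: "square_integrable f \<Longrightarrow> integrable lborel (\<lambda>x. (norm (f x))\<^sup>2)"
  by (simp add: square_integrable_def)

lemma square_integrable_nn: "square_integrable f \<Longrightarrow> (\<integral>\<^sup>+x. ennreal ((norm (f x))\<^sup>2) \<partial>lborel) = ennreal ((l2_norm f)\<^sup>2)"
  unfolding l2_norm_sq by (intro nn_integral_eq_integral square_integrable_integrable) auto

lemma square_integrableI_nn:
  assumes [measurable]: "f \<in> borel_measurable borel" and "(\<integral>\<^sup>+x. ennreal ((norm (f x))\<^sup>2) \<partial>lborel) < \<infinity>"
  shows "square_integrable f"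
  unfolding square_integrable_def using assms by (auto intro!: integrableI_bounded)

lemma L2_functions_iff: "g \<in> L2_functions \<longleftrightarrow> square_integrable g"
proof
  assume g: "g \<in> L2_functions"
  then have "(\<integral>\<^sup>+x. ennreal ((norm (g x))\<^sup>2) \<partial>lborel) < \<infinity>"
    by (auto simp: L2_functions_def L2_norm_def ennreal_sqrt_def top.not_eq_extremum split: if_splits)
  then show "square_integrable g" using g by (intro square_integrableI_nn) (auto simp: L2_functions_def)
next
  assume g: "square_integrable g"
  then show "g \<in> L2_functions"
    by (auto simp: L2_functions_def L2_norm_def square_integrable_nn ennreal_sqrt_def square_integrable_def)
qed

lemma L2_norm_eq: "square_integrable g \<Longrightarrow> L2_norm g = ennreal (l2_norm g)"
  by (simp add: L2_norm_def square_integrable_nn ennreal_sqrt_def)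

lemma schwartz_square_integrable: "f \<in> schwartz \<Longrightarrow> square_integrable f"
  by (simp add: square_integrable_def schwartz_measurable nn_integral_norm_square)

lemma square_integrable_cnj: "square_integrable f \<Longrightarrow> square_integrable (\<lambda>x. cnj (f x))"
  using measurable_compose[OF square_integrable_measurable borel_measurable_continuous_onI[OF continuous_on_cnj[OF continuous_on_id]], of f]
  by (auto simp: square_integrable_def)

lemma l2_norm_cnj [simp]: "l2_norm (\<lambda>x. cnj (f x)) = l2_norm f"
  by (simp add: l2_norm_def)

lemma square_integrable_mult_integrable:
  assumes "square_integrable f" "square_integrable g" shows "integrable lborel (\<lambda>x. f x * g x)"
proof (rule Bochner_Integration.integrable_bound)
  note [measurable] = square_integrable_measurable[OF assms(1)] square_integrable_measurable[OF assms(2)]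
  show "integrable lborel (\<lambda>x. (norm (f x))\<^sup>2 + (norm (g x))\<^sup>2)"
    using assms by (intro Bochner_Integration.integrable_add square_integrable_integrable)
  have "norm (f x * g x) \<le> (norm (f x))\<^sup>2 + (norm (g x))\<^sup>2" for x
    using sum_squares_bound[of "norm (f x)" "norm (g x)"] mult_nonneg_nonneg[OF norm_ge_zero[of "f x"] norm_ge_zero[of "g x"]]
    unfolding norm_mult by linarith
  then show "AE x in lborel. norm (f x * g x) \<le> norm ((norm (f x))\<^sup>2 + (norm (g x))\<^sup>2)"
    by (intro always_eventually allI) (simp add: abs_of_nonneg)
qed (use assms in \<open>simp add: square_integrable_measurable\<close>)

lemma square_integrable_add: assumes "square_integrable f" "square_integrable g" shows "square_integrable (\<lambda>x. f x + g x)"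
proof -
  note [measurable] = square_integrable_measurable[OF assms(1)] square_integrable_measurable[OF assms(2)]
  have "integrable lborel (\<lambda>x. (norm (f x + g x))\<^sup>2)"
  proof (rule Bochner_Integration.integrable_bound)
    show "integrable lborel (\<lambda>x. 2 * (norm (f x))\<^sup>2 + 2 * (norm (g x))\<^sup>2)"
      using assms by (intro Bochner_Integration.integrable_add integrable_mult_right square_integrable_integrable)
    have "(norm (f x + g x))\<^sup>2 \<le> 2 * (norm (f x))\<^sup>2 + 2 * (norm (g x))\<^sup>2" for x
    proof -
      have "(norm (f x + g x))\<^sup>2 \<le> (norm (f x) + norm (g x))\<^sup>2"
        by (intro power_mono norm_triangle_ineq norm_ge_zero)
      then show ?thesis using sum_squares_bound[of "norm (f x)" "norm (g x)"] by (simp add: power2_sum)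
    qed
    then show "AE x in lborel. norm ((norm (f x + g x))\<^sup>2) \<le> norm (2 * (norm (f x))\<^sup>2 + 2 * (norm (g x))\<^sup>2)"
      by (intro always_eventually allI) (simp add: abs_of_nonneg)
  qed measurable
  then show ?thesis by (simp add: square_integrable_def)
qed

lemma square_integrable_cmult: "square_integrable f \<Longrightarrow> square_integrable (\<lambda>x. c * f x)"
  by (auto simp: square_integrable_def norm_mult power_mult_distrib)

lemma square_integrable_diff: "square_integrable f \<Longrightarrow> square_integrable g \<Longrightarrow> square_integrable (\<lambda>x. f x - g x)"
  using square_integrable_add[OF _ square_integrable_cmult[of g "- 1"], of f] by simp

lemma l2_norm_cmult: "l2_norm (\<lambda>x. c * f x) = norm c * l2_norm f"
  by (simp add: l2_norm_def norm_mult power_mult_distrib real_sqrt_mult)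

lemma Cauchy_Schwarz_l2_norm:
  assumes f: "square_integrable f" and g: "square_integrable g"
  shows "norm (LINT x|lborel. f x * g x) \<le> l2_norm f * l2_norm g"
proof -
  note [measurable] = square_integrable_measurable[OF f] square_integrable_measurable[OF g]
  have "norm (LINT x|lborel. f x * g x) \<le> (LINT x|lborel. norm (f x * g x))" by (rule integral_norm_bound)
  moreover have "(LINT x|lborel. norm (f x * g x))\<^sup>2 \<le> (l2_norm f)\<^sup>2 * (l2_norm g)\<^sup>2"
  proof -
    have "ennreal ((LINT x|lborel. norm (f x * g x))\<^sup>2) = (\<integral>\<^sup>+x. ennreal (norm (f x)) * ennreal (norm (g x)) \<partial>lborel)\<^sup>2"
      by (subst ennreal_power[symmetric], simp, subst nn_integral_eq_integral[symmetric])
        (use integrable_norm[OF square_integrable_mult_integrable[OF f g]] in \<open>auto simp: norm_mult ennreal_mult\<close>)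
    also have "\<dots> \<le> (\<integral>\<^sup>+x. (ennreal (norm (f x)))\<^sup>2 \<partial>lborel) * (\<integral>\<^sup>+x. (ennreal (norm (g x)))\<^sup>2 \<partial>lborel)"
      by (rule Cauchy_Schwarz_nn_integral) measurable
    also have "\<dots> = ennreal ((l2_norm f)\<^sup>2 * (l2_norm g)\<^sup>2)"
      by (simp add: ennreal_power square_integrable_nn f g ennreal_mult)
    finally show ?thesis by (subst (asm) ennreal_le_iff) auto
  qed
  then have "(LINT x|lborel. norm (f x * g x)) \<le> l2_norm f * l2_norm g"
    unfolding power_mult_distrib[symmetric] by (rule power2_le_imp_le) simp
  ultimately show ?thesis by linarith
qed

definition l2_inner :: "('a::euclidean_space \<Rightarrow> complex) \<Rightarrow> ('a \<Rightarrow> complex) \<Rightarrow> complex" where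
  "l2_inner f g = (LINT x|lborel. f x * cnj (g x))"

lemma l2_inner_bound: "square_integrable f \<Longrightarrow> square_integrable g \<Longrightarrow> norm (l2_inner f g) \<le> l2_norm f * l2_norm g"
  unfolding l2_inner_def using Cauchy_Schwarz_l2_norm[OF _ square_integrable_cnj] by simp

lemma l2_inner_self: "l2_inner f f = of_real ((l2_norm f)\<^sup>2)"
  unfolding l2_inner_def l2_norm_sq complex_norm_square[symmetric] by (rule integral_complex_of_real)

lemma l2_inner_add_left: "square_integrable f \<Longrightarrow> square_integrable g \<Longrightarrow> square_integrable h \<Longrightarrow> l2_inner (\<lambda>x. f x + g x) h = l2_inner f h + l2_inner g h"
  unfolding l2_inner_def by (simp add: distrib_right square_integrable_mult_integrable square_integrable_cnj)

lemma l2_inner_cmult_left: "l2_inner (\<lambda>x. c * f x) h = c * l2_inner f h"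
  unfolding l2_inner_def by (simp add: mult.assoc)

lemma l2_inner_cnj: "cnj (l2_inner f g) = l2_inner g f"
  unfolding l2_inner_def Bochner_Integration.integral_cnj[symmetric] by (simp add: mult.commute)

lemma l2_inner_add_right: "square_integrable f \<Longrightarrow> square_integrable g \<Longrightarrow> square_integrable h \<Longrightarrow> l2_inner h (\<lambda>x. f x + g x) = l2_inner h f + l2_inner h g"
  unfolding l2_inner_def by (simp add: distrib_left square_integrable_mult_integrable square_integrable_cnj)

lemma l2_inner_cmult_right: "l2_inner h (\<lambda>x. c * f x) = cnj c * l2_inner h f"
  by (metis l2_inner_cmult_left l2_inner_cnj complex_cnj_mult)

lemma l2_norm_add_sq:
  assumes "square_integrable f" "square_integrable g"
  shows "(l2_norm (\<lambda>x. f x + g x))\<^sup>2 = (l2_norm f)\<^sup>2 + (l2_norm g)\<^sup>2 + 2 * Re (l2_inner f g)"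
proof -
  have "of_real ((l2_norm (\<lambda>x. f x + g x))\<^sup>2) = l2_inner f f + l2_inner g g + (l2_inner f g + cnj (l2_inner f g))"
    unfolding l2_inner_self[symmetric] using assms by (simp add: l2_inner_add_left l2_inner_add_right square_integrable_add l2_inner_cnj)
  also have "\<dots> = of_real ((l2_norm f)\<^sup>2 + (l2_norm g)\<^sup>2 + 2 * Re (l2_inner f g))"
    by (simp add: l2_inner_self complex_add_cnj)
  finally show ?thesis using of_real_eq_iff by blast
qed

lemma l2_norm_triangle:
  assumes "square_integrable f" "square_integrable g" shows "l2_norm (\<lambda>x. f x + g x) \<le> l2_norm f + l2_norm g"
proof (rule power2_le_imp_le)
  have "Re (l2_inner f g) \<le> l2_norm f * l2_norm g"
    using l2_inner_bound[OF assms] complex_Re_le_cmod[of "l2_inner f g"] by linarith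
  then show "(l2_norm (\<lambda>x. f x + g x))\<^sup>2 \<le> (l2_norm f + l2_norm g)\<^sup>2"
    unfolding l2_norm_add_sq[OF assms] power2_sum by simp
qed simp


text \<open>Completeness of \<open>L\<^sup>2\<close>, in the form needed for minimising sequences. The function
\<open>H = \<Sum>\<^sub>k 4\<^sup>k |f\<^sub>k\<^sub>+\<^sub>1 - f\<^sub>k|\<^sup>2\<close> is integrable, hence finite almost everywhere, and where it is finite the
increments are at most \<open>2\<^sup>-\<^sup>k \<surd>H\<close>. This gives convergence and the bound \<open>2 \<cdot> 2\<^sup>-\<^sup>k \<surd>H\<close> of the tails at
the same time.\<close>

lemma L2_limit_exists:
  fixes f :: "nat \<Rightarrow> 'a::euclidean_space \<Rightarrow> complex"
  assumes f: "\<And>k. square_integrable (f k)"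
    and d: "\<And>k. (l2_norm (\<lambda>x. f (Suc k) x - f k x))\<^sup>2 \<le> 4 * (1 / 16) ^ k"
  obtains h where "square_integrable h" "(\<lambda>k. l2_norm (\<lambda>x. f k x - h x)) \<longlonglongrightarrow> 0"
proof -
  note [measurable] = square_integrable_measurable[OF f]
  define D where "D k x = norm (f (Suc k) x - f k x)" for k x
  have [measurable]: "D k \<in> borel_measurable borel" for k unfolding D_def by measurable
  define H where "H x = (\<Sum>k. ennreal (4 ^ k * (D k x)\<^sup>2))" for x
  have [measurable]: "H \<in> borel_measurable borel" unfolding H_def by measurable
  have "(\<integral>\<^sup>+x. H x \<partial>lborel) = (\<Sum>k. \<integral>\<^sup>+x. ennreal (4 ^ k * (D k x)\<^sup>2) \<partial>lborel)"
    unfolding H_def by (rule nn_integral_suminf) measurable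
  also have "\<dots> \<le> (\<Sum>k. ennreal (4 * (1 / 4) ^ k))"
  proof (intro suminf_le summableI)
    fix k
    have "(\<integral>\<^sup>+x. ennreal (4 ^ k * (D k x)\<^sup>2) \<partial>lborel) = ennreal (4 ^ k) * ennreal ((l2_norm (\<lambda>x. f (Suc k) x - f k x))\<^sup>2)"
      unfolding square_integrable_nn[OF square_integrable_diff[OF f f], symmetric] D_def
      by (simp add: ennreal_mult nn_integral_cmult)
    also have "\<dots> \<le> ennreal (4 ^ k) * ennreal (4 * (1 / 16) ^ k)"
      by (intro mult_left_mono ennreal_leI d) simp
    also have "\<dots> = ennreal (4 * (4 * (1 / 16)) ^ k)"
      unfolding power_mult_distrib by (simp add: ennreal_mult[symmetric] mult_ac del: ennreal_power)
    finally show "(\<integral>\<^sup>+x. ennreal (4 ^ k * (D k x)\<^sup>2) \<partial>lborel) \<le> ennreal (4 * (1 / 4) ^ k)" by simp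
  qed
  also have "\<dots> < \<infinity>"
  proof -
    have "summable (\<lambda>k. 4 * (1 / 4 :: real) ^ k)" by (intro summable_mult summable_geometric) simp
    then have "(\<Sum>k. ennreal (4 * (1 / 4) ^ k)) = ennreal (\<Sum>k. 4 * (1 / 4) ^ k)"
      by (intro suminf_ennreal2) auto
    then show ?thesis by simp
  qed
  finally have Hint: "(\<integral>\<^sup>+x. H x \<partial>lborel) < \<infinity>" .
  then have HAE: "AE x in lborel. H x \<noteq> \<infinity>" by (intro nn_integral_noteq_infinite) auto
  define h where "h x = lim (\<lambda>k. f k x)" for x
  have hm[measurable]: "h \<in> borel_measurable borel"
  proof -
    have "h \<in> borel_measurable lborel" unfolding h_def by (rule borel_measurable_lim_metric) simp
    then show ?thesis by simp
  qed
  have tail: "norm (f k x - h x) \<le> 2 * (1 / 2) ^ k * sqrt (enn2real (H x))" if "H x \<noteq> \<infinity>" for x k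
  proof -
    define s where "s = sqrt (enn2real (H x))"
    have s0: "s \<ge> 0" by (simp add: s_def)
    have D: "D j x \<le> (1 / 2) ^ j * s" for j
    proof -
      have "ennreal (4 ^ j * (D j x)\<^sup>2) \<le> H x"
      proof -
        have "(\<Sum>i\<in>{j}. ennreal (4 ^ i * (D i x)\<^sup>2)) \<le> H x"
          unfolding H_def by (intro sum_le_suminf summableI) simp_all
        then show ?thesis by (simp only: sum.insert sum.empty finite.emptyI empty_iff not_False_eq_True add_0_right)
      qed
      also have "\<dots> = ennreal (enn2real (H x))" using that by (simp add: ennreal_enn2real_if)
      finally have "4 ^ j * (D j x)\<^sup>2 \<le> enn2real (H x)" by (subst (asm) ennreal_le_iff) auto
      then have "(2 ^ j * D j x)\<^sup>2 \<le> s\<^sup>2"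
        by (simp add: s_def power_mult_distrib power_even_eq[symmetric] power_mult[symmetric] mult.commute[of j 2] power_mult)
      then have "2 ^ j * D j x \<le> s" by (rule power2_le_imp_le[OF _ s0])
      then show ?thesis by (simp add: field_simps power_divide)
    qed
    have part: "norm (f (k + n) x - f k x) \<le> 2 * (1 / 2) ^ k * s" for k n
    proof -
      have "norm (f (k + n) x - f k x) \<le> (2 - 2 * (1 / 2) ^ n) * ((1 / 2) ^ k * s)"
      proof (induction n)
        case (Suc n)
        have "norm (f (k + Suc n) x - f k x) \<le> norm (f (k + n) x - f k x) + D (k + n) x"
          unfolding D_def using norm_triangle_ineq[of "f (k + n) x - f k x" "f (Suc (k + n)) x - f (k + n) x"] by simp
        also have "\<dots> \<le> (2 - 2 * (1 / 2) ^ n) * ((1 / 2) ^ k * s) + (1 / 2) ^ (k + n) * s"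
          using Suc D[of "k + n"] by linarith
        also have "\<dots> = (2 - 2 * (1 / 2) ^ Suc n) * ((1 / 2) ^ k * s)"
          by (simp add: algebra_simps power_add)
        finally show ?case .
      qed (simp add: s0)
      also have "\<dots> \<le> 2 * ((1 / 2) ^ k * s)" by (intro mult_right_mono) (auto simp: s0)
      finally show ?thesis by simp
    qed
    have "Cauchy (\<lambda>k. f k x)"
    proof (rule metric_CauchyI)
      fix e :: real assume "e > 0"
      have "(\<lambda>k. 2 * (1 / 2) ^ k * s) \<longlonglongrightarrow> 2 * 0 * s"
        by (intro tendsto_intros LIMSEQ_power_zero) simp
      then have "\<forall>\<^sub>F k in sequentially. 2 * (1 / 2) ^ k * s < e / 2"
        using \<open>e > 0\<close> by (intro order_tendstoD(2)[of _ 0]) auto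
      then obtain N where N: "2 * (1 / 2) ^ N * s < e / 2" by (auto simp: eventually_sequentially)
      have "dist (f m x) (f n x) < e" if "m \<ge> N" "n \<ge> N" for m n
      proof -
        have "dist (f m x) (f N x) < e / 2" "dist (f n x) (f N x) < e / 2"
          using part[of N "m - N"] part[of N "n - N"] N that by (auto simp: dist_norm)
        then show ?thesis by (rule dist_triangle_half_l)
      qed
      then show "\<exists>M. \<forall>m\<ge>M. \<forall>n\<ge>M. dist (f m x) (f n x) < e" by blast
    qed
    then have "(\<lambda>n. f n x) \<longlonglongrightarrow> h x" unfolding h_def
      by (simp add: Cauchy_convergent_iff convergent_LIMSEQ_iff)
    then have "(\<lambda>n. f (n + k) x) \<longlonglongrightarrow> h x" by (rule LIMSEQ_ignore_initial_segment)
    then have "(\<lambda>n. norm (f (n + k) x - f k x)) \<longlonglongrightarrow> norm (h x - f k x)" by (intro tendsto_intros)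
    then have "norm (h x - f k x) \<le> 2 * (1 / 2) ^ k * s"
      by (rule LIMSEQ_le_const2) (use part[of k] in \<open>auto simp: add.commute\<close>)
    then show ?thesis by (simp add: s_def norm_minus_commute)
  qed
  define I where "I = enn2real (\<integral>\<^sup>+x. H x \<partial>lborel)"
  have I: "(\<integral>\<^sup>+x. H x \<partial>lborel) = ennreal I" using Hint by (simp add: I_def ennreal_enn2real_if)
  have I0: "I \<ge> 0" by (simp add: I_def)
  have est: "(\<integral>\<^sup>+x. ennreal ((norm (f k x - h x))\<^sup>2) \<partial>lborel) \<le> ennreal (4 * (1 / 4) ^ k * I)" for k
  proof -
    have "(\<integral>\<^sup>+x. ennreal ((norm (f k x - h x))\<^sup>2) \<partial>lborel) \<le> (\<integral>\<^sup>+x. ennreal (4 * (1 / 4) ^ k) * H x \<partial>lborel)"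
    proof (rule nn_integral_mono_AE, use HAE in eventually_elim)
      fix x assume "H x \<noteq> \<infinity>"
      then have "(norm (f k x - h x))\<^sup>2 \<le> (2 * (1 / 2) ^ k * sqrt (enn2real (H x)))\<^sup>2"
        by (intro power_mono tail) auto
      also have "\<dots> = 4 * (1 / 4) ^ k * enn2real (H x)"
      proof -
        have "((1 / 2 :: real) ^ k)\<^sup>2 = (1 / 4) ^ k"
          unfolding power2_eq_square power_mult_distrib[symmetric] by simp
        then show ?thesis by (simp add: power_mult_distrib)
      qed
      finally have "ennreal ((norm (f k x - h x))\<^sup>2) \<le> ennreal (4 * (1 / 4) ^ k * enn2real (H x))" by (rule ennreal_leI)
      also have "\<dots> = ennreal (4 * (1 / 4) ^ k) * H x" using \<open>H x \<noteq> \<infinity>\<close>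
        by (simp add: ennreal_mult ennreal_enn2real_if del: ennreal_power)
      finally show "ennreal ((norm (f k x - h x))\<^sup>2) \<le> ennreal (4 * (1 / 4) ^ k) * H x" .
    qed
    also have "\<dots> = ennreal (4 * (1 / 4) ^ k * I)"
      using I0 by (simp add: nn_integral_cmult I ennreal_mult del: ennreal_power)
    finally show ?thesis .
  qed
  have sd: "square_integrable (\<lambda>x. f k x - h x)" for k
    by (rule square_integrableI_nn) (use est[of k] in \<open>auto intro: le_less_trans\<close>)
  have le: "(l2_norm (\<lambda>x. f k x - h x))\<^sup>2 \<le> 4 * (1 / 4) ^ k * I" for k
    using est[of k] unfolding square_integrable_nn[OF sd] by (subst (asm) ennreal_le_iff) (use I0 in auto)
  have "(\<lambda>k. 4 * (1 / 4) ^ k * I) \<longlonglongrightarrow> 4 * 0 * I"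
    by (intro tendsto_intros LIMSEQ_power_zero) simp
  then have "(\<lambda>k. 4 * (1 / 4) ^ k * I) \<longlonglongrightarrow> 0" by simp
  then have "(\<lambda>k. (l2_norm (\<lambda>x. f k x - h x))\<^sup>2) \<longlonglongrightarrow> 0"
    by (rule tendsto_sandwich[OF always_eventually always_eventually tendsto_const, rotated 2]) (use le zero_le_power2 in blast)+
  then have "(\<lambda>k. sqrt ((l2_norm (\<lambda>x. f k x - h x))\<^sup>2)) \<longlonglongrightarrow> sqrt 0" by (rule tendsto_real_sqrt)
  then have lim: "(\<lambda>k. l2_norm (\<lambda>x. f k x - h x)) \<longlonglongrightarrow> 0" by simp
  have "square_integrable h" using square_integrable_diff[OF f[of 0] sd[of 0]] by simp
  then show thesis using lim that by blast
qed


section \<open>The Riesz representation of a bounded functional\<close>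

text \<open>The functional \<open>J \<phi> = \<parallel>F \<phi>\<parallel>\<^sup>2 - 2 Re (u \<phi>)\<close> is bounded below by \<open>- A\<^sup>2\<close>. By the parallelogram identity,
the images under \<open>F\<close> of a minimising sequence converge in \<open>L\<^sup>2\<close>, and varying \<open>J\<close> in the directions
\<open>z \<psi>\<close> shows that the conjugate of the limit represents \<open>u\<close>. The limit exists in
\<open>L\<^sup>2\<close> but need not be in the image of \<open>F\<close>.\<close>

lemma riesz_representation:
  fixes F :: "('b \<Rightarrow> complex) \<Rightarrow> 'a::euclidean_space \<Rightarrow> complex" and u :: "('b \<Rightarrow> complex) \<Rightarrow> complex"
  assumes D0: "(\<lambda>x. 0) \<in> D"
    and Dadd: "\<And>\<phi> \<psi>. \<phi> \<in> D \<Longrightarrow> \<psi> \<in> D \<Longrightarrow> (\<lambda>x. \<phi> x + \<psi> x) \<in> D"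
    and Dmul: "\<And>\<phi> c. \<phi> \<in> D \<Longrightarrow> (\<lambda>x. c * \<phi> x) \<in> D"
    and Fadd: "\<And>\<phi> \<psi>. \<phi> \<in> D \<Longrightarrow> \<psi> \<in> D \<Longrightarrow> F (\<lambda>x. \<phi> x + \<psi> x) = (\<lambda>x. F \<phi> x + F \<psi> x)"
    and Fmul: "\<And>\<phi> c. \<phi> \<in> D \<Longrightarrow> F (\<lambda>x. c * \<phi> x) = (\<lambda>x. c * F \<phi> x)"
    and uadd: "\<And>\<phi> \<psi>. \<phi> \<in> D \<Longrightarrow> \<psi> \<in> D \<Longrightarrow> u (\<lambda>x. \<phi> x + \<psi> x) = u \<phi> + u \<psi>"
    and umul: "\<And>\<phi> c. \<phi> \<in> D \<Longrightarrow> u (\<lambda>x. c * \<phi> x) = c * u \<phi>"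
    and Fsq: "\<And>\<phi>. \<phi> \<in> D \<Longrightarrow> square_integrable (F \<phi>)"
    and A: "\<And>\<phi>. \<phi> \<in> D \<Longrightarrow> norm (u \<phi>) \<le> A * l2_norm (F \<phi>)" "A \<ge> 0"
  obtains g where "square_integrable g" "l2_norm g \<le> A" "\<And>\<phi>. \<phi> \<in> D \<Longrightarrow> u \<phi> = (LINT x|lborel. g x * F \<phi> x)"
proof -
  define J where "J \<phi> = (l2_norm (F \<phi>))\<^sup>2 - 2 * Re (u \<phi>)" for \<phi>
  have Jge: "J \<phi> \<ge> - A\<^sup>2" if "\<phi> \<in> D" for \<phi>
  proof -
    have "Re (u \<phi>) \<le> A * l2_norm (F \<phi>)" using A(1)[OF that] complex_Re_le_cmod[of "u \<phi>"] by linarith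
    moreover have "0 \<le> (l2_norm (F \<phi>) - A)\<^sup>2" by simp
    ultimately show ?thesis unfolding J_def power2_diff by (simp add: mult.commute)
  qed
  define m where "m = (INF \<phi>\<in>D. J \<phi>)"
  have bdd: "bdd_below (J ` D)" using Jge by (auto intro!: bdd_belowI2)
  have mle: "m \<le> J \<phi>" if "\<phi> \<in> D" for \<phi> unfolding m_def by (rule cINF_lower[OF bdd that])
  have "\<exists>\<phi>\<in>D. J \<phi> < m + e" if "e > 0" for e
    using cINF_less_iff[OF _ bdd, of "m + e"] D0 that unfolding m_def by auto
  then have "\<exists>\<phi>\<in>D. J \<phi> < m + (1 / 16) ^ k" for k :: nat by simp
  then obtain p where p: "\<And>k. p k \<in> D" "\<And>k. J (p k) < m + (1 / 16) ^ k" by metis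
  have Jadd: "J (\<lambda>x. \<phi> x + z * \<psi> x) = J \<phi> + (norm z)\<^sup>2 * (l2_norm (F \<psi>))\<^sup>2 + 2 * Re (z * (l2_inner (F \<psi>) (F \<phi>) - u \<psi>))"
    if "\<phi> \<in> D" "\<psi> \<in> D" for \<phi> \<psi> z
  proof -
    have "l2_inner (F \<phi>) (\<lambda>x. z * F \<psi> x) = cnj (z * l2_inner (F \<psi>) (F \<phi>))"
      by (simp add: l2_inner_cmult_right l2_inner_cnj)
    then show ?thesis
      unfolding J_def using that
      by (simp add: Fadd Fmul Dmul uadd umul l2_norm_add_sq Fsq square_integrable_cmult l2_norm_cmult power_mult_distrib ring_distribs)
  qed
  have var: "(norm (l2_inner (F \<psi>) (F (p k)) - u \<psi>))\<^sup>2 \<le> (1 / 16) ^ k * ((l2_norm (F \<psi>))\<^sup>2 + 1)" if "\<psi> \<in> D" for \<psi> k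
  proof -
    define w where "w = l2_inner (F \<psi>) (F (p k)) - u \<psi>"
    define S where "S = (l2_norm (F \<psi>))\<^sup>2 + 1"
    have S: "S > 0" "S \<ge> 1" by (auto simp: S_def intro: add_nonneg_pos)
    \<comment> \<open>The minimising \<open>z\<close> would have \<open>\<parallel>F \<psi>\<parallel>\<^sup>2\<close> in place of \<open>S\<close>; adding \<open>1\<close> avoids a division by zero.\<close>
    define z where "z = - cnj w / of_real S"
    have "m \<le> J (\<lambda>x. p k x + z * \<psi> x)" using p that by (intro mle Dadd Dmul)
    also have "\<dots> = J (p k) + (norm z)\<^sup>2 * (S - 1) + 2 * Re (z * w)"
      unfolding Jadd[OF p(1) that] by (simp add: S_def w_def)
    finally have 1: "0 \<le> (1 / 16) ^ k + (norm z)\<^sup>2 * (S - 1) + 2 * Re (z * w)" using p(2)[of k] by linarith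
    have "z * w = - of_real ((norm w)\<^sup>2 / S)"
    proof -
      have "z * w = - (w * cnj w) / of_real S" by (simp add: z_def)
      then show ?thesis unfolding complex_norm_square[symmetric] by simp
    qed
    then have 2: "Re (z * w) = - ((norm w)\<^sup>2 / S)" by (simp only: uminus_complex.sel Re_complex_of_real)
    have "(norm z)\<^sup>2 * (S - 1) \<le> (norm z)\<^sup>2 * S" by (intro mult_left_mono) auto
    also have "\<dots> = (norm w)\<^sup>2 / S" using S unfolding z_def by (simp add: norm_divide power_divide power2_eq_square)
    finally have "(norm w)\<^sup>2 / S \<le> (1 / 16) ^ k" using 1 2 by linarith
    then show ?thesis using S unfolding w_def[symmetric] S_def[symmetric] by (simp add: field_simps)
  qed
  have cauchy: "(l2_norm (\<lambda>x. F (p (Suc k)) x - F (p k) x))\<^sup>2 \<le> 4 * (1 / 16) ^ k" for k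
  proof -
    let ?a = "p (Suc k)" and ?b = "p k"
    have *: "(l2_norm (\<lambda>x. F ?a x + c * F ?b x))\<^sup>2 = (l2_norm (F ?a))\<^sup>2 + (norm c)\<^sup>2 * (l2_norm (F ?b))\<^sup>2 + 2 * Re (cnj c * l2_inner (F ?a) (F ?b))" for c
      using p by (simp add: l2_norm_add_sq Fsq square_integrable_cmult l2_norm_cmult power_mult_distrib l2_inner_cmult_right)
    have Jmid: "J (\<lambda>x. c * (?a x + ?b x)) = (norm c)\<^sup>2 * (l2_norm (\<lambda>x. F ?a x + 1 * F ?b x))\<^sup>2 - 2 * Re (c * (u ?a + u ?b))" for c
      unfolding J_def using p by (simp add: Fadd Fmul uadd umul Dadd Dmul l2_norm_cmult power_mult_distrib)
    \<comment> \<open>The midpoint of two near-minimisers cannot go below the infimum.\<close>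
    have "m \<le> J (\<lambda>x. (1 / 2) * (?a x + ?b x))" using p by (intro mle Dadd Dmul)
    also have "\<dots> = (l2_norm (\<lambda>x. F ?a x + 1 * F ?b x))\<^sup>2 / 4 - Re (u ?a) - Re (u ?b)"
      unfolding Jmid by (simp add: norm_divide power_divide field_simps)
    finally have "4 * m \<le> (l2_norm (F ?a))\<^sup>2 + (l2_norm (F ?b))\<^sup>2 + 2 * Re (l2_inner (F ?a) (F ?b)) - 4 * Re (u ?a) - 4 * Re (u ?b)"
      unfolding * by (simp add: field_simps)
    moreover have "(l2_norm (\<lambda>x. F ?a x - F ?b x))\<^sup>2 = (l2_norm (F ?a))\<^sup>2 + (l2_norm (F ?b))\<^sup>2 - 2 * Re (l2_inner (F ?a) (F ?b))"
      using *[of "- 1"] by simp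
    moreover have "J ?a < m + (1 / 16) ^ Suc k" "J ?b < m + (1 / 16) ^ k" by (rule p)+
    moreover have "(1 / 16) ^ Suc k \<le> (1 / 16 :: real) ^ k" by simp
    ultimately show ?thesis unfolding J_def by linarith
  qed
  obtain h where h: "square_integrable h" "(\<lambda>k. l2_norm (\<lambda>x. F (p k) x - h x)) \<longlonglongrightarrow> 0"
    using L2_limit_exists[of "\<lambda>k. F (p k)", OF Fsq[OF p(1)] cauchy] by metis
  have inner_lim: "(\<lambda>k. l2_inner f (F (p k))) \<longlonglongrightarrow> l2_inner f h" if "square_integrable f" for f
  proof (rule Lim_null[THEN iffD2], rule Lim_null_comparison)
    have "l2_inner f (F (p k)) - l2_inner f h = l2_inner f (\<lambda>x. F (p k) x + - 1 * h x)" for k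
      using that h p Fsq by (simp only: l2_inner_add_right l2_inner_cmult_right square_integrable_cmult) simp
    then show "\<forall>\<^sub>F k in sequentially. norm (l2_inner f (F (p k)) - l2_inner f h) \<le> l2_norm f * l2_norm (\<lambda>x. F (p k) x - h x)"
      using l2_inner_bound[OF that square_integrable_diff[OF Fsq[OF p(1)] h(1)]] by simp
    show "(\<lambda>k. l2_norm f * l2_norm (\<lambda>x. F (p k) x - h x)) \<longlonglongrightarrow> 0" using tendsto_mult_right_zero[OF h(2)] by simp
  qed
  have rep: "u \<psi> = l2_inner (F \<psi>) h" if "\<psi> \<in> D" for \<psi>
  proof -
    have "(\<lambda>k. l2_inner (F \<psi>) (F (p k)) - u \<psi>) \<longlonglongrightarrow> 0"
    proof (rule tendsto_norm_zero_cancel)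
      have "(\<lambda>k. (1 / 16) ^ k * ((l2_norm (F \<psi>))\<^sup>2 + 1)) \<longlonglongrightarrow> 0 * ((l2_norm (F \<psi>))\<^sup>2 + 1)"
        by (intro tendsto_mult tendsto_const LIMSEQ_power_zero) simp
      then have "(\<lambda>k. (1 / 16) ^ k * ((l2_norm (F \<psi>))\<^sup>2 + 1)) \<longlonglongrightarrow> 0" by simp
      then have "(\<lambda>k. (norm (l2_inner (F \<psi>) (F (p k)) - u \<psi>))\<^sup>2) \<longlonglongrightarrow> 0"
        by (rule tendsto_sandwich[OF always_eventually always_eventually tendsto_const, rotated 2])
          (use var[OF that] zero_le_power2 in blast)+
      from tendsto_real_sqrt[OF this] show "(\<lambda>k. norm (l2_inner (F \<psi>) (F (p k)) - u \<psi>)) \<longlonglongrightarrow> 0" by simp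
    qed
    then have "(\<lambda>k. l2_inner (F \<psi>) (F (p k))) \<longlonglongrightarrow> u \<psi>" by (simp add: LIM_zero_iff)
    then show ?thesis using inner_lim[OF Fsq[OF that]] LIMSEQ_unique by blast
  qed
  have "l2_norm h \<le> A"
  proof -
    have "(\<lambda>k. cnj (l2_inner h (F (p k)))) \<longlonglongrightarrow> cnj (l2_inner h h)" by (intro tendsto_cnj inner_lim h)
    then have "(\<lambda>k. norm (u (p k))) \<longlonglongrightarrow> norm (l2_inner h h)"
      by (intro tendsto_norm) (simp add: l2_inner_cnj rep p)
    moreover have "norm (u (p k)) \<le> A * (l2_norm h + l2_norm (\<lambda>x. F (p k) x - h x))" for k
    proof -
      have "l2_norm (F (p k)) \<le> l2_norm h + l2_norm (\<lambda>x. F (p k) x - h x)"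
        using l2_norm_triangle[OF h(1) square_integrable_diff[OF Fsq[OF p(1)] h(1)], of k] by simp
      then show ?thesis using A(1)[OF p(1)[of k]] A(2) by (meson mult_left_mono order_trans)
    qed
    moreover have "(\<lambda>k. A * (l2_norm h + l2_norm (\<lambda>x. F (p k) x - h x))) \<longlonglongrightarrow> A * (l2_norm h + 0)"
      by (intro tendsto_intros h)
    ultimately have "norm (l2_inner h h) \<le> A * (l2_norm h + 0)" by (intro LIMSEQ_le) auto
    then have "l2_norm h * l2_norm h \<le> A * l2_norm h" by (simp add: l2_inner_self power2_eq_square norm_mult)
    then show ?thesis using A(2) l2_norm_nonneg[of h] by (cases "l2_norm h = 0") (auto simp: mult_le_cancel_right)
  qed
  then show thesis
    using that[of "\<lambda>x. cnj (h x)"] h(1) rep by (simp add: square_integrable_cnj l2_inner_def mult.commute)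
qed


section \<open>Test functions separate square-integrable functions\<close>

lemma indicator_square_integrable:
  assumes "bounded (S::'a::euclidean_space set)" "S \<in> sets borel" shows "square_integrable (\<lambda>x. indicator S x)"
proof -
  have "integrable lborel (indicator S :: 'a \<Rightarrow> real)"
    using assms using emeasure_bounded_finite[of S] by (simp add: integrable_indicator_iff)
  moreover have "(norm (indicator S x :: complex))\<^sup>2 = indicator S x" for x by (simp add: indicator_def)
  ultimately show ?thesis using assms by (simp add: square_integrable_def)
qed

text \<open>Cut-off functions converging to the indicator of a compact set show that \<open>g\<close> integrates to \<open>0\<close> over
every compact set. Up to a null set, a bounded Borel set is an increasing union of compact sets,
so \<open>g\<close> integrates to \<open>0\<close> over it as well.\<close>

lemma zero_if_orthogonal_to_test_functions:
  fixes g :: "real^'n::finite \<Rightarrow> complex"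
  assumes g: "square_integrable g" and orth: "\<And>\<phi>. \<phi> \<in> test_functions \<Longrightarrow> (LINT x|lborel. g x * \<phi> x) = 0"
  shows "AE x in lborel. g x = 0"
proof -
  note [measurable] = square_integrable_measurable[OF g]
  have gb: "integrable lborel (\<lambda>x. g x * indicator S x)" if "bounded S" "S \<in> sets borel" for S
    by (intro square_integrable_mult_integrable g indicator_square_integrable that)
  have K0: "(LINT x|lborel. g x * indicator K x) = 0" if K: "compact K" for K
  proof -
    define U where "U k = (\<Union>x\<in>K. ball x (inverse (real (Suc k))))" for k
    have U: "open (U k)" "K \<subseteq> U k" for k by (auto simp: U_def)
    have UB: "U k \<subseteq> (\<Union>x\<in>K. cball x 1)" for k
    proof -
      have "inverse (real (Suc k)) \<le> 1" by (simp add: field_simps)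
      then show ?thesis unfolding U_def by (force simp: subset_iff)
    qed
    obtain R where R: "\<And>x. x \<in> K \<Longrightarrow> norm x \<le> R" using compact_imp_bounded[OF K] by (auto simp: bounded_iff)
    have UR: "U k \<subseteq> cball 0 (R + 1)" for k
    proof
      fix y assume "y \<in> U k"
      then obtain x where "x \<in> K" "dist x y \<le> 1" using UB[of k] by auto
      then show "y \<in> cball 0 (R + 1)" using R[of x] norm_triangle_ineq4[of x "x - y"] by (simp add: dist_norm)
    qed
    have "\<exists>\<eta>::real^'n \<Rightarrow> real. (\<lambda>x. complex_of_real (\<eta> x)) \<in> test_functions \<and> (\<forall>x. x \<notin> U k \<longrightarrow> \<eta> x = 0) \<and>
        (\<forall>x\<in>K. \<eta> x = 1) \<and> (\<forall>x. 0 \<le> \<eta> x \<and> \<eta> x \<le> 1)" for k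
    proof -
      obtain \<eta> :: "real^'n \<Rightarrow> real" and V where e: "(\<lambda>x. complex_of_real (\<eta> x)) \<in> test_functions"
        "fun_support (\<lambda>x. complex_of_real (\<eta> x)) \<subseteq> U k"
        "open V" "K \<subseteq> V" "\<And>x. x \<in> V \<Longrightarrow> \<eta> x = 1" "\<And>x. 0 \<le> \<eta> x" "\<And>x. \<eta> x \<le> 1"
        using cutoff_exists[OF K U] by metis
      have "\<eta> x = 0" if "x \<notin> U k" for x
        using e(2) that fun_support_zero[of x "\<lambda>x. complex_of_real (\<eta> x)"] by auto
      then show ?thesis using e by blast
    qed
    then obtain \<eta> :: "nat \<Rightarrow> real^'n \<Rightarrow> real" where e: "\<And>k. (\<lambda>x. complex_of_real (\<eta> k x)) \<in> test_functions"
      "\<And>k x. x \<notin> U k \<Longrightarrow> \<eta> k x = 0" "\<And>k x. x \<in> K \<Longrightarrow> \<eta> k x = 1" "\<And>k x. 0 \<le> \<eta> k x" "\<And>k x. \<eta> k x \<le> 1" by metis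
    have "(\<lambda>k. LINT x|lborel. g x * complex_of_real (\<eta> k x)) \<longlonglongrightarrow> (LINT x|lborel. g x * indicator K x)"
    proof (rule integral_dominated_convergence[where w="\<lambda>x. norm (g x * indicator (cball 0 (R + 1)) x)"])
      show "integrable lborel (\<lambda>x. norm (g x * indicator (cball 0 (R + 1)) x))"
        by (intro integrable_norm gb) auto
      have em[measurable]: "(\<lambda>x. complex_of_real (\<eta> k x)) \<in> borel_measurable borel" for k
        by (intro smooth_measurable test_smooth e)
      show "(\<lambda>x. g x * complex_of_real (\<eta> k x)) \<in> borel_measurable lborel" for k by measurable
      show "(\<lambda>x. g x * indicator K x) \<in> borel_measurable lborel"
        using gb[OF compact_imp_bounded[OF K] borel_compact[OF K]] by (rule borel_measurable_integrable)
      show "AE x in lborel. (\<lambda>k. g x * complex_of_real (\<eta> k x)) \<longlonglongrightarrow> g x * indicator K x"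
      proof (intro always_eventually allI tendsto_mult tendsto_const)
        fix x show "(\<lambda>k. complex_of_real (\<eta> k x)) \<longlonglongrightarrow> indicator K x"
        proof (cases "x \<in> K")
          case False
          have "open (- K)" using K by (simp add: compact_imp_closed open_Compl)
          then obtain d where d: "d > 0" "ball x d \<subseteq> - K" using False by (metis Compl_iff open_contains_ball)
          obtain N where N: "inverse (real (Suc N)) < d" using reals_Archimedean[OF d(1)] by auto
          have "\<eta> k x = 0" if "k \<ge> N" for k
          proof (rule e(2), rule notI)
            assume "x \<in> U k"
            then obtain y where y: "y \<in> K" "dist y x < inverse (real (Suc k))" by (auto simp: U_def)
            moreover have "inverse (real (Suc k)) \<le> inverse (real (Suc N))" using that by (simp add: field_simps)
            ultimately have "dist y x < d" using N by linarith
            then have "y \<in> ball x d" by (simp add: dist_commute)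
            then show False using d(2) y(1) by blast
          qed
          then have "\<forall>\<^sub>F k in sequentially. complex_of_real (\<eta> k x) = 0" by (auto simp: eventually_sequentially)
          then show ?thesis using False by (simp add: tendsto_eventually)
        qed (simp add: e)
      qed
      show "AE x in lborel. norm (g x * complex_of_real (\<eta> k x)) \<le> norm (g x * indicator (cball 0 (R + 1)) x)" for k
      proof (intro always_eventually allI)
        fix x show "norm (g x * complex_of_real (\<eta> k x)) \<le> norm (g x * indicator (cball 0 (R + 1)) x)"
          using e(2)[of x k] e(4)[of k x] e(5)[of k x] UR[of k]
          by (cases "x \<in> U k") (auto simp: norm_mult indicator_def mult_left_le subset_iff)
      qed
    qed
    then show ?thesis using orth[OF e(1)] by (simp add: LIMSEQ_const_iff)
  qed
  have A0: "(LINT x|lborel. g x * indicator A x) = 0" if A: "bounded A" "A \<in> sets borel" for A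
  proof -
    obtain C T where CT: "fsigma C" "T \<in> null_sets lebesgue" "C \<union> T = A" "disjnt C T"
      using lebesgue_set_almost_fsigma[of A] A(2) by auto
    obtain F where F: "range F \<subseteq> Collect compact" "C = \<Union>(F ` (UNIV::nat set))"
      using CT(1) unfolding fsigma_Union_compact by blast
    define E where "E n = (\<Union>i\<le>n. F i)" for n
    have E: "compact (E n)" "E n \<subseteq> A" for n using F CT(3) by (auto simp: E_def intro!: compact_UN)
    have "(\<lambda>n. LINT x|lborel. g x * indicator (E n) x) \<longlonglongrightarrow> (LINT x|lborel. g x * indicator A x)"
    proof (rule integral_dominated_convergence[where w="\<lambda>x. norm (g x * indicator A x)"])
      show "integrable lborel (\<lambda>x. norm (g x * indicator A x))" by (intro integrable_norm gb A)
      show "(\<lambda>x. g x * indicator A x) \<in> borel_measurable lborel"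
        by (rule borel_measurable_integrable[OF gb[OF A]])
      show "(\<lambda>x. g x * indicator (E n) x) \<in> borel_measurable lborel" for n
        by (rule borel_measurable_integrable[OF gb[OF compact_imp_bounded borel_compact]]) (rule E)+
      show "AE x in lborel. norm (g x * indicator (E n) x) \<le> norm (g x * indicator A x)" for n
        using E(2)[of n] by (intro always_eventually allI) (auto simp: indicator_def)
      have "AE x in lborel. x \<notin> T" using AE_not_in[OF CT(2)] by (simp add: AE_completion_iff)
      then show "AE x in lborel. (\<lambda>n. g x * indicator (E n) x) \<longlonglongrightarrow> g x * indicator A x"
      proof eventually_elim
        case (elim x)
        show ?case
        proof (cases "x \<in> A")
          case True
          then obtain N where "x \<in> F N" using elim CT(3) F(2) by auto
          then have "x \<in> E n" if "n \<ge> N" for n using that by (auto simp: E_def)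
          then have "\<forall>\<^sub>F n in sequentially. g x * indicator (E n) x = g x * indicator A x"
            by (intro eventually_mono[OF eventually_ge_at_top[of N]]) (use True in simp)
          then show ?thesis by (rule tendsto_eventually)
        next
          case False then have "x \<notin> E n" for n using E(2) by blast
          then show ?thesis using False by simp
        qed
      qed
    qed
    then show ?thesis using K0[OF E(1)] by (simp add: LIMSEQ_const_iff)
  qed
  have "AE x in lborel. g x * indicator (cball 0 (real R)) x = 0" for R
  proof (rule sigma_finite_measure.density_zero[OF sigma_finite_lborel])
    show "integrable lborel (\<lambda>x. g x * indicator (cball 0 (real R)) x)" by (intro gb) auto
    fix S :: "(real^'n) set" assume S: "S \<in> sets lborel"
    have "set_lebesgue_integral lborel S (\<lambda>x. g x * indicator (cball 0 (real R)) x) = (LINT x|lborel. g x * indicator (S \<inter> cball 0 (real R)) x)"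
      unfolding set_lebesgue_integral_def by (intro Bochner_Integration.integral_cong) (auto simp: indicator_def)
    also have "\<dots> = 0" using S by (intro A0) (auto intro: bounded_subset[OF bounded_cball])
    finally show "set_lebesgue_integral lborel S (\<lambda>x. g x * indicator (cball 0 (real R)) x) = 0" .
  qed
  then have "AE x in lborel. \<forall>R. g x * indicator (cball 0 (real R)) x = 0" unfolding AE_all_countable by (rule allI)
  then show ?thesis
  proof eventually_elim
    case (elim x)
    obtain R where "norm x \<le> real R" using real_arch_simple by blast
    then show ?case using elim[rule_format, of R] by simp
  qed
qed

section \<open>The operators with symbols \<open>\<langle>\<langle>\<xi>\<rangle>\<rangle>\<^sup>s\<close> on Schwartz functions\<close>

text \<open>The transpose of \<open>\<langle>\<langle>D\<rangle>\<rangle>\<^sup>s\<close> acting on functions. Since the symbol is even, it is \<open>\<langle>\<langle>D\<rangle>\<rangle>\<^sup>s\<close> itself.\<close>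

definition bessel :: "('n::finite \<Rightarrow> 'j::finite) \<Rightarrow> real^'j \<Rightarrow> (real^'n \<Rightarrow> complex) \<Rightarrow> real^'n \<Rightarrow> complex" where
  "bessel b s \<phi> = fourier (\<lambda>\<xi>. of_real (bracket b s \<xi>) * inverse_fourier \<phi> \<xi>)"

text \<open>The norm of \<open>\<phi>\<close> in \<open>\<H>\<^sup>s\<close>; the estimates of the theorem are all reduced to this quantity.\<close>

definition bessel_norm :: "('n::finite \<Rightarrow> 'j::finite) \<Rightarrow> real^'j \<Rightarrow> (real^'n \<Rightarrow> complex) \<Rightarrow> real" where
  "bessel_norm b s \<phi> = l2_norm (bessel b s \<phi>)"

lemma bracket_D_apply: "bracket_D b s T \<phi> = T (bessel b s \<phi>)"
  by (simp add: bracket_D_def fourier_multiplier_def inverse_fourier_dist_def mult_dist_def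
      fourier_dist_def bessel_def)

lemma schwartz_bracket_mult:
  "\<phi> \<in> schwartz \<Longrightarrow> (\<lambda>\<xi>. of_real (bracket b s \<xi>) * \<phi> \<xi>) \<in> schwartz"
  by (intro schwartz_mult_slow slow_bracket)

lemma schwartz_bessel: "\<phi> \<in> schwartz \<Longrightarrow> bessel b s \<phi> \<in> schwartz"
  unfolding bessel_def by (intro schwartz_fourier schwartz_bracket_mult schwartz_inverse_fourier)

lemma inverse_fourier_bessel:
  "\<phi> \<in> schwartz \<Longrightarrow> inverse_fourier (bessel b s \<phi>) = (\<lambda>\<xi>. of_real (bracket b s \<xi>) * inverse_fourier \<phi> \<xi>)"
  unfolding bessel_def
  by (intro inverse_fourier_fourier_id schwartz_bracket_mult schwartz_inverse_fourier)

lemma bessel_bessel_minus: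
  assumes "\<phi> \<in> schwartz" shows "bessel b s (bessel b (- s) \<phi>) = \<phi>" "bessel b (- s) (bessel b s \<phi>) = \<phi>"
proof -
  have e: "of_real (bracket b s \<xi>) * (of_real (bracket b (- s) \<xi>) * z) = z"
    "of_real (bracket b (- s) \<xi>) * (of_real (bracket b s \<xi>) * z) = z" for \<xi> and z :: complex
    by (simp_all flip: mult.assoc of_real_mult)
  show "bessel b s (bessel b (- s) \<phi>) = \<phi>" "bessel b (- s) (bessel b s \<phi>) = \<phi>"
    unfolding bessel_def[of b s "bessel b (- s) \<phi>"] bessel_def[of b "- s" "bessel b s \<phi>"]
      inverse_fourier_bessel[OF assms] e
    by (simp_all add: fourier_inverse_fourier_id assms)
qed

lemma bessel_add:
  "\<phi> \<in> schwartz \<Longrightarrow> \<psi> \<in> schwartz \<Longrightarrow> bessel b s (\<lambda>x. \<phi> x + \<psi> x) = (\<lambda>x. bessel b s \<phi> x + bessel b s \<psi> x)"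
  unfolding bessel_def
  by (simp add: inverse_fourier_add distrib_left fourier_add schwartz_integrable schwartz_bracket_mult schwartz_inverse_fourier)

lemma bessel_cmult: "bessel b s (\<lambda>x. c * \<phi> x) = (\<lambda>x. c * bessel b s \<phi> x)"
  unfolding bessel_def by (simp add: inverse_fourier_cmult mult.left_commute[of _ c] fourier_cmult)

lemma bessel_norm_nonneg [simp]: "bessel_norm b s \<phi> \<ge> 0" by (simp add: bessel_norm_def)

lemma bessel_norm_cmult: "bessel_norm b s (\<lambda>x. c * \<phi> x) = norm c * bessel_norm b s \<phi>"
  by (simp add: bessel_norm_def bessel_cmult l2_norm_cmult)

lemma bessel_norm_square:
  fixes b :: "'n::finite \<Rightarrow> 'j::finite"
  assumes "\<phi> \<in> schwartz"
  shows "ennreal ((bessel_norm b s \<phi>)\<^sup>2) = ennreal ((2 * pi) ^ CARD('n)) *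
    (\<integral>\<^sup>+\<xi>. ennreal ((bracket b s \<xi> * norm (inverse_fourier \<phi> \<xi>))\<^sup>2) \<partial>lborel)"
proof -
  have "ennreal ((bessel_norm b s \<phi>)\<^sup>2) = (\<integral>\<^sup>+x. ennreal ((norm (bessel b s \<phi> x))\<^sup>2) \<partial>lborel)"
    unfolding bessel_norm_def by (rule square_integrable_nn[OF schwartz_square_integrable[OF schwartz_bessel[OF assms]], symmetric])
  also have "\<dots> = ennreal ((2 * pi) ^ CARD('n)) *
      (\<integral>\<^sup>+\<xi>. ennreal ((norm (of_real (bracket b s \<xi>) * inverse_fourier \<phi> \<xi>))\<^sup>2) \<partial>lborel)"
    unfolding bessel_def
    by (rule plancherel_fourier_norm[OF schwartz_bracket_mult[OF schwartz_inverse_fourier[OF assms]]])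
  finally show ?thesis by (simp add: norm_mult bracket_nonneg abs_of_nonneg)
qed

lemma bracket_measurable [measurable]: "bracket b s \<in> borel_measurable borel"
  using measurable_compose[OF smooth_measurable[OF slow_smooth[OF slow_bracket[of b s]]]
      borel_measurable_continuous_onI[OF continuous_on_Re[OF continuous_on_id]]] by simp

lemma bracket_poly_bound:
  obtains C k where "C > 0" "\<And>\<xi>. bracket b s \<xi> \<le> C * (1 + norm \<xi>) ^ k"
proof -
  from poly_boundedD[OF slow_poly_bounded[OF slow_bracket[of b s]]] obtain C k
    where "C > 0" "\<And>\<xi>. norm (complex_of_real (bracket b s \<xi>)) \<le> C * (1 + norm \<xi>) ^ k" by metis
  then show thesis using that[of C k] bracket_nonneg[of b s] by (simp add: abs_of_nonneg)
qed

lemma square_weight_nn_integral: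
  fixes C :: real
  assumes "C \<ge> 0"
  shows "(\<integral>\<^sup>+\<xi>. ennreal ((C / (1 + norm (\<xi>::real^'n::finite)) ^ CARD('n))\<^sup>2) \<partial>lborel) =
    ennreal (C\<^sup>2 * (LINT x|lborel. weight (x::real^'n)))"
proof -
  have e: "(C / p ^ m)\<^sup>2 = C\<^sup>2 * inverse (p ^ (2 * m))" for p :: real and m
    unfolding power_even_eq power_divide by (rule divide_inverse)
  have "(\<integral>\<^sup>+\<xi>. ennreal ((C / (1 + norm (\<xi>::real^'n)) ^ CARD('n))\<^sup>2) \<partial>lborel) =
      (\<integral>\<^sup>+\<xi>. ennreal (C\<^sup>2 * weight (\<xi>::real^'n)) \<partial>lborel)" by (rule nn_integral_cong) (subst e, rule refl)
  also have "\<dots> = ennreal (LINT \<xi>|lborel. C\<^sup>2 * weight (\<xi>::real^'n))"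
    by (rule nn_integral_eq_integral[OF integrable_mult_right[OF weight_integrable]]) auto
  finally show ?thesis by simp
qed

text \<open>Continuity of the \<open>\<H>\<^sup>s\<close> norm on the Schwartz space: the symbol grows polynomially, and the Fourier
transform decays at any polynomial rate with constants given by seminorms.\<close>

lemma bessel_norm_seminorm:
  fixes b :: "'n::finite \<Rightarrow> 'j::finite"
  obtains C k where "C \<ge> 0" "\<And>\<phi>. \<phi> \<in> schwartz \<Longrightarrow> bessel_norm b s \<phi> \<le> C * seminorm (2 * CARD('n)) k \<phi>"
proof -
  obtain C l where C: "C > 0" "\<And>\<xi>. bracket b s \<xi> \<le> C * (1 + norm \<xi>) ^ l" using bracket_poly_bound by metis
  define k where "k = l + CARD('n)"
  obtain E where E: "E \<ge> 0" "\<And>(f::real^'n \<Rightarrow> complex) \<xi>. f \<in> schwartz \<Longrightarrow>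
     (1 + norm \<xi>) ^ k * norm (fourier f \<xi>) \<le> E * seminorm (2 * CARD('n)) k f"
    using fourier_decay[of k] by metis
  define W where "W = (LINT x|lborel. weight (x::real^'n))"
  have W0: "W \<ge> 0" unfolding W_def by (intro Bochner_Integration.integral_nonneg) simp
  define P where "P = (2 * pi) ^ CARD('n)"
  have P0: "P > 0" by (simp add: P_def)
  have "bessel_norm b s \<phi> \<le> sqrt (P * W) * (C * E / P) * seminorm (2 * CARD('n)) k \<phi>" if \<phi>: "\<phi> \<in> schwartz" for \<phi> :: "real^'n \<Rightarrow> complex"
  proof -
    let ?S = "seminorm (2 * CARD('n)) k \<phi>"
    have S0: "?S \<ge> 0"
      by (rule order_trans[OF _ seminorm_ge[OF \<phi>, of "[]" k 0 "2 * CARD('n)"]]) simp_all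
    define D where "D = C * E / P * ?S"
    have D0: "D \<ge> 0" using C E P0 S0 by (simp add: D_def)
    have "bracket b s \<xi> * norm (inverse_fourier \<phi> \<xi>) \<le> D / (1 + norm \<xi>) ^ CARD('n)" for \<xi>
    proof -
      have p: "(1 + norm \<xi>) ^ CARD('n) > 0" by (simp add: add_pos_nonneg)
      have nI: "norm (inverse_fourier \<phi> \<xi>) = norm (fourier \<phi> (- \<xi>)) / P"
        unfolding inverse_fourier_fourier norm_mult norm_of_real using P0 by (simp add: P_def)
      have "(bracket b s \<xi> * norm (inverse_fourier \<phi> \<xi>)) * (1 + norm \<xi>) ^ CARD('n) \<le>
          ((C * (1 + norm \<xi>) ^ l) * (norm (fourier \<phi> (- \<xi>)) / P)) * (1 + norm \<xi>) ^ CARD('n)"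
        unfolding nI using P0 by (intro mult_right_mono C) auto
      also have "((C * (1 + norm \<xi>) ^ l) * (norm (fourier \<phi> (- \<xi>)) / P)) * (1 + norm \<xi>) ^ CARD('n) =
          C / P * ((1 + norm (- \<xi>)) ^ k * norm (fourier \<phi> (- \<xi>)))"
        by (simp add: k_def power_add)
      also have "\<dots> \<le> C / P * (E * ?S)" using C P0 by (intro mult_left_mono E \<phi>) auto
      also have "\<dots> = D" by (simp add: D_def)
      finally show ?thesis using p by (simp add: pos_le_divide_eq)
    qed
    then have "ennreal ((bracket b s \<xi> * norm (inverse_fourier \<phi> \<xi>))\<^sup>2) \<le> ennreal ((D / (1 + norm \<xi>) ^ CARD('n))\<^sup>2)" for \<xi>
      by (intro ennreal_leI power_mono) (auto simp: bracket_nonneg)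
    then have "ennreal ((bessel_norm b s \<phi>)\<^sup>2) \<le> ennreal P * (\<integral>\<^sup>+\<xi>. ennreal ((D / (1 + norm (\<xi>::real^'n)) ^ CARD('n))\<^sup>2) \<partial>lborel)"
      unfolding bessel_norm_square[OF \<phi>] P_def by (intro mult_left_mono nn_integral_mono) auto
    also have "\<dots> = ennreal (P * (D\<^sup>2 * W))"
      unfolding square_weight_nn_integral[OF D0] W_def[symmetric] using P0 W0 by (simp add: ennreal_mult)
    finally have "(bessel_norm b s \<phi>)\<^sup>2 \<le> P * (D\<^sup>2 * W)" using P0 W0 by (subst (asm) ennreal_le_iff) auto
    then have "(bessel_norm b s \<phi>)\<^sup>2 \<le> (sqrt (P * W) * D)\<^sup>2"
      unfolding power_mult_distrib[of "sqrt (P * W)"] using P0 W0 by (simp add: mult_ac)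
    then have "bessel_norm b s \<phi> \<le> sqrt (P * W) * D"
      by (rule power2_le_imp_le) (intro mult_nonneg_nonneg D0 real_sqrt_ge_zero W0 less_imp_le[OF P0])
    then show ?thesis unfolding D_def by (simp only: mult.assoc)
  qed
  then show thesis by (intro that[of "sqrt (P * W) * (C * E / P)" k]) (use C E P0 W0 in auto)
qed


section \<open>The spaces \<open>\<H>\<^sup>s\<close> by duality\<close>

lemma distributions_linear:
  assumes "u \<in> distributions"
  shows "\<phi> \<in> test_functions \<Longrightarrow> \<psi> \<in> test_functions \<Longrightarrow> u (\<lambda>x. \<phi> x + \<psi> x) = u \<phi> + u \<psi>"
    "\<phi> \<in> test_functions \<Longrightarrow> u (\<lambda>x. c * \<phi> x) = c * u \<phi>"
  using assms by (auto simp: distributions_def linear_functional_on_def)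

text \<open>This eliminates tempered extensions. Since \<open>bessel b (- s)\<close> inverts the transpose of \<open>\<langle>\<langle>D\<rangle>\<rangle>\<^sup>s\<close> on Schwartz
functions, a density determines the values of \<open>u\<close>; conversely the integral on the right is
defined for all Schwartz functions and is tempered.\<close>

lemma H_density_iff:
  fixes b :: "'n::finite \<Rightarrow> 'j::finite"
  shows "H_density b s u g \<longleftrightarrow> u \<in> distributions \<and> square_integrable g \<and>
    (\<forall>\<psi>\<in>test_functions. u \<psi> = (LINT x|lborel. g x * bessel b (- s) \<psi> x))" (is "_ \<longleftrightarrow> ?R")
proof
  assume h: "H_density b s u g"
  then obtain T where T: "tempered_extension u T" "represents g (bracket_D b s T)"
    by (auto simp: H_density_def)
  have "u \<psi> = (LINT x|lborel. g x * bessel b (- s) \<psi> x)" if \<psi>: "\<psi> \<in> test_functions" for \<psi>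
  proof -
    have "u \<psi> = T \<psi>" using T(1) \<psi> by (simp add: tempered_extension_def)
    also have "\<dots> = bracket_D b s T (bessel b (- s) \<psi>)"
      by (simp add: bracket_D_apply bessel_bessel_minus test_schwartz[OF \<psi>])
    also have "\<dots> = (LINT x|lborel. g x * bessel b (- s) \<psi> x)"
      using T(2) by (simp add: represents_def schwartz_bessel test_schwartz[OF \<psi>])
    finally show ?thesis .
  qed
  then show ?R using h by (simp add: H_density_def L2_functions_iff)
next
  assume R: ?R
  then have g: "square_integrable g" by simp
  define T where "T \<phi> = (LINT x|lborel. g x * bessel b (- s) \<phi> x)" for \<phi>
  have int: "integrable lborel (\<lambda>x. g x * bessel b (- s) \<phi> x)" if "\<phi> \<in> schwartz" for \<phi>
    by (intro square_integrable_mult_integrable g schwartz_square_integrable schwartz_bessel that)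
  obtain C k where C: "C \<ge> 0" "\<And>\<phi>. \<phi> \<in> schwartz \<Longrightarrow> bessel_norm b (- s) \<phi> \<le> C * seminorm (2 * CARD('n)) k \<phi>"
    using bessel_norm_seminorm by metis
  have "norm (T \<phi>) \<le> (l2_norm g * C) * seminorm (2 * CARD('n)) k \<phi>" if \<phi>: "\<phi> \<in> schwartz" for \<phi>
  proof -
    have "norm (T \<phi>) \<le> l2_norm g * bessel_norm b (- s) \<phi>"
      unfolding T_def bessel_norm_def by (intro Cauchy_Schwarz_l2_norm g schwartz_square_integrable schwartz_bessel \<phi>)
    also have "\<dots> \<le> l2_norm g * (C * seminorm (2 * CARD('n)) k \<phi>)" by (intro mult_left_mono C \<phi>) simp
    finally show ?thesis by (simp add: mult.assoc)
  qed
  moreover have "linear_functional_on schwartz T"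
    unfolding linear_functional_on_def T_def
    by (auto simp: bessel_add bessel_cmult distrib_left int mult.left_commute[of _ "_ :: complex"])
  ultimately have "T \<in> tempered_distributions" by (auto simp: tempered_distributions_def)
  then have "tempered_extension u T" using R by (simp add: tempered_extension_def T_def)
  moreover have "represents g (bracket_D b s T)"
    unfolding represents_def bracket_D_apply T_def by (simp add: bessel_bessel_minus)
  ultimately show "H_density b s u g" using R by (auto simp: H_density_def L2_functions_iff)
qed

text \<open>The approximants are \<open>\<psi>\<^sub>k(x) = h(x/(k+1)) \<phi>(x)\<close> with a cut-off function \<open>h\<close> equal to \<open>1\<close> at the origin.
On the Fourier side, \<open>\<psi>\<^sub>k\<close> is a weighted average of the transform of \<open>\<phi>\<close> over small shifts, so the
convergence is pointwise and dominated by a power of \<open>1 + |\<xi>|\<close>.\<close>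

lemma test_functions_dense:
  fixes b :: "'n::finite \<Rightarrow> 'j::finite"
  assumes \<phi>: "\<phi> \<in> schwartz"
  obtains \<psi> where "\<And>k. \<psi> k \<in> test_functions" "(\<lambda>k. bessel_norm b s (\<lambda>x. \<psi> k x + - 1 * \<phi> x)) \<longlonglongrightarrow> 0"
proof -
  obtain \<eta> :: "real^'n \<Rightarrow> real" and V where e: "(\<lambda>x. complex_of_real (\<eta> x)) \<in> test_functions" "\<eta> 0 = 1"
    using cutoff_exists[of "{0 :: real^'n}" UNIV] by (metis compact_sing insert_subset open_UNIV subset_UNIV)
  define h where "h x = complex_of_real (\<eta> x)" for x
  have hD: "h \<in> test_functions" unfolding h_def by (rule e)
  have hS: "h \<in> schwartz" by (rule test_schwartz[OF hD])
  define \<epsilon> where "\<epsilon> k = inverse (real (Suc k))" for k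
  have \<epsilon>: "0 < \<epsilon> k" "\<epsilon> k \<le> 1" for k by (auto simp: \<epsilon>_def field_simps)
  have \<epsilon>0: "\<epsilon> \<longlonglongrightarrow> 0" unfolding \<epsilon>_def by (rule LIMSEQ_inverse_real_of_nat)
  define \<psi> where "\<psi> k x = h (\<epsilon> k *\<^sub>R x) * \<phi> x" for k x
  have \<psi>D: "\<psi> k \<in> test_functions" for k
    unfolding \<psi>_def using test_affine[OF hD, of "\<epsilon> k" 0] \<epsilon>(1)[of k]
    by (intro test_mult_right schwartz_smooth \<phi>) auto
  note \<psi>S = test_schwartz[OF \<psi>D]
  let ?I = inverse_fourier
  note IS = schwartz_inverse_fourier
  note [measurable] = schwartz_measurable[OF IS[OF hS]] schwartz_measurable[OF IS[OF \<phi>]] schwartz_measurable[OF IS[OF \<psi>S]]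
  obtain C l where C: "C > 0" "\<And>\<xi>. bracket b s \<xi> \<le> C * (1 + norm \<xi>) ^ l" using bracket_poly_bound by metis
  define N where "N = l + CARD('n)"
  obtain E where E: "E > 0" "\<And>\<xi>. (1 + norm \<xi>) ^ N * norm (?I \<phi> \<xi>) \<le> E"
    using rapidD[OF schwartz_rapid[OF IS[OF \<phi>]]] by metis
  have conv: "?I (\<psi> k) \<xi> = (LINT \<zeta>|lborel. ?I h \<zeta> * ?I \<phi> (\<xi> - \<epsilon> k *\<^sub>R \<zeta>))" for k \<xi>
    unfolding \<psi>_def by (rule inverse_fourier_mult[OF hS \<phi>])
  obtain B where B: "B > 0" "\<And>\<zeta>. (1 + norm \<zeta>) ^ (N + 2 * CARD('n)) * norm (?I h \<zeta>) \<le> B"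
    using rapidD[OF schwartz_rapid[OF IS[OF hS]]] by metis
  have split: "norm (?I h \<zeta>) * norm (?I \<phi> (\<xi> - \<epsilon> k *\<^sub>R \<zeta>)) * (1 + norm \<xi>) ^ N \<le> B * E * weight \<zeta>" for \<zeta> \<xi> k
  proof -
    have "norm \<xi> \<le> norm (\<xi> - \<epsilon> k *\<^sub>R \<zeta>) + norm (\<epsilon> k *\<^sub>R \<zeta>)" using norm_triangle_ineq[of "\<xi> - \<epsilon> k *\<^sub>R \<zeta>" "\<epsilon> k *\<^sub>R \<zeta>"] by simp
    also have "norm (\<epsilon> k *\<^sub>R \<zeta>) \<le> norm \<zeta>" using \<epsilon>[of k] by (simp add: mult_left_le_one_le)
    finally have "norm \<xi> \<le> norm (\<xi> - \<epsilon> k *\<^sub>R \<zeta>) + norm \<zeta>" by simp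
    moreover have "0 \<le> norm \<zeta> * norm (\<xi> - \<epsilon> k *\<^sub>R \<zeta>)" by simp
    ultimately have "1 + norm \<xi> \<le> (1 + norm \<zeta>) * (1 + norm (\<xi> - \<epsilon> k *\<^sub>R \<zeta>))"
      by (simp only: distrib_left distrib_right mult_1_left mult_1_right)
    then have "(1 + norm \<xi>) ^ N \<le> (1 + norm \<zeta>) ^ N * (1 + norm (\<xi> - \<epsilon> k *\<^sub>R \<zeta>)) ^ N"
      unfolding power_mult_distrib[symmetric] by (intro power_mono) auto
    then have "norm (?I h \<zeta>) * norm (?I \<phi> (\<xi> - \<epsilon> k *\<^sub>R \<zeta>)) * (1 + norm \<xi>) ^ N \<le>
        norm (?I h \<zeta>) * norm (?I \<phi> (\<xi> - \<epsilon> k *\<^sub>R \<zeta>)) * ((1 + norm \<zeta>) ^ N * (1 + norm (\<xi> - \<epsilon> k *\<^sub>R \<zeta>)) ^ N)"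
      by (intro mult_left_mono) auto
    also have "\<dots> = ((1 + norm \<zeta>) ^ N * norm (?I h \<zeta>)) * ((1 + norm (\<xi> - \<epsilon> k *\<^sub>R \<zeta>)) ^ N * norm (?I \<phi> (\<xi> - \<epsilon> k *\<^sub>R \<zeta>)))"
      by (simp add: mult_ac)
    also have "\<dots> \<le> (B * weight \<zeta>) * E"
    proof (rule mult_mono[OF _ E(2)])
      have "(1 + norm \<zeta>) ^ (2 * CARD('n)) > 0" by (simp add: add_pos_nonneg)
      then show "(1 + norm \<zeta>) ^ N * norm (?I h \<zeta>) \<le> B * weight \<zeta>"
        using B(2)[of \<zeta>] by (simp add: field_simps power_add)
    qed (use B in auto)
    finally show ?thesis by (simp add: mult_ac)
  qed
  define W where "W = (LINT x|lborel. weight (x::real^'n))"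
  have W0: "W \<ge> 0" unfolding W_def by (intro Bochner_Integration.integral_nonneg) simp
  have iconv: "integrable lborel (\<lambda>\<zeta>. ?I h \<zeta> * ?I \<phi> (\<xi> - \<epsilon> k *\<^sub>R \<zeta>))" for \<xi> k
  proof (rule Bochner_Integration.integrable_bound)
    show "integrable lborel (\<lambda>\<zeta>::real^'n. B * E * weight \<zeta>)" by (intro integrable_mult_right weight_integrable)
    show "AE \<zeta> in lborel. norm (?I h \<zeta> * ?I \<phi> (\<xi> - \<epsilon> k *\<^sub>R \<zeta>)) \<le> norm (B * E * weight \<zeta>)"
    proof (intro always_eventually allI)
      fix \<zeta> :: "real^'n"
      have "norm (?I h \<zeta>) * norm (?I \<phi> (\<xi> - \<epsilon> k *\<^sub>R \<zeta>)) * 1 \<le> norm (?I h \<zeta>) * norm (?I \<phi> (\<xi> - \<epsilon> k *\<^sub>R \<zeta>)) * (1 + norm \<xi>) ^ N"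
        by (intro mult_left_mono one_le_power) auto
      then show "norm (?I h \<zeta> * ?I \<phi> (\<xi> - \<epsilon> k *\<^sub>R \<zeta>)) \<le> norm (B * E * weight \<zeta>)"
        using split[of \<zeta> \<xi> k] by (simp add: norm_mult)
    qed
  qed measurable
  have bd: "norm (?I (\<psi> k) \<xi>) * (1 + norm \<xi>) ^ N \<le> B * E * W" for k \<xi>
  proof -
    have "norm (?I (\<psi> k) \<xi>) * (1 + norm \<xi>) ^ N \<le>
        (LINT \<zeta>|lborel. norm (?I h \<zeta> * ?I \<phi> (\<xi> - \<epsilon> k *\<^sub>R \<zeta>))) * (1 + norm \<xi>) ^ N"
      unfolding conv by (intro mult_right_mono integral_norm_bound) simp
    also have "\<dots> = (LINT \<zeta>|lborel. norm (?I h \<zeta>) * norm (?I \<phi> (\<xi> - \<epsilon> k *\<^sub>R \<zeta>)) * (1 + norm \<xi>) ^ N)"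
      by (simp add: norm_mult)
    also have "\<dots> \<le> (LINT \<zeta>|lborel. B * E * weight (\<zeta>::real^'n))"
      using integrable_norm[OF iconv]
      by (intro integral_mono integrable_mult_right integrable_mult_left weight_integrable split) (simp add: norm_mult)
    also have "\<dots> = B * E * W" by (simp add: W_def)
    finally show ?thesis .
  qed
  define G where "G = C * (B * E * W + E)"
  have G0: "G \<ge> 0" using C B E W0 by (simp add: G_def)
  have dom: "bracket b s \<xi> * norm (?I (\<psi> k) \<xi> - ?I \<phi> \<xi>) \<le> G / (1 + norm \<xi>) ^ CARD('n)" for k \<xi>
  proof -
    have p: "(1 + norm \<xi>) ^ CARD('n) > 0" by (simp add: add_pos_nonneg)
    have "(bracket b s \<xi> * norm (?I (\<psi> k) \<xi> - ?I \<phi> \<xi>)) * (1 + norm \<xi>) ^ CARD('n) \<le>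
        ((C * (1 + norm \<xi>) ^ l) * (norm (?I (\<psi> k) \<xi>) + norm (?I \<phi> \<xi>))) * (1 + norm \<xi>) ^ CARD('n)"
      by (intro mult_right_mono mult_mono C norm_triangle_ineq4) (use C(1) in auto)
    also have "\<dots> = C * (norm (?I (\<psi> k) \<xi>) * (1 + norm \<xi>) ^ N + (1 + norm \<xi>) ^ N * norm (?I \<phi> \<xi>))"
      by (simp add: N_def power_add algebra_simps)
    also have "\<dots> \<le> G" unfolding G_def using C(1) by (intro mult_left_mono add_mono bd E) auto
    finally show ?thesis using p by (simp add: pos_le_divide_eq)
  qed
  have pointwise: "(\<lambda>k. ?I (\<psi> k) \<xi>) \<longlonglongrightarrow> ?I \<phi> \<xi>" for \<xi>
  proof -
    have c: "isCont (?I \<phi>) x" for x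
      using IS[OF \<phi>] by (intro differentiable_imp_continuous_within smooth_differentiable schwartz_smooth)
    have "(\<lambda>k. LINT \<zeta>|lborel. ?I h \<zeta> * ?I \<phi> (\<xi> - \<epsilon> k *\<^sub>R \<zeta>)) \<longlonglongrightarrow> (LINT \<zeta>|lborel. ?I h \<zeta> * ?I \<phi> (\<xi> - 0 *\<^sub>R \<zeta>))"
    proof (rule integral_dominated_convergence[where w="\<lambda>\<zeta>. norm (?I h \<zeta>) * E"])
      show "integrable lborel (\<lambda>\<zeta>. norm (?I h \<zeta>) * E)"
        by (intro integrable_mult_left integrable_norm schwartz_integrable IS hS)
      show "AE \<zeta> in lborel. (\<lambda>k. ?I h \<zeta> * ?I \<phi> (\<xi> - \<epsilon> k *\<^sub>R \<zeta>)) \<longlonglongrightarrow> ?I h \<zeta> * ?I \<phi> (\<xi> - 0 *\<^sub>R \<zeta>)"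
        by (intro always_eventually allI tendsto_mult tendsto_const isCont_tendsto_compose[OF c] tendsto_diff tendsto_scaleR \<epsilon>0)
      have "norm (?I \<phi> x) \<le> E" for x
      proof -
        have "1 * norm (?I \<phi> x) \<le> (1 + norm x) ^ N * norm (?I \<phi> x)" by (intro mult_right_mono one_le_power) auto
        then show ?thesis using E(2)[of x] by simp
      qed
      then show "AE \<zeta> in lborel. norm (?I h \<zeta> * ?I \<phi> (\<xi> - \<epsilon> k *\<^sub>R \<zeta>)) \<le> norm (?I h \<zeta>) * E" for k
        by (intro always_eventually allI) (simp add: norm_mult mult_left_mono)
    qed measurable
    moreover have "(LINT \<zeta>|lborel. ?I h \<zeta>) = 1"
    proof -
      have "(LINT \<zeta>|lborel. ?I h \<zeta>) = fourier (?I h) 0" by (simp add: fourier_def)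
      then show ?thesis by (simp add: fourier_inverse_fourier_id[OF hS] h_def e)
    qed
    ultimately show ?thesis by (simp add: conv)
  qed
  have dS: "(\<lambda>x. \<psi> k x + - 1 * \<phi> x) \<in> schwartz" for k by (intro schwartz_add \<psi>S schwartz_cmult \<phi>)
  have sq: "ennreal ((bessel_norm b s (\<lambda>x. \<psi> k x + - 1 * \<phi> x))\<^sup>2) = ennreal ((2 * pi) ^ CARD('n)) *
      (\<integral>\<^sup>+\<xi>. ennreal ((bracket b s \<xi> * norm (?I (\<psi> k) \<xi> - ?I \<phi> \<xi>))\<^sup>2) \<partial>lborel)" for k
    unfolding bessel_norm_square[OF dS] inverse_fourier_add[OF \<psi>S schwartz_cmult[OF \<phi>]] inverse_fourier_cmult by simp
  have "(\<lambda>k. \<integral>\<^sup>+\<xi>. ennreal ((bracket b s \<xi> * norm (?I (\<psi> k) \<xi> - ?I \<phi> \<xi>))\<^sup>2) \<partial>lborel) \<longlonglongrightarrow> (\<integral>\<^sup>+\<xi>. 0 \<partial>(lborel :: (real^'n) measure))"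
  proof (rule nn_integral_dominated_convergence[where w="\<lambda>\<xi>. ennreal ((G / (1 + norm \<xi>) ^ CARD('n))\<^sup>2)"])
    show "(\<integral>\<^sup>+\<xi>. ennreal ((G / (1 + norm (\<xi>::real^'n)) ^ CARD('n))\<^sup>2) \<partial>lborel) < \<infinity>"
      unfolding square_weight_nn_integral[OF G0] by simp
    show "AE \<xi> in lborel. ennreal ((bracket b s \<xi> * norm (?I (\<psi> k) \<xi> - ?I \<phi> \<xi>))\<^sup>2) \<le> ennreal ((G / (1 + norm \<xi>) ^ CARD('n))\<^sup>2)" for k
      by (intro always_eventually allI ennreal_leI power_mono dom) (simp add: bracket_nonneg)
    show "AE \<xi> in lborel. (\<lambda>k. ennreal ((bracket b s \<xi> * norm (?I (\<psi> k) \<xi> - ?I \<phi> \<xi>))\<^sup>2)) \<longlonglongrightarrow> 0"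
    proof (intro always_eventually allI)
      fix \<xi>
      have "(\<lambda>k. ennreal ((bracket b s \<xi> * norm (?I (\<psi> k) \<xi> - ?I \<phi> \<xi>))\<^sup>2)) \<longlonglongrightarrow> ennreal ((bracket b s \<xi> * norm (?I \<phi> \<xi> - ?I \<phi> \<xi>))\<^sup>2)"
        by (intro tendsto_ennrealI tendsto_power tendsto_mult tendsto_const tendsto_norm tendsto_diff pointwise)
      then show "(\<lambda>k. ennreal ((bracket b s \<xi> * norm (?I (\<psi> k) \<xi> - ?I \<phi> \<xi>))\<^sup>2)) \<longlonglongrightarrow> 0" by simp
    qed
  qed measurable
  then have "(\<lambda>k. ennreal ((2 * pi) ^ CARD('n)) * (\<integral>\<^sup>+\<xi>. ennreal ((bracket b s \<xi> * norm (?I (\<psi> k) \<xi> - ?I \<phi> \<xi>))\<^sup>2) \<partial>lborel)) \<longlonglongrightarrow> ennreal ((2 * pi) ^ CARD('n)) * 0"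
    by (intro ennreal_tendsto_cmult) (simp_all add: ennreal_less_top)
  then have "(\<lambda>k. ennreal ((bessel_norm b s (\<lambda>x. \<psi> k x + - 1 * \<phi> x))\<^sup>2)) \<longlonglongrightarrow> ennreal 0" unfolding sq by simp
  then have "(\<lambda>k. (bessel_norm b s (\<lambda>x. \<psi> k x + - 1 * \<phi> x))\<^sup>2) \<longlonglongrightarrow> 0"
    by (subst (asm) tendsto_ennreal_iff) auto
  from tendsto_real_sqrt[OF this] have "(\<lambda>k. bessel_norm b s (\<lambda>x. \<psi> k x + - 1 * \<phi> x)) \<longlonglongrightarrow> 0" by simp
  then show thesis using that \<psi>D by blast
qed

text \<open>By density, \<open>g\<close> is orthogonal to the image under \<open>bessel b s\<close> of all Schwartz functions, and that
image contains every test function.\<close>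

lemma H_density_unique:
  fixes b :: "'n::finite \<Rightarrow> 'j::finite"
  assumes g: "square_integrable g" and orth: "\<And>\<psi>. \<psi> \<in> test_functions \<Longrightarrow> (LINT x|lborel. g x * bessel b s \<psi> x) = 0"
  shows "AE x in lborel. g x = 0"
proof (rule zero_if_orthogonal_to_test_functions[OF g])
  fix \<phi> :: "real^'n \<Rightarrow> complex" assume \<phi>: "\<phi> \<in> test_functions"
  define \<theta> where "\<theta> = bessel b (- s) \<phi>"
  have \<theta>: "\<theta> \<in> schwartz" unfolding \<theta>_def by (intro schwartz_bessel test_schwartz \<phi>)
  \<comment> \<open>\<open>bessel b s \<theta> = \<phi>\<close>, and \<open>\<theta>\<close> is approximated by test functions.\<close>
  obtain \<psi> where \<psi>: "\<And>k. \<psi> k \<in> test_functions" "(\<lambda>k. bessel_norm b s (\<lambda>x. \<psi> k x + - 1 * \<theta> x)) \<longlonglongrightarrow> 0"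
    by (rule test_functions_dense[OF \<theta>, where b=b and s=s]) blast
  have "norm (LINT x|lborel. g x * \<phi> x) \<le> l2_norm g * bessel_norm b s (\<lambda>x. \<psi> k x + - 1 * \<theta> x)" for k
  proof -
    have S: "\<psi> k \<in> schwartz" "(\<lambda>x. - 1 * \<theta> x) \<in> schwartz" by (intro test_schwartz \<psi> schwartz_cmult \<theta>)+
    have "(LINT x|lborel. g x * bessel b s (\<lambda>x. \<psi> k x + - 1 * \<theta> x) x) =
        (LINT x|lborel. g x * bessel b s (\<psi> k) x + - 1 * (g x * bessel b s \<theta> x))"
      unfolding bessel_add[OF S] bessel_cmult by (simp add: ring_distribs)
    also have "\<dots> = - (LINT x|lborel. g x * bessel b s \<theta> x)"
      by (subst Bochner_Integration.integral_add)
        (simp_all add: orth \<psi> square_integrable_mult_integrable g schwartz_square_integrable schwartz_bessel S \<theta>)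
    also have "bessel b s \<theta> = \<phi>" unfolding \<theta>_def by (simp add: bessel_bessel_minus test_schwartz \<phi>)
    finally have "norm (LINT x|lborel. g x * \<phi> x) = norm (LINT x|lborel. g x * bessel b s (\<lambda>x. \<psi> k x + - 1 * \<theta> x) x)" by simp
    also have "\<dots> \<le> l2_norm g * bessel_norm b s (\<lambda>x. \<psi> k x + - 1 * \<theta> x)"
      unfolding bessel_norm_def by (intro Cauchy_Schwarz_l2_norm g schwartz_square_integrable schwartz_bessel schwartz_add S)
    finally show ?thesis .
  qed
  moreover have "(\<lambda>k. l2_norm g * bessel_norm b s (\<lambda>x. \<psi> k x + - 1 * \<theta> x)) \<longlonglongrightarrow> 0"
    by (rule tendsto_mult_right_zero[OF \<psi>(2)])
  ultimately have "norm (LINT x|lborel. g x * \<phi> x) \<le> 0" by (intro LIMSEQ_le_const) auto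
  then show "(LINT x|lborel. g x * \<phi> x) = 0" by simp
qed

lemma l2_norm_cong_AE: "square_integrable f \<Longrightarrow> square_integrable g \<Longrightarrow> AE x in lborel. f x = g x \<Longrightarrow> l2_norm f = l2_norm g"
  unfolding l2_norm_def by (intro arg_cong[where f=sqrt] integral_cong_AE) auto

text \<open>The density chosen in the definition of the norm is arbitrary, but any two densities of \<open>u\<close> agree
almost everywhere.\<close>

lemma H_norm_eq:
  fixes b :: "'n::finite \<Rightarrow> 'j::finite"
  assumes "H_density b s u g" shows "u \<in> H_space b s" "H_norm b s u = ennreal (l2_norm g)"
proof -
  show us: "u \<in> H_space b s" using assms by (auto simp: H_space_def)
  define g' where "g' = (SOME g. H_density b s u g)"
  have g': "H_density b s u g'" unfolding g'_def by (rule someI[of _ g]) (rule assms)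
  note gg = assms[unfolded H_density_iff] g'[unfolded H_density_iff]
  have sg: "square_integrable g" "square_integrable g'" using gg by auto
  have "AE x in lborel. g x - g' x = 0"
  proof (rule H_density_unique[of _ b "- s"])
    show "square_integrable (\<lambda>x. g x - g' x)" by (intro square_integrable_diff sg)
    fix \<psi> :: "real^'n \<Rightarrow> complex" assume \<psi>: "\<psi> \<in> test_functions"
    have "(LINT x|lborel. (g x - g' x) * bessel b (- s) \<psi> x) =
        (LINT x|lborel. g x * bessel b (- s) \<psi> x) - (LINT x|lborel. g' x * bessel b (- s) \<psi> x)"
      unfolding left_diff_distrib
      by (intro Bochner_Integration.integral_diff square_integrable_mult_integrable sg schwartz_square_integrable schwartz_bessel test_schwartz \<psi>)
    then show "(LINT x|lborel. (g x - g' x) * bessel b (- s) \<psi> x) = 0" using gg \<psi> by simp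
  qed
  then have "l2_norm g = l2_norm g'" by (intro l2_norm_cong_AE sg) simp
  then show "H_norm b s u = ennreal (l2_norm g)"
    using us sg by (simp add: H_norm_def g'_def[symmetric] L2_norm_eq)
qed

lemma H_norm_bound:
  assumes "u \<in> H_space b s"
  obtains A where "A \<ge> 0" "H_norm b s u = ennreal A"
    "\<And>\<psi>. \<psi> \<in> test_functions \<Longrightarrow> norm (u \<psi>) \<le> A * bessel_norm b (- s) \<psi>"
proof -
  obtain g where g: "H_density b s u g" using assms by (auto simp: H_space_def)
  have "norm (u \<psi>) \<le> l2_norm g * bessel_norm b (- s) \<psi>" if "\<psi> \<in> test_functions" for \<psi>
    using g that Cauchy_Schwarz_l2_norm[OF _ schwartz_square_integrable[OF schwartz_bessel[OF test_schwartz[OF that]]], of g b "- s"]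
    unfolding H_density_iff bessel_norm_def by auto
  then show thesis using that[OF l2_norm_nonneg H_norm_eq(2)[OF g]] by blast
qed

text \<open>Together with the preceding bound this is the description of \<open>\<H>\<^sup>s\<close> by duality: membership and
the norm can be read off from the values on test functions alone.\<close>

lemma H_norm_leI:
  fixes b :: "'n::finite \<Rightarrow> 'j::finite"
  assumes u: "u \<in> distributions" and A: "A \<ge> 0"
    "\<And>\<psi>. \<psi> \<in> test_functions \<Longrightarrow> norm (u \<psi>) \<le> A * bessel_norm b (- s) \<psi>"
  shows "u \<in> H_space b s" "H_norm b s u \<le> ennreal A"
proof -
  obtain g where g: "square_integrable g" "l2_norm g \<le> A" "\<And>\<phi>. \<phi> \<in> test_functions \<Longrightarrow> u \<phi> = (LINT x|lborel. g x * bessel b (- s) \<phi> x)"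
  proof (rule riesz_representation[of test_functions "bessel b (- s)" u A])
    show "\<And>\<phi>. \<phi> \<in> test_functions \<Longrightarrow> cmod (u \<phi>) \<le> A * l2_norm (bessel b (- s) \<phi>)"
      using A(2) unfolding bessel_norm_def .
  qed (use A(1) in \<open>auto intro: test_zero test_add test_cmult distributions_linear[OF u]
        schwartz_square_integrable schwartz_bessel test_schwartz simp: bessel_add bessel_cmult test_schwartz\<close>)
  have d: "H_density b s u g" unfolding H_density_iff using g u by simp
  show "u \<in> H_space b s" "H_norm b s u \<le> ennreal A"
    using H_norm_eq[OF d] g(2) by (auto intro: ennreal_leI)
qed

section \<open>Localisation by translated cut-off functions\<close>

lemma bessel_norm_translate:
  assumes "\<phi> \<in> schwartz" shows "bessel_norm b s (\<lambda>x. \<phi> (x + a)) = bessel_norm b s \<phi>"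
proof -
  have "ennreal ((bessel_norm b s (\<lambda>x. \<phi> (x + a)))\<^sup>2) = ennreal ((bessel_norm b s \<phi>)\<^sup>2)"
    unfolding bessel_norm_square[OF schwartz_translate[OF assms]] bessel_norm_square[OF assms]
      inverse_fourier_translate[OF schwartz_measurable[OF assms]]
    by (simp add: norm_mult)
  then show ?thesis by (simp add: power2_eq_iff_nonneg)
qed

text \<open>For a fixed frequency \<open>\<xi>\<close>, the transform of the localised function is itself a Fourier transform
in the translation parameter \<open>y\<close>. This is what makes Plancherel's theorem available in \<open>y\<close>.\<close>

lemma inverse_fourier_localised:
  fixes h \<phi> :: "real^'n::finite \<Rightarrow> complex"
  assumes h: "h \<in> schwartz" and \<phi>: "\<phi> \<in> schwartz"
  shows "inverse_fourier (\<lambda>x. h (x + y) * \<phi> x) \<xi> =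
    fourier (\<lambda>\<zeta>. inverse_fourier h \<zeta> * inverse_fourier \<phi> (\<xi> - \<zeta>)) y"
proof -
  have "inverse_fourier (\<lambda>x. h (x + y) * \<phi> x) \<xi> =
      (LINT \<zeta>|lborel. inverse_fourier (\<lambda>x. h (x + y)) \<zeta> * inverse_fourier \<phi> (\<xi> - \<zeta>))"
    using inverse_fourier_mult[OF schwartz_translate[OF h, of y] \<phi>, of 1 \<xi>] by simp
  also have "\<dots> = fourier (\<lambda>\<zeta>. inverse_fourier h \<zeta> * inverse_fourier \<phi> (\<xi> - \<zeta>)) y"
    unfolding fourier_def inverse_fourier_translate[OF schwartz_measurable[OF h]]
    by (simp add: inner_commute mult.assoc)
  finally show ?thesis .
qed

lemma localised_measurable:
  fixes b :: "'n::finite \<Rightarrow> 'j::finite"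
  assumes h: "h \<in> schwartz" and \<phi>: "\<phi> \<in> schwartz"
  shows "(\<lambda>(y, \<xi>). ennreal ((bracket b s \<xi> * norm (inverse_fourier (\<lambda>x. h (x + y) * \<phi> x) \<xi>))\<^sup>2)) \<in>
    borel_measurable (lborel \<Otimes>\<^sub>M lborel)"
proof -
  note [measurable] = schwartz_measurable[OF schwartz_inverse_fourier[OF h]]
    schwartz_measurable[OF schwartz_inverse_fourier[OF \<phi>]]
  show ?thesis unfolding inverse_fourier_localised[OF h \<phi>] fourier_def by measurable
qed

text \<open>The square of the left-hand norm is an integral over \<open>\<xi>\<close>. Interchanging it with the integral over \<open>y\<close>
and using Plancherel's theorem in \<open>y\<close> leaves the double integral of
\<open>\<langle>\<langle>\<xi>\<rangle>\<rangle>\<^sup>2\<^sup>s |h\<hat>(\<zeta>)|\<^sup>2 |\<phi>\<hat>(\<xi> - \<zeta>)|\<^sup>2\<close>, and Peetre's inequality separates the variables.\<close>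

lemma localisation_inequality:
  fixes b :: "'n::finite \<Rightarrow> 'j::finite"
  assumes h: "h \<in> schwartz"
  obtains C where "C \<ge> 0"
    "\<And>\<phi>. \<phi> \<in> schwartz \<Longrightarrow> (\<lambda>y. ennreal ((bessel_norm b s (\<lambda>x. h (x + y) * \<phi> x))\<^sup>2)) \<in> borel_measurable borel"
    "\<And>\<phi>. \<phi> \<in> schwartz \<Longrightarrow>
      (\<integral>\<^sup>+y. ennreal ((bessel_norm b s (\<lambda>x. h (x + y) * \<phi> x))\<^sup>2) \<partial>lborel) \<le> ennreal (C * (bessel_norm b s \<phi>)\<^sup>2)"
proof -
  define c where "c = 2 powr (\<Sum>l\<in>UNIV. \<bar>s $ l\<bar> / 2)"
  define t where "t = (\<chi> l. \<bar>s $ l\<bar>)"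
  define P where "P = ennreal ((2 * pi) ^ CARD('n))"
  define C where "C = c\<^sup>2 * (bessel_norm b t h)\<^sup>2"
  let ?I = inverse_fourier
  have main: "(\<lambda>y. ennreal ((bessel_norm b s (\<lambda>x. h (x + y) * \<phi> x))\<^sup>2)) \<in> borel_measurable borel \<and>
     (\<integral>\<^sup>+y. ennreal ((bessel_norm b s (\<lambda>x. h (x + y) * \<phi> x))\<^sup>2) \<partial>lborel) \<le> ennreal (C * (bessel_norm b s \<phi>)\<^sup>2)"
    if \<phi>: "\<phi> \<in> schwartz" for \<phi> :: "real^'n \<Rightarrow> complex"
  proof -
    note Im[measurable] = schwartz_measurable[OF schwartz_inverse_fourier[OF h]]
      schwartz_measurable[OF schwartz_inverse_fourier[OF \<phi>]]
    define w where "w \<xi> \<zeta> = ?I h \<zeta> * ?I \<phi> (\<xi> - \<zeta>)" for \<xi> \<zeta>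
    have wS: "w \<xi> \<in> schwartz" for \<xi>
      unfolding w_def using schwartz_affine[OF schwartz_inverse_fourier[OF \<phi>], of "- 1" \<xi>]
      by (intro schwartz_mult schwartz_inverse_fourier h) simp
    have loc: "?I (\<lambda>x. h (x + y) * \<phi> x) \<xi> = fourier (w \<xi>) y" for y \<xi>
      unfolding w_def by (rule inverse_fourier_localised[OF h \<phi>])
    have S: "(\<lambda>x. h (x + y) * \<phi> x) \<in> schwartz" for y
      by (intro schwartz_mult schwartz_translate h \<phi>)
    have mm[measurable]: "(\<lambda>(y, \<xi>). ennreal ((bracket b s \<xi> * norm (fourier (w \<xi>) y))\<^sup>2)) \<in> borel_measurable (lborel \<Otimes>\<^sub>M lborel)"
      using localised_measurable[OF h \<phi>, of b s] unfolding loc .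
    have Hy: "ennreal ((bessel_norm b s (\<lambda>x. h (x + y) * \<phi> x))\<^sup>2) =
        P * (\<integral>\<^sup>+\<xi>. ennreal ((bracket b s \<xi> * norm (fourier (w \<xi>) y))\<^sup>2) \<partial>lborel)" for y
      unfolding bessel_norm_square[OF S] loc P_def ..
    have m1: "(\<lambda>y. \<integral>\<^sup>+\<xi>. ennreal ((bracket b s \<xi> * norm (fourier (w \<xi>) y))\<^sup>2) \<partial>lborel) \<in> borel_measurable lborel"
      using lborel.borel_measurable_nn_integral[OF mm] by simp
    then have m2: "(\<lambda>y. ennreal ((bessel_norm b s (\<lambda>x. h (x + y) * \<phi> x))\<^sup>2)) \<in> borel_measurable borel"
      unfolding Hy by simp
    have peetre: "ennreal ((bracket b s \<xi> * norm (w \<xi> \<zeta>))\<^sup>2) \<le>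
        ennreal (c\<^sup>2) * (ennreal ((bracket b t \<zeta> * norm (?I h \<zeta>))\<^sup>2) * ennreal ((bracket b s (\<xi> - \<zeta>) * norm (?I \<phi> (\<xi> - \<zeta>)))\<^sup>2))" for \<xi> \<zeta>
    proof -
      have "bracket b s \<xi> \<le> c * bracket b s (\<xi> - \<zeta>) * bracket b t \<zeta>"
        using bracket_peetre[of b s "\<xi> - \<zeta>" \<zeta>] by (simp add: c_def t_def)
      then have "bracket b s \<xi> * norm (w \<xi> \<zeta>) \<le> (c * bracket b s (\<xi> - \<zeta>) * bracket b t \<zeta>) * norm (w \<xi> \<zeta>)"
        by (intro mult_right_mono) auto
      also have "\<dots> = c * ((bracket b t \<zeta> * norm (?I h \<zeta>)) * (bracket b s (\<xi> - \<zeta>) * norm (?I \<phi> (\<xi> - \<zeta>))))"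
        by (simp add: w_def norm_mult)
      finally have "(bracket b s \<xi> * norm (w \<xi> \<zeta>))\<^sup>2 \<le>
          (c * ((bracket b t \<zeta> * norm (?I h \<zeta>)) * (bracket b s (\<xi> - \<zeta>) * norm (?I \<phi> (\<xi> - \<zeta>)))))\<^sup>2"
        by (intro power_mono) (auto simp: bracket_nonneg)
      then have "ennreal ((bracket b s \<xi> * norm (w \<xi> \<zeta>))\<^sup>2) \<le>
          ennreal (c\<^sup>2 * ((bracket b t \<zeta> * norm (?I h \<zeta>))\<^sup>2 * (bracket b s (\<xi> - \<zeta>) * norm (?I \<phi> (\<xi> - \<zeta>)))\<^sup>2))"
        unfolding power_mult_distrib[of c] power_mult_distrib[of "bracket b t \<zeta> * norm (?I h \<zeta>)"] by (rule ennreal_leI)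
      also have "\<dots> = ennreal (c\<^sup>2) * (ennreal ((bracket b t \<zeta> * norm (?I h \<zeta>))\<^sup>2) * ennreal ((bracket b s (\<xi> - \<zeta>) * norm (?I \<phi> (\<xi> - \<zeta>)))\<^sup>2))"
        by (subst ennreal_mult, simp, simp, subst ennreal_mult, simp, simp, rule refl)
      finally show ?thesis .
    qed
    define J where "J = (\<integral>\<^sup>+\<xi>. ennreal ((bracket b s \<xi> * norm (?I \<phi> \<xi>))\<^sup>2) \<partial>lborel)"
    define Q where "Q = (\<integral>\<^sup>+\<zeta>. ennreal ((bracket b t \<zeta> * norm (?I h \<zeta>))\<^sup>2) \<partial>lborel)"
    have shift: "(\<integral>\<^sup>+\<xi>. ennreal ((bracket b s (\<xi> - \<zeta>) * norm (?I \<phi> (\<xi> - \<zeta>)))\<^sup>2) \<partial>lborel) = J" for \<zeta>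
      unfolding J_def
      using lborel_translate_nn_integral[of "\<lambda>\<xi>. ennreal ((bracket b s \<xi> * norm (?I \<phi> \<xi>))\<^sup>2)" "- \<zeta>"] by simp
    have 1: "(\<integral>\<^sup>+y. ennreal ((bessel_norm b s (\<lambda>x. h (x + y) * \<phi> x))\<^sup>2) \<partial>lborel) =
        P * (\<integral>\<^sup>+y. \<integral>\<^sup>+\<xi>. ennreal ((bracket b s \<xi> * norm (fourier (w \<xi>) y))\<^sup>2) \<partial>lborel \<partial>lborel)"
      unfolding Hy by (rule nn_integral_cmult) (rule m1)
    have "(\<integral>\<^sup>+y. \<integral>\<^sup>+\<xi>. ennreal ((bracket b s \<xi> * norm (fourier (w \<xi>) y))\<^sup>2) \<partial>lborel \<partial>lborel) =
        (\<integral>\<^sup>+\<xi>. \<integral>\<^sup>+y. ennreal ((bracket b s \<xi> * norm (fourier (w \<xi>) y))\<^sup>2) \<partial>lborel \<partial>lborel)"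
      by (rule lborel_pair.Fubini'[symmetric]) (rule mm)
    also have "\<dots> = (\<integral>\<^sup>+\<xi>. P * (\<integral>\<^sup>+\<zeta>. ennreal ((bracket b s \<xi> * norm (w \<xi> \<zeta>))\<^sup>2) \<partial>lborel) \<partial>lborel)"
    proof (rule nn_integral_cong)
      fix \<xi>
      note [measurable] = schwartz_measurable[OF wS, of \<xi>] schwartz_measurable[OF schwartz_fourier[OF wS], of \<xi>]
      have "(\<integral>\<^sup>+y. ennreal ((bracket b s \<xi> * norm (fourier (w \<xi>) y))\<^sup>2) \<partial>lborel) =
          ennreal ((bracket b s \<xi>)\<^sup>2) * (\<integral>\<^sup>+y. ennreal ((norm (fourier (w \<xi>) y))\<^sup>2) \<partial>lborel)"
        by (subst nn_integral_cmult[symmetric]) (auto simp: power_mult_distrib ennreal_mult)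
      also have "\<dots> = P * (ennreal ((bracket b s \<xi>)\<^sup>2) * (\<integral>\<^sup>+y. ennreal ((norm (w \<xi> y))\<^sup>2) \<partial>lborel))"
        unfolding plancherel_fourier_norm[OF wS] P_def by (simp add: mult.left_commute)
      also have "ennreal ((bracket b s \<xi>)\<^sup>2) * (\<integral>\<^sup>+y. ennreal ((norm (w \<xi> y))\<^sup>2) \<partial>lborel) =
          (\<integral>\<^sup>+\<zeta>. ennreal ((bracket b s \<xi> * norm (w \<xi> \<zeta>))\<^sup>2) \<partial>lborel)"
        by (subst nn_integral_cmult[symmetric]) (auto simp: power_mult_distrib ennreal_mult)
      finally show "(\<integral>\<^sup>+y. ennreal ((bracket b s \<xi> * norm (fourier (w \<xi>) y))\<^sup>2) \<partial>lborel) =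
          P * (\<integral>\<^sup>+\<zeta>. ennreal ((bracket b s \<xi> * norm (w \<xi> \<zeta>))\<^sup>2) \<partial>lborel)" .
    qed
    also have "\<dots> \<le> (\<integral>\<^sup>+\<xi>. P * (\<integral>\<^sup>+\<zeta>. ennreal (c\<^sup>2) * (ennreal ((bracket b t \<zeta> * norm (?I h \<zeta>))\<^sup>2) *
        ennreal ((bracket b s (\<xi> - \<zeta>) * norm (?I \<phi> (\<xi> - \<zeta>)))\<^sup>2)) \<partial>lborel) \<partial>lborel)"
      by (intro nn_integral_mono mult_left_mono peetre) auto
    also have "\<dots> = P * (\<integral>\<^sup>+\<xi>. \<integral>\<^sup>+\<zeta>. ennreal (c\<^sup>2) * (ennreal ((bracket b t \<zeta> * norm (?I h \<zeta>))\<^sup>2) *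
        ennreal ((bracket b s (\<xi> - \<zeta>) * norm (?I \<phi> (\<xi> - \<zeta>)))\<^sup>2)) \<partial>lborel \<partial>lborel)"
      by (rule nn_integral_cmult) measurable
    also have "(\<integral>\<^sup>+\<xi>. \<integral>\<^sup>+\<zeta>. ennreal (c\<^sup>2) * (ennreal ((bracket b t \<zeta> * norm (?I h \<zeta>))\<^sup>2) *
        ennreal ((bracket b s (\<xi> - \<zeta>) * norm (?I \<phi> (\<xi> - \<zeta>)))\<^sup>2)) \<partial>lborel \<partial>lborel) =
      (\<integral>\<^sup>+\<zeta>. \<integral>\<^sup>+\<xi>. ennreal (c\<^sup>2) * (ennreal ((bracket b t \<zeta> * norm (?I h \<zeta>))\<^sup>2) *
        ennreal ((bracket b s (\<xi> - \<zeta>) * norm (?I \<phi> (\<xi> - \<zeta>)))\<^sup>2)) \<partial>lborel \<partial>lborel)"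
      by (rule lborel_pair.Fubini'[symmetric]) measurable
    also have "\<dots> = (\<integral>\<^sup>+\<zeta>. ennreal (c\<^sup>2) * (ennreal ((bracket b t \<zeta> * norm (?I h \<zeta>))\<^sup>2) * J) \<partial>lborel)"
      by (simp add: nn_integral_cmult shift del: ennreal_power)
    also have "\<dots> = ennreal (c\<^sup>2) * (Q * J)"
      unfolding Q_def by (simp add: nn_integral_cmult nn_integral_multc del: ennreal_power)
    finally have *: "(\<integral>\<^sup>+y. ennreal ((bessel_norm b s (\<lambda>x. h (x + y) * \<phi> x))\<^sup>2) \<partial>lborel) \<le> P * (P * (ennreal (c\<^sup>2) * (Q * J)))"
      unfolding 1 by (rule mult_left_mono) simp
    have "P * (P * (ennreal (c\<^sup>2) * (Q * J))) = ennreal (c\<^sup>2) * ((P * Q) * (P * J))" by (simp add: mult_ac)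
    also have "\<dots> = ennreal (c\<^sup>2) * (ennreal ((bessel_norm b t h)\<^sup>2) * ennreal ((bessel_norm b s \<phi>)\<^sup>2))"
      unfolding bessel_norm_square[OF h] bessel_norm_square[OF \<phi>] P_def Q_def J_def ..
    also have "\<dots> = ennreal (C * (bessel_norm b s \<phi>)\<^sup>2)"
      unfolding C_def by (simp add: ennreal_mult mult.assoc del: ennreal_power)
    finally show ?thesis using * m2 by simp
  qed
  have "C \<ge> 0" by (simp add: C_def)
  with main show thesis using that by blast
qed

text \<open>The factor \<open>2\<close> makes the comparison with the average strict when \<open>M > 0\<close>; when \<open>M = 0\<close>, the
function vanishes almost everywhere on \<open>B\<close>, which is not a null set.\<close>

lemma exists_le_average:
  assumes [measurable]: "g \<in> borel_measurable borel" "B \<in> sets borel"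
    and B: "emeasure lborel (B :: 'a::euclidean_space set) = ennreal v" "v > 0"
    and M: "(\<integral>\<^sup>+y\<in>B. g y \<partial>lborel) \<le> ennreal M" "M \<ge> 0"
  shows "\<exists>y\<in>B. g y \<le> ennreal (2 * M / v)"
proof (rule ccontr)
  assume "\<not> (\<exists>y\<in>B. g y \<le> ennreal (2 * M / v))"
  then have gt: "g y > ennreal (2 * M / v)" if "y \<in> B" for y using that by (simp add: not_le)
  show False
  proof (cases "M = 0")
    case True
    then have "(\<integral>\<^sup>+y\<in>B. g y \<partial>lborel) = 0" using M by simp
    then have "AE y in lborel. g y * indicator B y = 0" by (subst (asm) nn_integral_0_iff_AE) auto
    then have "AE y in lborel. y \<notin> B"
      by eventually_elim (use gt True in \<open>force simp: indicator_def\<close>)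
    then have "emeasure lborel B = 0" by (subst (asm) AE_iff_measurable[OF _ refl]) (auto simp: assms)
    then show False using B by simp
  next
    case False
    then have "M > 0" using M by simp
    have "ennreal (2 * M) = ennreal (2 * M / v) * ennreal v" using B M by (simp flip: ennreal_mult)
    also have "\<dots> = (\<integral>\<^sup>+y. ennreal (2 * M / v) * indicator B y \<partial>lborel)" by (simp add: nn_integral_cmult B)
    also have "\<dots> \<le> (\<integral>\<^sup>+y\<in>B. g y \<partial>lborel)"
      by (intro nn_integral_mono) (use gt in \<open>auto simp: indicator_def less_imp_le\<close>)
    also have "\<dots> \<le> ennreal M" by (rule M)
    finally show False using \<open>M > 0\<close> by simp
  qed
qed

text \<open>A single translation \<open>y\<close> serves the whole family, because the localisation inequality is summed
over the family before \<open>y\<close> is chosen.\<close>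

lemma localise_family:
  fixes b :: "'n::finite \<Rightarrow> 'j::finite"
  assumes h: "h \<in> schwartz" and r: "r > 0"
  obtains C where "C \<ge> 0"
    "\<And>(F :: 'i set) \<psi>. finite F \<Longrightarrow> (\<And>\<gamma>. \<gamma> \<in> F \<Longrightarrow> \<psi> \<gamma> \<in> schwartz) \<Longrightarrow>
      \<exists>y\<in>ball 0 r. (\<Sum>\<gamma>\<in>F. (bessel_norm b s (\<lambda>x. h (x + y) * \<psi> \<gamma> x))\<^sup>2) \<le> C * (\<Sum>\<gamma>\<in>F. (bessel_norm b s (\<psi> \<gamma>))\<^sup>2)"
proof -
  obtain C where C: "C \<ge> 0"
    "\<And>\<phi>. \<phi> \<in> schwartz \<Longrightarrow> (\<lambda>y. ennreal ((bessel_norm b s (\<lambda>x. h (x + y) * \<phi> x))\<^sup>2)) \<in> borel_measurable borel"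
    "\<And>\<phi>. \<phi> \<in> schwartz \<Longrightarrow>
      (\<integral>\<^sup>+y. ennreal ((bessel_norm b s (\<lambda>x. h (x + y) * \<phi> x))\<^sup>2) \<partial>lborel) \<le> ennreal (C * (bessel_norm b s \<phi>)\<^sup>2)"
    using localisation_inequality[OF h, where b=b and s=s] by blast
  define v where "v = measure lborel (ball (0::real^'n) r)"
  have v: "emeasure lborel (ball (0::real^'n) r) = ennreal v" "v > 0"
    using content_ball_pos[OF r, of "0::real^'n"] emeasure_bounded_finite[OF bounded_ball, of "0::real^'n" r]
    by (auto simp: v_def emeasure_eq_ennreal_measure)
  have "\<exists>y\<in>ball 0 r. (\<Sum>\<gamma>\<in>F. (bessel_norm b s (\<lambda>x. h (x + y) * \<psi> \<gamma> x))\<^sup>2) \<le> (2 * C / v) * (\<Sum>\<gamma>\<in>F. (bessel_norm b s (\<psi> \<gamma>))\<^sup>2)"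
    if F: "finite F" "\<And>\<gamma>. \<gamma> \<in> F \<Longrightarrow> \<psi> \<gamma> \<in> schwartz" for F :: "'i set" and \<psi>
  proof -
    let ?g = "\<lambda>y. \<Sum>\<gamma>\<in>F. ennreal ((bessel_norm b s (\<lambda>x. h (x + y) * \<psi> \<gamma> x))\<^sup>2)"
    define M where "M = C * (\<Sum>\<gamma>\<in>F. (bessel_norm b s (\<psi> \<gamma>))\<^sup>2)"
    have M0: "M \<ge> 0" using C by (simp add: M_def sum_nonneg)
    have "(\<integral>\<^sup>+y\<in>ball 0 r. ?g y \<partial>lborel) \<le> (\<integral>\<^sup>+y. ?g y \<partial>lborel)"
      by (intro nn_integral_mono) (auto simp: indicator_def)
    also have "\<dots> = (\<Sum>\<gamma>\<in>F. \<integral>\<^sup>+y. ennreal ((bessel_norm b s (\<lambda>x. h (x + y) * \<psi> \<gamma> x))\<^sup>2) \<partial>lborel)"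
      by (rule nn_integral_sum) (use C(2) F in simp)
    also have "\<dots> \<le> (\<Sum>\<gamma>\<in>F. ennreal (C * (bessel_norm b s (\<psi> \<gamma>))\<^sup>2))" by (intro sum_mono C F)
    also have "\<dots> = ennreal M" using C by (simp add: M_def sum_ennreal sum_distrib_left)
    finally obtain y where y: "y \<in> ball 0 r" "?g y \<le> ennreal (2 * M / v)"
      using exists_le_average[of ?g "ball 0 r" v M] C(2) F v M0 by auto
    have "(\<Sum>\<gamma>\<in>F. (bessel_norm b s (\<lambda>x. h (x + y) * \<psi> \<gamma> x))\<^sup>2) \<le> 2 * M / v"
      using y(2) M0 v by (simp add: sum_ennreal)
    then show ?thesis using y(1) unfolding M_def mult.assoc[symmetric] times_divide_eq_left by blast
  qed
  then show thesis using that[of "2 * C / v"] C(1) v(2) by simp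
qed


section \<open>The integer lattice\<close>

lemma int_lattice_diff: "x \<in> int_lattice \<Longrightarrow> y \<in> int_lattice \<Longrightarrow> x - y \<in> int_lattice"
  by (simp add: int_lattice_def)

lemma int_lattice_norm_ge_1:
  assumes "x \<in> int_lattice" "x \<noteq> 0" shows "norm x \<ge> 1"
proof -
  obtain i where i: "x $ i \<noteq> 0" using assms(2) by (auto simp: vec_eq_iff)
  then have "1 \<le> \<bar>x $ i\<bar>" using assms(1) by (auto simp: int_lattice_def intro: Ints_nonzero_abs_ge1)
  then show ?thesis using component_le_norm_cart[of x i] by linarith
qed

lemma closed_int_lattice: "closed (int_lattice :: (real^'n::finite) set)"
proof -
  have eq: "int_lattice = (\<Inter>i. (\<lambda>x::real^'n. x $ i) -` \<int>)" by (auto simp: int_lattice_def)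
  have cl: "closed ((\<lambda>x::real^'n. x $ i) -` \<int>)" for i
    by (intro continuous_closed_vimage closed_Ints) (auto intro!: continuous_intros)
  show ?thesis unfolding eq by (intro closed_INT ballI cl)
qed

lemma finite_int_lattice_bounded:
  assumes "bounded (S :: (real^'n::finite) set)" shows "finite (int_lattice \<inter> S)"
proof -
  obtain R where R: "\<And>x. x \<in> S \<Longrightarrow> norm x \<le> R" using assms by (auto simp: bounded_iff)
  define N where "N = \<lceil>R\<rceil>"
  let ?P = "PiE (UNIV :: 'n set) (\<lambda>_. {- N..N})"
  have "int_lattice \<inter> S \<subseteq> (\<lambda>f. \<chi> i. real_of_int (f i)) ` ?P"
  proof
    fix x assume x: "x \<in> int_lattice \<inter> S"
    define f where "f i = \<lfloor>x $ i\<rfloor>" for i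
    have fx: "real_of_int (f i) = x $ i" for i using x by (auto simp: f_def int_lattice_def elim: Ints_cases)
    have "f i \<in> {- N..N}" for i
    proof -
      have "\<bar>x $ i\<bar> \<le> R" using component_le_norm_cart[of x i] R[of x] x by auto
      then have "\<bar>real_of_int (f i)\<bar> \<le> real_of_int N" unfolding fx N_def by linarith
      then show ?thesis by (simp add: abs_le_iff)
    qed
    then show "x \<in> (\<lambda>f. \<chi> i. real_of_int (f i)) ` ?P"
      by (intro image_eqI[of _ _ f]) (auto simp: vec_eq_iff fx)
  qed
  moreover have "finite ?P" by (intro finite_PiE) auto
  ultimately show ?thesis by (meson finite_imageI finite_subset)
qed

text \<open>Here the sum over the lattice is turned into the integral of the localisation inequality: the
translates \<open>B - \<gamma>\<close> of a ball \<open>B\<close> of radius at most \<open>1/2\<close> are pairwise disjoint, so averaging the sum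
over \<open>y \<in> B\<close> gives at most the integral over the whole space.\<close>

lemma localise_translates:
  fixes b :: "'n::finite \<Rightarrow> 'j::finite"
  assumes h: "h \<in> schwartz" and r: "r > 0" "r \<le> 1 / 2"
  obtains C where "C \<ge> 0"
    "\<And>F \<phi>. finite F \<Longrightarrow> F \<subseteq> int_lattice \<Longrightarrow> \<phi> \<in> schwartz \<Longrightarrow>
      \<exists>y\<in>ball 0 r. (\<Sum>\<gamma>\<in>F. (bessel_norm b s (\<lambda>x. h (x + y) * \<phi> (x + \<gamma>)))\<^sup>2) \<le> C * (bessel_norm b s \<phi>)\<^sup>2"
proof -
  obtain C where C: "C \<ge> 0"
    "\<And>\<phi>. \<phi> \<in> schwartz \<Longrightarrow> (\<lambda>y. ennreal ((bessel_norm b s (\<lambda>x. h (x + y) * \<phi> x))\<^sup>2)) \<in> borel_measurable borel"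
    "\<And>\<phi>. \<phi> \<in> schwartz \<Longrightarrow>
      (\<integral>\<^sup>+y. ennreal ((bessel_norm b s (\<lambda>x. h (x + y) * \<phi> x))\<^sup>2) \<partial>lborel) \<le> ennreal (C * (bessel_norm b s \<phi>)\<^sup>2)"
    using localisation_inequality[OF h, where b=b and s=s] by blast
  define v where "v = measure lborel (ball (0::real^'n) r)"
  have v: "emeasure lborel (ball (0::real^'n) r) = ennreal v" "v > 0"
    using content_ball_pos[OF r(1), of "0::real^'n"] emeasure_bounded_finite[OF bounded_ball, of "0::real^'n" r]
    by (auto simp: v_def emeasure_eq_ennreal_measure)
  have "\<exists>y\<in>ball 0 r. (\<Sum>\<gamma>\<in>F. (bessel_norm b s (\<lambda>x. h (x + y) * \<phi> (x + \<gamma>)))\<^sup>2) \<le> (2 * C / v) * (bessel_norm b s \<phi>)\<^sup>2"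
    if F: "finite F" "F \<subseteq> int_lattice" and \<phi>: "\<phi> \<in> schwartz" for F \<phi>
  proof -
    define G where "G y = ennreal ((bessel_norm b s (\<lambda>x. h (x + y) * \<phi> x))\<^sup>2)" for y
    have Gm[measurable]: "G \<in> borel_measurable borel" unfolding G_def by (rule C(2)[OF \<phi>])
    have Hg: "ennreal ((bessel_norm b s (\<lambda>x. h (x + y) * \<phi> (x + \<gamma>)))\<^sup>2) = G (y - \<gamma>)" for y \<gamma>
    proof -
      have "(\<lambda>x. h (x + (y - \<gamma>)) * \<phi> x) \<in> schwartz" by (intro schwartz_mult schwartz_translate h \<phi>)
      from bessel_norm_translate[OF this, of b s \<gamma>] show ?thesis by (simp add: G_def algebra_simps)
    qed
    have [measurable]: "ball 0 r \<in> sets (borel :: (real^'n) measure)" by simp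
    let ?g = "\<lambda>y. \<Sum>\<gamma>\<in>F. G (y - \<gamma>)"
    define M where "M = C * (bessel_norm b s \<phi>)\<^sup>2"
    have M0: "M \<ge> 0" using C by (simp add: M_def)
    \<comment> \<open>Distinct lattice points are at distance at least \<open>1\<close>.\<close>
    have ind: "(\<Sum>\<gamma>\<in>F. indicator (ball 0 r) (y + \<gamma>) :: ennreal) \<le> 1" for y
    proof (cases "\<exists>\<gamma>\<in>F. y + \<gamma> \<in> ball 0 r")
      case True
      then obtain \<gamma> where \<gamma>: "\<gamma> \<in> F" "y + \<gamma> \<in> ball 0 r" by blast
      have "indicator (ball 0 r) (y + \<gamma>') = (0::ennreal)" if "\<gamma>' \<in> F - {\<gamma>}" for \<gamma>'
      proof (rule ccontr)
        assume "\<not> ?thesis"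
        then have "norm (y + \<gamma>') < r" by (auto simp: indicator_def split: if_splits)
        moreover have "norm (y + \<gamma>) < r" using \<gamma> by simp
        ultimately have "norm ((y + \<gamma>') - (y + \<gamma>)) < 1"
          using r(2) norm_triangle_ineq4[of "y + \<gamma>'" "y + \<gamma>"] by linarith
        moreover have "norm (\<gamma>' - \<gamma>) \<ge> 1" using that \<gamma> F by (intro int_lattice_norm_ge_1 int_lattice_diff) auto
        ultimately show False by simp
      qed
      then have "(\<Sum>\<gamma>'\<in>F - {\<gamma>}. indicator (ball 0 r) (y + \<gamma>') :: ennreal) = 0" by (intro sum.neutral) blast
      then show ?thesis using \<gamma> F by (subst sum.remove[of _ \<gamma>]) auto
    next
      case False then show ?thesis by (simp add: indicator_def)
    qed
    have "(\<integral>\<^sup>+y\<in>ball 0 r. ?g y \<partial>lborel) = (\<integral>\<^sup>+y. (\<Sum>\<gamma>\<in>F. G (y - \<gamma>) * indicator (ball 0 r) y) \<partial>lborel)"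
      by (simp add: sum_distrib_right)
    also have "\<dots> = (\<Sum>\<gamma>\<in>F. \<integral>\<^sup>+y. G (y - \<gamma>) * indicator (ball 0 r) y \<partial>lborel)"
      by (rule nn_integral_sum) measurable
    also have "\<dots> = (\<Sum>\<gamma>\<in>F. \<integral>\<^sup>+y. G y * indicator (ball 0 r) (y + \<gamma>) \<partial>lborel)"
    proof (rule sum.cong[OF refl])
      fix \<gamma>
      show "(\<integral>\<^sup>+y. G (y - \<gamma>) * indicator (ball 0 r) y \<partial>lborel) = (\<integral>\<^sup>+y. G y * indicator (ball 0 r) (y + \<gamma>) \<partial>lborel)"
        using lborel_translate_nn_integral[of "\<lambda>y. G (y - \<gamma>) * indicator (ball 0 r) y" \<gamma>] by simp
    qed
    also have "\<dots> = (\<integral>\<^sup>+y. (\<Sum>\<gamma>\<in>F. G y * indicator (ball 0 r) (y + \<gamma>)) \<partial>lborel)"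
      by (rule nn_integral_sum[symmetric]) measurable
    also have "\<dots> \<le> (\<integral>\<^sup>+y. G y \<partial>lborel)"
    proof (rule nn_integral_mono)
      fix y show "(\<Sum>\<gamma>\<in>F. G y * indicator (ball 0 r) (y + \<gamma>)) \<le> G y"
        unfolding sum_distrib_left[symmetric] using mult_left_mono[OF ind[of y], of "G y"] by simp
    qed
    also have "\<dots> \<le> ennreal M" unfolding G_def M_def by (rule C(3)[OF \<phi>])
    finally obtain y where y: "y \<in> ball 0 r" "?g y \<le> ennreal (2 * M / v)"
      using exists_le_average[of ?g "ball 0 r" v M] v M0 by auto
    have "(\<Sum>\<gamma>\<in>F. (bessel_norm b s (\<lambda>x. h (x + y) * \<phi> (x + \<gamma>)))\<^sup>2) \<le> 2 * M / v"
      using y(2) M0 v unfolding Hg[symmetric] by (simp add: sum_ennreal)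
    then show ?thesis using y(1) unfolding M_def mult.assoc[symmetric] times_divide_eq_left by blast
  qed
  then show thesis using that[of "2 * C / v"] C(1) v(2) by simp
qed

section \<open>Superposition of translates\<close>

text \<open>On the Fourier side the two symbols cancel. Hence \<open>\<H>\<^sup>s\<close> and \<open>\<H>\<^sup>-\<^sup>s\<close> are dual under the \<open>L\<^sup>2\<close> pairing.\<close>

lemma l2_inner_bessel:
  assumes "f \<in> schwartz" "g \<in> schwartz"
  shows "l2_inner f g = l2_inner (bessel b s f) (bessel b (- s) g)"
proof -
  have "of_real (bracket b s \<xi>) * z * cnj (of_real (bracket b (- s) \<xi>) * w) = z * cnj w" for \<xi> z w
  proof -
    have "of_real (bracket b s \<xi>) * z * cnj (of_real (bracket b (- s) \<xi>) * w) =
        of_real (bracket b s \<xi> * bracket b (- s) \<xi>) * (z * cnj w)" by (simp del: bracket_mult_minus)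
    then show ?thesis by simp
  qed
  then show ?thesis
    unfolding l2_inner_def plancherel_inverse_fourier[OF assms]
      plancherel_inverse_fourier[OF schwartz_bessel[OF assms(1)] schwartz_bessel[OF assms(2)]]
      inverse_fourier_bessel[OF assms(1)] inverse_fourier_bessel[OF assms(2)]
    by presburger
qed

lemma l2_inner_bessel_norm_bound:
  assumes "f \<in> schwartz" "g \<in> schwartz"
  shows "norm (l2_inner f g) \<le> bessel_norm b s f * bessel_norm b (- s) g"
  unfolding l2_inner_bessel[OF assms, of b s] bessel_norm_def
  by (intro l2_inner_bound schwartz_square_integrable schwartz_bessel assms)

lemma sum_mult_le_sqrt:
  fixes a c :: "'i \<Rightarrow> real"
  assumes "(\<Sum>i\<in>F. (a i)\<^sup>2) \<le> A\<^sup>2" "(\<Sum>i\<in>F. (c i)\<^sup>2) \<le> B\<^sup>2" "A \<ge> 0" "B \<ge> 0"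
  shows "(\<Sum>i\<in>F. a i * c i) \<le> A * B"
proof (rule power2_le_imp_le)
  have "(\<Sum>i\<in>F. a i * c i)\<^sup>2 \<le> (\<Sum>i\<in>F. (a i)\<^sup>2) * (\<Sum>i\<in>F. (c i)\<^sup>2)" by (rule Cauchy_Schwarz_ineq_sum)
  also have "\<dots> \<le> A\<^sup>2 * B\<^sup>2" using assms by (intro mult_mono) (auto intro: sum_nonneg)
  finally show "(\<Sum>i\<in>F. a i * c i)\<^sup>2 \<le> (A * B)\<^sup>2" by (simp add: power_mult_distrib)
qed (use assms in simp)

text \<open>The dual of the inequality for lattice translates. Pair the superposition \<open>\<Phi>\<close> with \<open>\<theta> = \<langle>\<langle>D\<rangle>\<rangle>\<^sup>2\<^sup>s \<Phi>\<close>, whose norm in \<open>\<H>\<^sup>-\<^sup>s\<close> is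
the norm of \<open>\<Phi>\<close> in \<open>\<H>\<^sup>s\<close>. In each term \<open>\<theta>\<close> may be multiplied by a translated cut-off function that
equals \<open>1\<close> on the support of \<open>f \<gamma>\<close>.\<close>

lemma superpose_translates:
  fixes b :: "'n::finite \<Rightarrow> 'j::finite" and \<eta> :: "real^'n \<Rightarrow> real"
  assumes h: "(\<lambda>x. complex_of_real (\<eta> x)) \<in> schwartz" and r: "r > 0" "r \<le> 1 / 2"
  obtains C where "C \<ge> 0"
    "\<And>F f. finite F \<Longrightarrow> F \<subseteq> int_lattice \<Longrightarrow> (\<And>\<gamma>. \<gamma> \<in> F \<Longrightarrow> f \<gamma> \<in> schwartz) \<Longrightarrow>
      (\<And>\<gamma> x y. \<gamma> \<in> F \<Longrightarrow> y \<in> ball 0 r \<Longrightarrow> of_real (\<eta> (x + y)) * f \<gamma> x = f \<gamma> x) \<Longrightarrow>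
      (bessel_norm b s (\<lambda>x. \<Sum>\<gamma>\<in>F. f \<gamma> (x - \<gamma>)))\<^sup>2 \<le> C * (\<Sum>\<gamma>\<in>F. (bessel_norm b s (f \<gamma>))\<^sup>2)"
proof -
  obtain C where C: "C \<ge> 0"
    "\<And>F \<phi>. finite F \<Longrightarrow> F \<subseteq> int_lattice \<Longrightarrow> \<phi> \<in> schwartz \<Longrightarrow>
      \<exists>y\<in>ball 0 r. (\<Sum>\<gamma>\<in>F. (bessel_norm b (- s) (\<lambda>x. of_real (\<eta> (x + y)) * \<phi> (x + \<gamma>)))\<^sup>2) \<le> C * (bessel_norm b (- s) \<phi>)\<^sup>2"
    by (rule localise_translates[OF h r, where b=b and s="- s"]) blast
  have "(bessel_norm b s (\<lambda>x. \<Sum>\<gamma>\<in>F. f \<gamma> (x - \<gamma>)))\<^sup>2 \<le> C * (\<Sum>\<gamma>\<in>F. (bessel_norm b s (f \<gamma>))\<^sup>2)"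
    if F: "finite F" "F \<subseteq> int_lattice" and fS: "\<And>\<gamma>. \<gamma> \<in> F \<Longrightarrow> f \<gamma> \<in> schwartz"
      and fe: "\<And>\<gamma> x y. \<gamma> \<in> F \<Longrightarrow> y \<in> ball 0 r \<Longrightarrow> of_real (\<eta> (x + y)) * f \<gamma> x = f \<gamma> x"
    for F f
  proof -
    define \<Phi> where "\<Phi> x = (\<Sum>\<gamma>\<in>F. f \<gamma> (x - \<gamma>))" for x
    have fS': "(\<lambda>x. f \<gamma> (x - \<gamma>)) \<in> schwartz" if "\<gamma> \<in> F" for \<gamma>
      using schwartz_translate[OF fS[OF that], of "- \<gamma>"] by simp
    have \<Phi>S: "\<Phi> \<in> schwartz" unfolding \<Phi>_def by (intro schwartz_sum fS')
    \<comment> \<open>With this choice the pairing with \<open>\<Phi>\<close> is the square of the norm of \<open>\<Phi>\<close>.\<close>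
    define \<theta> where "\<theta> = bessel b s (bessel b s \<Phi>)"
    have \<theta>S: "\<theta> \<in> schwartz" unfolding \<theta>_def by (intro schwartz_bessel \<Phi>S)
    have b\<theta>: "bessel b (- s) \<theta> = bessel b s \<Phi>" unfolding \<theta>_def by (simp add: bessel_bessel_minus schwartz_bessel \<Phi>S)
    define H where "H = bessel_norm b s \<Phi>"
    have l2_inner\<theta>: "l2_inner \<Phi> \<theta> = of_real (H\<^sup>2)"
      unfolding l2_inner_bessel[OF \<Phi>S \<theta>S, of b s] b\<theta> l2_inner_self H_def bessel_norm_def ..
    have H\<theta>: "bessel_norm b (- s) \<theta> = H" unfolding bessel_norm_def b\<theta> H_def ..
    obtain y where y: "y \<in> ball 0 r"
      "(\<Sum>\<gamma>\<in>F. (bessel_norm b (- s) (\<lambda>x. of_real (\<eta> (x + y)) * \<theta> (x + \<gamma>)))\<^sup>2) \<le> C * H\<^sup>2"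
      using C(2)[OF F \<theta>S] unfolding H\<theta> by blast
    have loc: "l2_inner (\<lambda>x. f \<gamma> (x - \<gamma>)) \<theta> = l2_inner (f \<gamma>) (\<lambda>x. of_real (\<eta> (x + y)) * \<theta> (x + \<gamma>))" if \<gamma>: "\<gamma> \<in> F" for \<gamma>
    proof -
      have "l2_inner (\<lambda>x. f \<gamma> (x - \<gamma>)) \<theta> = (LINT x|lborel. f \<gamma> (x + \<gamma> - \<gamma>) * cnj (\<theta> (x + \<gamma>)))"
        unfolding l2_inner_def
        by (rule lborel_translate_integral[symmetric])
          (intro schwartz_measurable schwartz_mult fS' \<gamma> schwartz_cnj \<theta>S)
      also have "\<dots> = (LINT x|lborel. (of_real (\<eta> (x + y)) * f \<gamma> x) * cnj (\<theta> (x + \<gamma>)))"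
        by (simp add: fe[OF \<gamma> y(1)])
      finally show ?thesis unfolding l2_inner_def by (simp add: mult_ac)
    qed
    have lS: "(\<lambda>x. of_real (\<eta> (x + y)) * \<theta> (x + \<gamma>)) \<in> schwartz" for \<gamma>
      by (intro schwartz_mult schwartz_translate[OF h] schwartz_translate \<theta>S)
    have "l2_inner \<Phi> \<theta> = (\<Sum>\<gamma>\<in>F. l2_inner (\<lambda>x. f \<gamma> (x - \<gamma>)) \<theta>)"
      unfolding l2_inner_def \<Phi>_def sum_distrib_right
      by (rule Bochner_Integration.integral_sum)
        (intro schwartz_integrable schwartz_mult fS' schwartz_cnj \<theta>S)
    also have "\<dots> = (\<Sum>\<gamma>\<in>F. l2_inner (f \<gamma>) (\<lambda>x. of_real (\<eta> (x + y)) * \<theta> (x + \<gamma>)))"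
      by (intro sum.cong refl loc)
    finally have "norm (l2_inner \<Phi> \<theta>) \<le> (\<Sum>\<gamma>\<in>F. norm (l2_inner (f \<gamma>) (\<lambda>x. of_real (\<eta> (x + y)) * \<theta> (x + \<gamma>))))"
      by (simp only: norm_sum)
    also have "\<dots> \<le> (\<Sum>\<gamma>\<in>F. bessel_norm b s (f \<gamma>) * bessel_norm b (- s) (\<lambda>x. of_real (\<eta> (x + y)) * \<theta> (x + \<gamma>)))"
      by (intro sum_mono l2_inner_bessel_norm_bound fS lS)
    also have "\<dots> \<le> sqrt (\<Sum>\<gamma>\<in>F. (bessel_norm b s (f \<gamma>))\<^sup>2) * (sqrt C * H)"
      by (rule sum_mult_le_sqrt) (use y(2) C(1) in \<open>auto simp: sum_nonneg power_mult_distrib H_def\<close>)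
    finally have "H\<^sup>2 \<le> sqrt (\<Sum>\<gamma>\<in>F. (bessel_norm b s (f \<gamma>))\<^sup>2) * (sqrt C * H)"
      unfolding l2_inner\<theta> norm_of_real by simp
    moreover have "H \<ge> 0" by (simp add: H_def)
    ultimately have "H \<le> sqrt (\<Sum>\<gamma>\<in>F. (bessel_norm b s (f \<gamma>))\<^sup>2) * sqrt C"
      by (cases "H = 0") (auto simp: power2_eq_square mult.assoc[symmetric] C(1) sum_nonneg)
    then have "H\<^sup>2 \<le> (sqrt (\<Sum>\<gamma>\<in>F. (bessel_norm b s (f \<gamma>))\<^sup>2) * sqrt C)\<^sup>2"
      using \<open>H \<ge> 0\<close> by (intro power_mono)
    then have "H\<^sup>2 \<le> C * (\<Sum>\<gamma>\<in>F. (bessel_norm b s (f \<gamma>))\<^sup>2)"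
      using C(1) by (simp add: power_mult_distrib sum_nonneg mult.commute)
    then show ?thesis by (simp add: H_def \<Phi>_def[abs_def])
  qed
  then show thesis using that C(1) by blast
qed


section \<open>Supports of distributions\<close>

lemma distribution_zero: "u \<in> distributions \<Longrightarrow> u (\<lambda>x. 0) = 0"
  using distributions_linear(2)[of u "\<lambda>x. 0" 0] test_zero by simp

text \<open>Split \<open>\<phi>\<close> with a cut-off function supported in \<open>U\<close> and equal to \<open>1\<close> near the part of the support
outside \<open>V\<close>.\<close>

lemma vanishing_union:
  fixes u :: "'n::finite functional"
  assumes u: "u \<in> distributions" and "open U" "open V"
    and U: "\<And>\<phi>. \<phi> \<in> test_functions \<Longrightarrow> fun_support \<phi> \<subseteq> U \<Longrightarrow> u \<phi> = 0"
    and V: "\<And>\<phi>. \<phi> \<in> test_functions \<Longrightarrow> fun_support \<phi> \<subseteq> V \<Longrightarrow> u \<phi> = 0"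
    and \<phi>: "\<phi> \<in> test_functions" "fun_support \<phi> \<subseteq> U \<union> V"
  shows "u \<phi> = 0"
proof -
  have "compact (fun_support \<phi> - V)" using test_compact[OF \<phi>(1)] \<open>open V\<close> by (rule compact_diff)
  moreover have "fun_support \<phi> - V \<subseteq> U" using \<phi>(2) by auto
  ultimately obtain \<eta> :: "real^'n \<Rightarrow> real" and W where e: "(\<lambda>x. complex_of_real (\<eta> x)) \<in> test_functions"
    "fun_support (\<lambda>x. complex_of_real (\<eta> x)) \<subseteq> U" "open W" "fun_support \<phi> - V \<subseteq> W" "\<And>x. x \<in> W \<Longrightarrow> \<eta> x = 1"
    using cutoff_exists[OF _ \<open>open U\<close>] by metis
  let ?h = "\<lambda>x. complex_of_real (\<eta> x)"
  have sm: "smooth (\<lambda>x. 1 + - 1 * ?h x)" by (intro smooth_add smooth_mult smooth_const test_smooth e)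
  have 1: "(\<lambda>x. ?h x * \<phi> x) \<in> test_functions" by (intro test_mult_right e test_smooth \<phi>)
  have 2: "(\<lambda>x. \<phi> x * (1 + - 1 * ?h x)) \<in> test_functions" by (intro test_mult_right \<phi> sm)
  have "u \<phi> = u (\<lambda>x. ?h x * \<phi> x + \<phi> x * (1 + - 1 * ?h x))" by (simp add: ring_distribs mult.commute)
  also have "\<dots> = u (\<lambda>x. ?h x * \<phi> x) + u (\<lambda>x. \<phi> x * (1 + - 1 * ?h x))"
    by (rule distributions_linear(1)[OF u 1 2])
  also have "u (\<lambda>x. ?h x * \<phi> x) = 0"
    by (rule U[OF 1]) (rule order_trans[OF fun_support_mult_left e(2)])
  also have "u (\<lambda>x. \<phi> x * (1 + - 1 * ?h x)) = 0"
  proof (rule V[OF 2])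
    have "fun_support (\<lambda>x. \<phi> x * (1 + - 1 * ?h x)) \<subseteq> fun_support \<phi> \<inter> - W"
      by (rule fun_supportI) (use e fun_support_zero in \<open>auto intro!: closed_Int fun_support_closed\<close>)
    then show "fun_support (\<lambda>x. \<phi> x * (1 + - 1 * ?h x)) \<subseteq> V" using e(4) by blast
  qed
  finally show ?thesis by simp
qed

text \<open>The complement of the support is a union of open sets on which \<open>u\<close> vanishes; by compactness,
finitely many of them cover the support of \<open>\<phi>\<close>.\<close>

lemma vanishing_off_support:
  fixes u :: "'n::finite functional"
  assumes u: "u \<in> distributions_in K" and \<phi>: "\<phi> \<in> test_functions" "fun_support \<phi> \<inter> K = {}"
  shows "u \<phi> = 0"
proof -
  let ?\<U> = "{U. open U \<and> (\<forall>\<phi>\<in>test_functions. fun_support \<phi> \<subseteq> U \<longrightarrow> u \<phi> = 0)}"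
  have ud: "u \<in> distributions" using u by (simp add: distributions_in_def)
  have cover: "fun_support \<phi> \<subseteq> \<Union>?\<U>"
    using u \<phi>(2) by (auto simp: distributions_in_def dist_support_def)
  have op: "\<And>U. U \<in> ?\<U> \<Longrightarrow> open U" by simp
  obtain \<G> where G: "\<G> \<subseteq> ?\<U>" "finite \<G>" "fun_support \<phi> \<subseteq> \<Union>\<G>"
    by (rule compactE[OF test_compact[OF \<phi>(1)] cover op])
  have "\<Union>\<G> \<in> ?\<U>" using G(2,1)
  proof induction
    case empty
    have "u \<psi> = 0" if "fun_support \<psi> \<subseteq> {}" for \<psi>
    proof -
      have "\<psi> = (\<lambda>x. 0)" using that fun_support_zero[of _ \<psi>] by auto
      then show ?thesis by (simp add: distribution_zero[OF ud])
    qed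
    then show ?case by auto
  next
    case (insert U \<G>)
    have U: "open U" "\<And>\<phi>. \<phi> \<in> test_functions \<Longrightarrow> fun_support \<phi> \<subseteq> U \<Longrightarrow> u \<phi> = 0"
      using insert.prems by auto
    have V: "open (\<Union>\<G>)" "\<And>\<phi>. \<phi> \<in> test_functions \<Longrightarrow> fun_support \<phi> \<subseteq> \<Union>\<G> \<Longrightarrow> u \<phi> = 0"
      using insert.IH insert.prems by auto
    have "\<forall>\<phi>\<in>test_functions. fun_support \<phi> \<subseteq> U \<union> \<Union>\<G> \<longrightarrow> u \<phi> = 0"
      using vanishing_union[OF ud U(1) V(1) U(2) V(2)] by blast
    then show ?case using U(1) V(1) by (simp add: open_Un)
  qed
  then show ?thesis using G(3) \<phi>(1) by auto
qed

text \<open>The difference \<open>(1 - h) \<phi>\<close> is supported outside \<open>V\<close>, hence away from the support of \<open>u\<close>.\<close>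

lemma cut_off_near_support:
  fixes u :: "'n::finite functional"
  assumes u: "u \<in> distributions_in K" and h: "h \<in> test_functions"
    and V: "open V" "K \<subseteq> V" "\<And>x. x \<in> V \<Longrightarrow> h x = 1" and \<phi>: "\<phi> \<in> test_functions"
  shows "u (\<lambda>x. h x * \<phi> x) = u \<phi>"
proof -
  have ud: "u \<in> distributions" using u by (simp add: distributions_in_def)
  have sm: "smooth (\<lambda>x. 1 + - 1 * h x)" by (intro smooth_add smooth_mult smooth_const test_smooth h)
  have 1: "(\<lambda>x. h x * \<phi> x) \<in> test_functions" by (intro test_mult_right h test_smooth \<phi>)
  have 2: "(\<lambda>x. \<phi> x * (1 + - 1 * h x)) \<in> test_functions" by (intro test_mult_right \<phi> sm)
  have "fun_support (\<lambda>x. \<phi> x * (1 + - 1 * h x)) \<subseteq> - V"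
    by (rule fun_supportI) (use V in auto)
  then have z: "u (\<lambda>x. \<phi> x * (1 + - 1 * h x)) = 0"
    using V(2) by (intro vanishing_off_support[OF u 2]) auto
  have "u \<phi> = u (\<lambda>x. h x * \<phi> x + \<phi> x * (1 + - 1 * h x))" by (simp add: ring_distribs mult.commute)
  also have "\<dots> = u (\<lambda>x. h x * \<phi> x) + u (\<lambda>x. \<phi> x * (1 + - 1 * h x))"
    by (rule distributions_linear(1)[OF ud 1 2])
  finally show ?thesis using z by simp
qed

lemma fun_support_translate: "fun_support (\<lambda>x. \<phi> (x + a)) \<subseteq> {x. x + a \<in> fun_support \<phi>}"
proof (rule fun_supportI)
  have "closed ((\<lambda>x. x + a) -` fun_support \<phi>)"
    by (intro continuous_closed_vimage fun_support_closed) (auto intro!: continuous_intros)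
  then show "closed {x. x + a \<in> fun_support \<phi>}" by (simp add: vimage_def)
qed (auto simp: fun_support_zero)

lemma distribution_sum:
  assumes u: "u \<in> distributions" and f: "\<And>i. i \<in> I \<Longrightarrow> f i \<in> test_functions"
  shows "u (\<lambda>x. \<Sum>i\<in>I. f i x) = (\<Sum>i\<in>I. u (f i))"
  using f by (induction I rule: infinite_finite_induct)
    (simp_all add: distribution_zero[OF u] distributions_linear(1)[OF u] test_sum)

section \<open>The lattice series\<close>

lemma lattice_series_finite:
  fixes v :: "real^'n::finite \<Rightarrow> 'n functional"
  assumes v: "\<And>\<gamma>. \<gamma> \<in> int_lattice \<Longrightarrow> v \<gamma> \<in> distributions_in K"
    and \<phi>: "\<phi> \<in> test_functions" and F: "finite F" "F \<subseteq> int_lattice"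
    and off: "\<And>\<gamma> x. \<gamma> \<in> int_lattice - F \<Longrightarrow> x \<in> K \<Longrightarrow> x + \<gamma> \<notin> fun_support \<phi>"
  shows "lattice_series v \<phi> = (\<Sum>\<gamma>\<in>F. v \<gamma> (\<lambda>x. \<phi> (x + \<gamma>)))"
proof -
  have "v \<gamma> (\<lambda>x. \<phi> (x + \<gamma>)) = 0" if "\<gamma> \<in> int_lattice - F" for \<gamma>
  proof (rule vanishing_off_support[of "v \<gamma>" K "\<lambda>x. \<phi> (x + \<gamma>)"])
    show "fun_support (\<lambda>x. \<phi> (x + \<gamma>)) \<inter> K = {}"
      using fun_support_translate[of \<phi> \<gamma>] off[OF that] by blast
  qed (use v that \<phi> in \<open>auto intro: test_translate\<close>)
  then have "infsum (\<lambda>\<gamma>. translate \<gamma> (v \<gamma>) \<phi>) int_lattice = infsum (\<lambda>\<gamma>. v \<gamma> (\<lambda>x. \<phi> (x + \<gamma>))) F"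
    by (intro infsum_cong_neutral) (use F in \<open>auto simp: translate_def\<close>)
  then show ?thesis using F by (simp add: lattice_series_def)
qed

lemma finite_lattice_meeting:
  assumes "bounded (K :: (real^'n::finite) set)" "bounded Q"
  shows "finite {\<gamma> \<in> int_lattice. \<exists>x\<in>K. x + \<gamma> \<in> Q}"
proof -
  obtain R S where R: "\<And>x. x \<in> K \<Longrightarrow> norm x \<le> R" "\<And>x. x \<in> Q \<Longrightarrow> norm x \<le> S"
    using assms by (auto simp: bounded_iff)
  have "{\<gamma> \<in> int_lattice. \<exists>x\<in>K. x + \<gamma> \<in> Q} \<subseteq> int_lattice \<inter> cball 0 (R + S)"
  proof clarsimp
    fix \<gamma> x assume "x \<in> K" "x + \<gamma> \<in> Q"
    then show "norm \<gamma> \<le> R + S"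
      using R(1)[of x] R(2)[of "x + \<gamma>"] norm_triangle_ineq4[of "x + \<gamma>" x] by simp
  qed
  then show ?thesis using finite_int_lattice_bounded[OF bounded_cball] finite_subset by blast
qed

lemma partials_translate:
  assumes "smooth f" shows "partials is (\<lambda>x. f (x + a)) = (\<lambda>x. partials is f (x + a))"
proof (induction "is")
  case (Cons i "is")
  have "pd i (\<lambda>x. partials is f (x + a)) = (\<lambda>x. pd i (partials is f) (x + a))"
    using pd_affine[of "partials is f" i 1 a] smooth_partials[OF assms] by (simp add: smooth_differentiable)
  then show ?case unfolding partials_Cons Cons .
qed simp

lemma seminorm_translate:
  fixes f :: "real^'n::finite \<Rightarrow> complex"
  assumes "smooth f" shows "seminorm 0 N (\<lambda>x. f (x + a)) = seminorm 0 N f"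
proof -
  have "(SUP x. norm (g (x + a))) = (SUP x. norm (g x))" for g :: "real^'n \<Rightarrow> complex"
  proof -
    have "range (\<lambda>x. norm (g (x + a))) = range (\<lambda>x. norm (g x))"
    proof (intro equalityI subsetI; clarify)
      fix x show "norm (g x) \<in> range (\<lambda>x. norm (g (x + a)))" by (rule range_eqI[of _ _ "x - a"]) simp
    qed blast
    then show ?thesis by simp
  qed
  then show ?thesis unfolding seminorm_def partials_translate[OF assms] by simp
qed

text \<open>For test functions supported in a given compact set, the same finitely many terms contribute. The
orders of these finitely many distributions are bounded by their sum.\<close>

lemma lattice_series_distribution:
  fixes v :: "real^'n::finite \<Rightarrow> 'n functional"
  assumes K: "compact K" and v: "\<And>\<gamma>. \<gamma> \<in> int_lattice \<Longrightarrow> v \<gamma> \<in> distributions_in K"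
  shows "lattice_series v \<in> distributions"
proof -
  define F where "F Q = {\<gamma> \<in> int_lattice. \<exists>x\<in>K. x + \<gamma> \<in> Q}" for Q
  have Ffin: "finite (F Q)" "F Q \<subseteq> int_lattice" if "compact Q" for Q
    using finite_lattice_meeting[OF compact_imp_bounded[OF K] compact_imp_bounded[OF that]] by (auto simp: F_def)
  have eq: "lattice_series v \<phi> = (\<Sum>\<gamma>\<in>F Q. v \<gamma> (\<lambda>x. \<phi> (x + \<gamma>)))"
    if "\<phi> \<in> test_functions" "compact Q" "fun_support \<phi> \<subseteq> Q" for \<phi> Q
    by (rule lattice_series_finite[OF v that(1) Ffin[OF that(2)]]) (use that(3) in \<open>auto simp: F_def\<close>)
  have vd: "v \<gamma> \<in> distributions" if "\<gamma> \<in> int_lattice" for \<gamma>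
    using v[OF that] by (simp add: distributions_in_def)
  have add: "lattice_series v (\<lambda>x. \<phi> x + \<psi> x) = lattice_series v \<phi> + lattice_series v \<psi>"
    if "\<phi> \<in> test_functions" "\<psi> \<in> test_functions" for \<phi> \<psi>
  proof -
    define Q where "Q = fun_support \<phi> \<union> fun_support \<psi>"
    have Q: "compact Q" "fun_support \<phi> \<subseteq> Q" "fun_support \<psi> \<subseteq> Q"
      using that by (auto simp: Q_def test_compact)
    have "fun_support (\<lambda>x. \<phi> x + \<psi> x) \<subseteq> Q"
      by (rule fun_supportI) (auto simp: Q_def fun_support_zero fun_support_closed)
    then show ?thesis using Ffin(2)[OF Q(1)]
      by (simp add: eq[OF _ Q(1)] Q that test_add sum.distrib[symmetric])
        (intro sum.cong refl distributions_linear(1)[OF vd]; auto intro: test_translate that)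
  qed
  have mul: "lattice_series v (\<lambda>x. c * \<phi> x) = c * lattice_series v \<phi>" if "\<phi> \<in> test_functions" for \<phi> c
  proof -
    define Q where "Q = fun_support \<phi>"
    have Q: "compact Q" "fun_support \<phi> \<subseteq> Q"
      using that by (auto simp: Q_def test_compact)
    have "fun_support (\<lambda>x. c * \<phi> x) \<subseteq> Q"
      by (rule fun_supportI) (auto simp: Q_def fun_support_zero fun_support_closed)
    then show ?thesis using Ffin(2)[OF Q(1)]
      by (simp add: eq[OF _ Q(1)] Q that test_cmult sum_distrib_left)
        (intro sum.cong refl distributions_linear(2)[OF vd]; auto intro: test_translate that)
  qed
  have bound: "\<exists>C N. \<forall>\<phi>\<in>test_functions. fun_support \<phi> \<subseteq> Q \<longrightarrow> norm (lattice_series v \<phi>) \<le> C * seminorm 0 N \<phi>"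
    if Q: "compact Q" for Q
  proof -
    have "\<exists>C N. \<forall>\<phi>\<in>test_functions. fun_support \<phi> \<subseteq> (\<lambda>x. x - \<gamma>) ` Q \<longrightarrow> norm (v \<gamma> \<phi>) \<le> C * seminorm 0 N \<phi>"
      if "\<gamma> \<in> int_lattice" for \<gamma>
    proof -
      have "compact ((\<lambda>x. x - \<gamma>) ` Q)" using Q by (intro compact_continuous_image continuous_intros)
      then show ?thesis using vd[OF that] unfolding distributions_def by blast
    qed
    then obtain C N where CN: "\<And>\<gamma> \<phi>. \<gamma> \<in> int_lattice \<Longrightarrow> \<phi> \<in> test_functions \<Longrightarrow>
        fun_support \<phi> \<subseteq> (\<lambda>x. x - \<gamma>) ` Q \<Longrightarrow> norm (v \<gamma> \<phi>) \<le> C \<gamma> * seminorm 0 (N \<gamma>) \<phi>" by metis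
    define M where "M = (\<Sum>\<gamma>\<in>F Q. N \<gamma>)"
    have NM: "N \<gamma> \<le> M" if "\<gamma> \<in> F Q" for \<gamma>
      unfolding M_def using that Ffin[OF Q] by (intro member_le_sum) auto
    have "norm (lattice_series v \<phi>) \<le> (\<Sum>\<gamma>\<in>F Q. \<bar>C \<gamma>\<bar>) * seminorm 0 M \<phi>"
      if \<phi>: "\<phi> \<in> test_functions" "fun_support \<phi> \<subseteq> Q" for \<phi>
    proof -
      have "norm (lattice_series v \<phi>) \<le> (\<Sum>\<gamma>\<in>F Q. norm (v \<gamma> (\<lambda>x. \<phi> (x + \<gamma>))))"
        unfolding eq[OF \<phi>(1) Q \<phi>(2)] by (rule norm_sum)
      also have "\<dots> \<le> (\<Sum>\<gamma>\<in>F Q. \<bar>C \<gamma>\<bar> * seminorm 0 M \<phi>)"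
      proof (rule sum_mono)
        fix \<gamma> assume \<gamma>: "\<gamma> \<in> F Q"
        have s0: "0 \<le> seminorm 0 (N \<gamma>) \<phi>"
          by (rule order_trans[OF _ seminorm_ge[OF test_schwartz[OF \<phi>(1)], of "[]" _ 0]]) simp_all
        have "fun_support (\<lambda>x. \<phi> (x + \<gamma>)) \<subseteq> (\<lambda>x. x - \<gamma>) ` Q"
        proof
          fix x assume "x \<in> fun_support (\<lambda>x. \<phi> (x + \<gamma>))"
          then have "x + \<gamma> \<in> Q" using fun_support_translate[of \<phi> \<gamma>] \<phi>(2) by blast
          then show "x \<in> (\<lambda>x. x - \<gamma>) ` Q" by (rule rev_image_eqI) simp
        qed
        then have "norm (v \<gamma> (\<lambda>x. \<phi> (x + \<gamma>))) \<le> C \<gamma> * seminorm 0 (N \<gamma>) (\<lambda>x. \<phi> (x + \<gamma>))"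
          using \<gamma> Ffin(2)[OF Q] by (intro CN test_translate \<phi>) auto
        also have "\<dots> = C \<gamma> * seminorm 0 (N \<gamma>) \<phi>" by (simp add: seminorm_translate test_smooth \<phi>)
        also have "\<dots> \<le> \<bar>C \<gamma>\<bar> * seminorm 0 (N \<gamma>) \<phi>" using s0 by (intro mult_right_mono) auto
        also have "\<dots> \<le> \<bar>C \<gamma>\<bar> * seminorm 0 M \<phi>"
          by (intro mult_left_mono seminorm_mono test_schwartz \<phi> NM \<gamma>) simp
        finally show "norm (v \<gamma> (\<lambda>x. \<phi> (x + \<gamma>))) \<le> \<bar>C \<gamma>\<bar> * seminorm 0 M \<phi>" .
      qed
      finally show ?thesis by (simp add: sum_distrib_right)
    qed
    then show ?thesis by blast
  qed
  show ?thesis unfolding distributions_def linear_functional_on_def using add mul bound by blast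
qed

lemma sum_squares_ennreal:
  assumes "\<And>i. i \<in> F \<Longrightarrow> 0 \<le> a i" "\<And>i. i \<in> F \<Longrightarrow> f i = ennreal (a i)"
  shows "(\<Sum>i\<in>F. (f i)\<^sup>2) = ennreal (\<Sum>i\<in>F. (a i)\<^sup>2)"
proof -
  have "(\<Sum>i\<in>F. (f i)\<^sup>2) = (\<Sum>i\<in>F. ennreal ((a i)\<^sup>2))"
    by (intro sum.cong refl) (simp add: assms ennreal_power)
  also have "\<dots> = ennreal (\<Sum>i\<in>F. (a i)\<^sup>2)" by (rule sum_ennreal) simp
  finally show ?thesis .
qed

section \<open>The two norm estimates\<close>

lemma compact_fattened: "compact (K :: (real^'n) set) \<Longrightarrow> compact {x + e | x e. x \<in> K \<and> e \<in> cball 0 r}"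
  by (intro compact_sums compact_cball)

lemma fattened_mem: "k \<in> K \<Longrightarrow> norm e \<le> r \<Longrightarrow> k + e \<in> {x + e | x e. x \<in> K \<and> e \<in> cball 0 r}"
  unfolding mem_Collect_eq by (rule exI[of _ k], rule exI[of _ e]) simp

text \<open>For any small \<open>y\<close>, each \<open>v \<gamma> (\<phi> (\<cdot> + \<gamma>))\<close> is unchanged when its argument is multiplied by a cut-off
function translated by \<open>y\<close>. With the \<open>y\<close> given by the inequality for lattice translates, duality and
the Cauchy--Schwarz inequality finish the estimate.\<close>

lemma upper_estimate:
  fixes b :: "'n::finite \<Rightarrow> 'j::finite" and K :: "(real^'n) set"
  assumes K: "compact K"
  obtains C where "C \<ge> 0"
    "\<And>v M. (\<And>\<gamma>. \<gamma> \<in> int_lattice \<Longrightarrow> v \<gamma> \<in> H_space b s \<inter> distributions_in K) \<Longrightarrow> M \<ge> 0 \<Longrightarrow>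
      (\<And>F. finite F \<Longrightarrow> F \<subseteq> int_lattice \<Longrightarrow> (\<Sum>\<gamma>\<in>F. (H_norm b s (v \<gamma>))\<^sup>2) \<le> ennreal (M\<^sup>2)) \<Longrightarrow>
      lattice_series v \<in> H_space b s \<and> H_norm b s (lattice_series v) \<le> ennreal (C * M)"
proof -
  define r :: real where "r = 1 / 2"
  have r: "r > 0" "r \<le> 1 / 2" by (auto simp: r_def)
  define K' where "K' = {x + e | x e. x \<in> K \<and> e \<in> cball 0 r}"
  have K': "compact K'" unfolding K'_def by (rule compact_fattened[OF K])
  obtain \<eta> :: "real^'n \<Rightarrow> real" and V where e: "(\<lambda>x. complex_of_real (\<eta> x)) \<in> test_functions"
    "open V" "K' \<subseteq> V" "\<And>x. x \<in> V \<Longrightarrow> \<eta> x = 1"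
    by (rule cutoff_exists[OF K' open_UNIV subset_UNIV]) blast
  let ?h = "\<lambda>x. complex_of_real (\<eta> x)"
  obtain C where C: "C \<ge> 0"
    "\<And>F \<phi>. finite F \<Longrightarrow> F \<subseteq> int_lattice \<Longrightarrow> \<phi> \<in> schwartz \<Longrightarrow>
      \<exists>y\<in>ball 0 r. (\<Sum>\<gamma>\<in>F. (bessel_norm b (- s) (\<lambda>x. ?h (x + y) * \<phi> (x + \<gamma>)))\<^sup>2) \<le> C * (bessel_norm b (- s) \<phi>)\<^sup>2"
    by (rule localise_translates[OF test_schwartz[OF e(1)] r, where b=b and s="- s"]) blast
  have "lattice_series v \<in> H_space b s \<and> H_norm b s (lattice_series v) \<le> ennreal (sqrt C * M)"
    if v: "\<And>\<gamma>. \<gamma> \<in> int_lattice \<Longrightarrow> v \<gamma> \<in> H_space b s \<inter> distributions_in K" and M: "M \<ge> 0"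
      "\<And>F. finite F \<Longrightarrow> F \<subseteq> int_lattice \<Longrightarrow> (\<Sum>\<gamma>\<in>F. (H_norm b s (v \<gamma>))\<^sup>2) \<le> ennreal (M\<^sup>2)"
    for v :: "real^'n \<Rightarrow> 'n functional" and M
  proof -
    have "\<exists>a\<ge>0. H_norm b s (v \<gamma>) = ennreal a \<and> (\<forall>\<psi>\<in>test_functions. norm (v \<gamma> \<psi>) \<le> a * bessel_norm b (- s) \<psi>)"
      if "\<gamma> \<in> int_lattice" for \<gamma>
      by (rule H_norm_bound[of "v \<gamma>" b s]) (use v[OF that] in auto)
    then obtain a where a: "\<And>\<gamma>. \<gamma> \<in> int_lattice \<Longrightarrow> a \<gamma> \<ge> 0" "\<And>\<gamma>. \<gamma> \<in> int_lattice \<Longrightarrow> H_norm b s (v \<gamma>) = ennreal (a \<gamma>)"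
      "\<And>\<gamma> \<psi>. \<gamma> \<in> int_lattice \<Longrightarrow> \<psi> \<in> test_functions \<Longrightarrow> norm (v \<gamma> \<psi>) \<le> a \<gamma> * bessel_norm b (- s) \<psi>" by metis
    have vK: "v \<gamma> \<in> distributions_in K" if "\<gamma> \<in> int_lattice" for \<gamma> using v[OF that] by simp
    have dist: "lattice_series v \<in> distributions" by (rule lattice_series_distribution[OF K vK])
    have "norm (lattice_series v \<phi>) \<le> (sqrt C * M) * bessel_norm b (- s) \<phi>" if \<phi>: "\<phi> \<in> test_functions" for \<phi>
    proof -
      define F where "F = {\<gamma> \<in> int_lattice. \<exists>x\<in>K. x + \<gamma> \<in> fun_support \<phi>}"
      have F: "finite F" "F \<subseteq> int_lattice"
        using finite_lattice_meeting[OF compact_imp_bounded[OF K] compact_imp_bounded[OF test_compact[OF \<phi>]]]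
        by (auto simp: F_def)
      obtain y where y: "y \<in> ball 0 r"
        "(\<Sum>\<gamma>\<in>F. (bessel_norm b (- s) (\<lambda>x. ?h (x + y) * \<phi> (x + \<gamma>)))\<^sup>2) \<le> C * (bessel_norm b (- s) \<phi>)\<^sup>2"
        using C(2)[OF F test_schwartz[OF \<phi>]] by blast
      have S: "(\<Sum>\<gamma>\<in>F. (a \<gamma>)\<^sup>2) \<le> M\<^sup>2"
      proof -
        have "ennreal (\<Sum>\<gamma>\<in>F. (a \<gamma>)\<^sup>2) = (\<Sum>\<gamma>\<in>F. (H_norm b s (v \<gamma>))\<^sup>2)"
          by (rule sum_squares_ennreal[symmetric]) (use F(2) a in auto)
        also have "\<dots> \<le> ennreal (M\<^sup>2)" by (rule M(2)[OF F])
        finally show ?thesis by (simp add: ennreal_le_iff)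
      qed
      have cut: "v \<gamma> (\<lambda>x. \<phi> (x + \<gamma>)) = v \<gamma> (\<lambda>x. ?h (x + y) * \<phi> (x + \<gamma>))" if \<gamma>: "\<gamma> \<in> int_lattice" for \<gamma>
      proof (rule cut_off_near_support[OF vK[OF \<gamma>], of "\<lambda>x. ?h (x + y)" "(\<lambda>x. x + y) -` V", symmetric])
        show "open ((\<lambda>x. x + y) -` V)" by (intro continuous_open_vimage e) (auto intro!: continuous_intros)
        show "K \<subseteq> (\<lambda>x. x + y) -` V"
        proof
          fix x assume "x \<in> K"
          then have "x + y \<in> K'" using y(1) unfolding K'_def by (intro fattened_mem) auto
          then show "x \<in> (\<lambda>x. x + y) -` V" using e(3) by auto
        qed
      qed (use e \<phi> in \<open>auto intro: test_translate\<close>)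
      have tD: "(\<lambda>x. ?h (x + y) * \<phi> (x + \<gamma>)) \<in> test_functions" for \<gamma>
        by (intro test_mult_right test_translate[OF e(1)] test_smooth test_translate[OF \<phi>])
      have "lattice_series v \<phi> = (\<Sum>\<gamma>\<in>F. v \<gamma> (\<lambda>x. \<phi> (x + \<gamma>)))"
        by (rule lattice_series_finite[OF vK \<phi> F]) (auto simp: F_def)
      also have "\<dots> = (\<Sum>\<gamma>\<in>F. v \<gamma> (\<lambda>x. ?h (x + y) * \<phi> (x + \<gamma>)))"
        using F(2) by (intro sum.cong refl cut) auto
      finally have "norm (lattice_series v \<phi>) \<le> (\<Sum>\<gamma>\<in>F. norm (v \<gamma> (\<lambda>x. ?h (x + y) * \<phi> (x + \<gamma>))))"
        by (simp only: norm_sum)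
      also have "\<dots> \<le> (\<Sum>\<gamma>\<in>F. a \<gamma> * bessel_norm b (- s) (\<lambda>x. ?h (x + y) * \<phi> (x + \<gamma>)))"
        using F(2) by (intro sum_mono a tD) auto
      also have "\<dots> \<le> M * (sqrt C * bessel_norm b (- s) \<phi>)"
        by (rule sum_mult_le_sqrt[OF S]) (use y(2) C(1) M(1) in \<open>auto simp: power_mult_distrib\<close>)
      finally show ?thesis by (simp add: mult_ac)
    qed
    then show ?thesis
      using H_norm_leI[OF dist, of "sqrt C * M" b s] C(1) M(1) by simp
  qed
  then show thesis using that[of "sqrt C"] C(1) by simp
qed

text \<open>Choose \<open>\<psi> \<gamma>\<close> of norm at most \<open>a \<gamma> = \<parallel>v \<gamma>\<parallel>\<close> with \<open>v \<gamma> (\<psi> \<gamma>) = (a \<gamma>)\<^sup>2 / 2\<close>, which is possible because half of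
the norm is not an admissible bound. Cut \<open>\<psi> \<gamma>\<close> off near \<open>K\<close>, translate by \<open>\<gamma>\<close> and add up to \<open>\<Phi>\<close>.
As a small neighbourhood of \<open>K\<close> meets no other lattice translate of \<open>K\<close>, the series takes the value
\<open>\<Sum>\<^sub>\<gamma> (a \<gamma>)\<^sup>2 / 2\<close> at \<open>\<Phi>\<close>, while the norm of \<open>\<Phi>\<close> is bounded by a multiple of \<open>(\<Sum>\<^sub>\<gamma> (a \<gamma>)\<^sup>2)\<^sup>1\<^sup>/\<^sup>2\<close>.\<close>

lemma lower_estimate:
  fixes b :: "'n::finite \<Rightarrow> 'j::finite" and K :: "(real^'n) set"
  assumes K: "compact K" and sep: "{x - y | x y. x \<in> K \<and> y \<in> K} \<inter> int_lattice = {0}"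
  obtains C where "C \<ge> 0"
    "\<And>v A F. (\<And>\<gamma>. \<gamma> \<in> int_lattice \<Longrightarrow> v \<gamma> \<in> H_space b s \<inter> distributions_in K) \<Longrightarrow>
      lattice_series v \<in> H_space b s \<Longrightarrow> A \<ge> 0 \<Longrightarrow> H_norm b s (lattice_series v) = ennreal A \<Longrightarrow>
      finite F \<Longrightarrow> F \<subseteq> int_lattice \<Longrightarrow> (\<Sum>\<gamma>\<in>F. (H_norm b s (v \<gamma>))\<^sup>2) \<le> ennreal ((C * A)\<^sup>2)"
proof -
  have "closed (int_lattice - ball (0::real^'n) 1)" by (intro closed_Diff closed_int_lattice open_ball)
  moreover have "int_lattice - ball (0::real^'n) 1 = int_lattice - {0}"
    using int_lattice_norm_ge_1 by force
  ultimately have cl: "closed (int_lattice - {0 :: real^'n})" by simp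
  have "{x - y | x y. x \<in> K \<and> y \<in> K} \<inter> (int_lattice - {0}) = {}" using sep by blast
  then obtain d where d: "d > 0" "\<And>z \<gamma>. z \<in> {x - y | x y. x \<in> K \<and> y \<in> K} \<Longrightarrow> \<gamma> \<in> int_lattice - {0} \<Longrightarrow> d \<le> dist z \<gamma>"
    using separate_compact_closed[OF compact_differences[OF K K] cl] by blast
  \<comment> \<open>The cut functions live within distance \<open>3 r\<close> of \<open>K\<close>, so \<open>3 r < d\<close> keeps them away from its other lattice translates.\<close>
  define r where "r = min (d / 4) (1 / 2)"
  have r: "r > 0" "r \<le> 1 / 2" "3 * r < d" using d by (auto simp: r_def)
  define T where "T q = {x + e | x e. x \<in> K \<and> e \<in> cball 0 q}" for q
  have T: "compact (T q)" for q unfolding T_def by (rule compact_fattened[OF K])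
  have Tadd: "x + y \<in> T (q + r)" if xT: "x \<in> T q" and y: "norm y \<le> r" for x y q
  proof -
    obtain k e where "x = k + e" "k \<in> K" "norm e \<le> q" using xT by (auto simp: T_def)
    moreover from this have "norm (e + y) \<le> q + r" using y norm_triangle_ineq[of e y] by linarith
    ultimately have "x + y = k + (e + y) \<and> k \<in> K \<and> e + y \<in> cball 0 (q + r)" by (simp add: add.assoc)
    then show ?thesis unfolding T_def by blast
  qed
  define U where "U = (\<Union>x\<in>K. ball x (2 * r))"
  have "open U" by (auto simp: U_def)
  have UT: "U \<subseteq> T (2 * r)"
  proof
    fix x assume "x \<in> U"
    then obtain k where "k \<in> K" "norm (x - k) < 2 * r" by (auto simp: U_def dist_norm norm_minus_commute)
    then show "x \<in> T (2 * r)" unfolding T_def using fattened_mem[of k K "x - k" "2 * r"] by simp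
  qed
  have TU: "T r \<subseteq> U" using r(1) unfolding T_def U_def by (auto simp: dist_norm intro!: bexI)
  obtain \<eta> :: "real^'n \<Rightarrow> real" and V where e: "(\<lambda>x. complex_of_real (\<eta> x)) \<in> test_functions"
    "fun_support (\<lambda>x. complex_of_real (\<eta> x)) \<subseteq> U" "open V" "T r \<subseteq> V" "\<And>x. x \<in> V \<Longrightarrow> \<eta> x = 1"
    by (rule cutoff_exists[OF T \<open>open U\<close> TU]) blast
  \<comment> \<open>Equal to \<open>1\<close> on all shifts by less than \<open>r\<close> of the set that carries the cut functions.\<close>
  obtain \<eta>' :: "real^'n \<Rightarrow> real" and V' where e': "(\<lambda>x. complex_of_real (\<eta>' x)) \<in> test_functions"
    "open V'" "T (4 * r) \<subseteq> V'" "\<And>x. x \<in> V' \<Longrightarrow> \<eta>' x = 1"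
    by (rule cutoff_exists[OF T open_UNIV subset_UNIV, of "4 * r"]) blast
  let ?h = "\<lambda>x. complex_of_real (\<eta> x)"
  obtain C1 where C1: "C1 \<ge> 0"
    "\<And>(F :: (real^'n) set) \<psi>. finite F \<Longrightarrow> (\<And>\<gamma>. \<gamma> \<in> F \<Longrightarrow> \<psi> \<gamma> \<in> schwartz) \<Longrightarrow>
      \<exists>y\<in>ball 0 r. (\<Sum>\<gamma>\<in>F. (bessel_norm b (- s) (\<lambda>x. ?h (x + y) * \<psi> \<gamma> x))\<^sup>2) \<le> C1 * (\<Sum>\<gamma>\<in>F. (bessel_norm b (- s) (\<psi> \<gamma>))\<^sup>2)"
    by (rule localise_family[OF test_schwartz[OF e(1)] r(1), where b=b and s="- s"]) blast
  obtain C2 where C2: "C2 \<ge> 0"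
    "\<And>F f. finite F \<Longrightarrow> F \<subseteq> int_lattice \<Longrightarrow> (\<And>\<gamma>. \<gamma> \<in> F \<Longrightarrow> f \<gamma> \<in> schwartz) \<Longrightarrow>
      (\<And>\<gamma> x y. \<gamma> \<in> F \<Longrightarrow> y \<in> ball 0 r \<Longrightarrow> of_real (\<eta>' (x + y)) * f \<gamma> x = f \<gamma> x) \<Longrightarrow>
      (bessel_norm b (- s) (\<lambda>x. \<Sum>\<gamma>\<in>F. f \<gamma> (x - \<gamma>)))\<^sup>2 \<le> C2 * (\<Sum>\<gamma>\<in>F. (bessel_norm b (- s) (f \<gamma>))\<^sup>2)"
    by (rule superpose_translates[OF test_schwartz[OF e'(1)] r(1,2), where b=b and s="- s"]) blast
  define C where "C = 2 * sqrt (C2 * C1)"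
  have "(\<Sum>\<gamma>\<in>F. (H_norm b s (v \<gamma>))\<^sup>2) \<le> ennreal ((C * A)\<^sup>2)"
    if v: "\<And>\<gamma>. \<gamma> \<in> int_lattice \<Longrightarrow> v \<gamma> \<in> H_space b s \<inter> distributions_in K"
      and u: "lattice_series v \<in> H_space b s" and A: "A \<ge> 0" "H_norm b s (lattice_series v) = ennreal A"
      and F: "finite F" "F \<subseteq> int_lattice"
    for v :: "real^'n \<Rightarrow> 'n functional" and A F
  proof -
    have vK: "v \<gamma> \<in> distributions_in K" if "\<gamma> \<in> int_lattice" for \<gamma> using v[OF that] by simp
    have vd: "v \<gamma> \<in> distributions" if "\<gamma> \<in> int_lattice" for \<gamma> using vK[OF that] by (simp add: distributions_in_def)
    have ud: "lattice_series v \<in> distributions" by (rule lattice_series_distribution[OF K vK])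
    have uA: "norm (lattice_series v \<psi>) \<le> A * bessel_norm b (- s) \<psi>" if "\<psi> \<in> test_functions" for \<psi>
    proof -
      obtain A' where "A' \<ge> 0" "H_norm b s (lattice_series v) = ennreal A'"
        "\<And>\<psi>. \<psi> \<in> test_functions \<Longrightarrow> norm (lattice_series v \<psi>) \<le> A' * bessel_norm b (- s) \<psi>"
        using H_norm_bound[OF u] by blast
      then show ?thesis using A that by simp
    qed
    have ex: "\<exists>a \<psi>. a \<ge> 0 \<and> H_norm b s (v \<gamma>) = ennreal a \<and> \<psi> \<in> test_functions \<and> bessel_norm b (- s) \<psi> \<le> a \<and>
        v \<gamma> \<psi> = of_real (a\<^sup>2 / 2)" if \<gamma>: "\<gamma> \<in> int_lattice" for \<gamma>
    proof -
      obtain a where a: "a \<ge> 0" "H_norm b s (v \<gamma>) = ennreal a"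
        "\<And>\<psi>. \<psi> \<in> test_functions \<Longrightarrow> norm (v \<gamma> \<psi>) \<le> a * bessel_norm b (- s) \<psi>"
        by (rule H_norm_bound[of "v \<gamma>" b s]) (use v[OF \<gamma>] in auto)
      show ?thesis
      proof (cases "a = 0")
        case True
        have "bessel_norm b (- s) (\<lambda>x::real^'n. 0) = 0" using bessel_norm_cmult[of b "- s" 0 "\<lambda>x. 0"] by simp
        then show ?thesis using a(1,2) True test_zero distribution_zero[OF vd[OF \<gamma>]]
          by (intro exI[of _ 0] exI[of _ "\<lambda>x. 0"]) simp
      next
        case False
        then have a0: "a > 0" using a by simp
        have "\<not> (\<forall>\<psi>\<in>test_functions. norm (v \<gamma> \<psi>) \<le> (a / 2) * bessel_norm b (- s) \<psi>)"
        proof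
          assume "\<forall>\<psi>\<in>test_functions. norm (v \<gamma> \<psi>) \<le> (a / 2) * bessel_norm b (- s) \<psi>"
          then have "H_norm b s (v \<gamma>) \<le> ennreal (a / 2)" using a0 by (intro H_norm_leI vd \<gamma>) auto
          then show False using a0 by (simp add: a(2))
        qed
        then obtain \<psi> where \<psi>: "\<psi> \<in> test_functions" "norm (v \<gamma> \<psi>) > (a / 2) * bessel_norm b (- s) \<psi>" by (auto simp: not_le)
        then have n0: "norm (v \<gamma> \<psi>) > 0" using a0 bessel_norm_nonneg[of b "- s" \<psi>] by (smt (verit) mult_nonneg_nonneg divide_nonneg_nonneg)
        define c where "c = of_real (a\<^sup>2 / 2) / v \<gamma> \<psi>"
        have "v \<gamma> (\<lambda>x. c * \<psi> x) = of_real (a\<^sup>2 / 2)"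
          unfolding distributions_linear(2)[OF vd[OF \<gamma>] \<psi>(1)] using n0 by (simp add: c_def)
        moreover have "bessel_norm b (- s) (\<lambda>x. c * \<psi> x) \<le> a"
        proof -
          have "norm c = (a\<^sup>2 / 2) / norm (v \<gamma> \<psi>)" unfolding c_def norm_divide norm_of_real by simp
          then have "bessel_norm b (- s) (\<lambda>x. c * \<psi> x) = a * ((a / 2) * bessel_norm b (- s) \<psi>) / norm (v \<gamma> \<psi>)"
            by (simp add: bessel_norm_cmult power2_eq_square)
          also have "\<dots> \<le> a * norm (v \<gamma> \<psi>) / norm (v \<gamma> \<psi>)"
            using \<psi>(2) a0 by (intro divide_right_mono mult_left_mono) auto
          finally show ?thesis using n0 by simp
        qed
        ultimately show ?thesis using a(1,2) test_cmult[OF \<psi>(1)] by blast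
      qed
    qed
    then obtain a \<psi> where a: "\<And>\<gamma>. \<gamma> \<in> int_lattice \<Longrightarrow> a \<gamma> \<ge> 0" "\<And>\<gamma>. \<gamma> \<in> int_lattice \<Longrightarrow> H_norm b s (v \<gamma>) = ennreal (a \<gamma>)"
      "\<And>\<gamma>. \<gamma> \<in> int_lattice \<Longrightarrow> \<psi> \<gamma> \<in> test_functions" "\<And>\<gamma>. \<gamma> \<in> int_lattice \<Longrightarrow> bessel_norm b (- s) (\<psi> \<gamma>) \<le> a \<gamma>"
      "\<And>\<gamma>. \<gamma> \<in> int_lattice \<Longrightarrow> v \<gamma> (\<psi> \<gamma>) = of_real ((a \<gamma>)\<^sup>2 / 2)" by metis
    obtain y where y: "y \<in> ball 0 r"
      "(\<Sum>\<gamma>\<in>F. (bessel_norm b (- s) (\<lambda>x. ?h (x + y) * \<psi> \<gamma> x))\<^sup>2) \<le> C1 * (\<Sum>\<gamma>\<in>F. (bessel_norm b (- s) (\<psi> \<gamma>))\<^sup>2)"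
      using C1(2)[of F \<psi>] F a(3) test_schwartz by blast
    have ny: "norm y \<le> r" "norm (- y) \<le> r" using y(1) by auto
    define f where "f \<gamma> x = ?h (x + y) * \<psi> \<gamma> x" for \<gamma> x
    have fD: "f \<gamma> \<in> test_functions" if "\<gamma> \<in> int_lattice" for \<gamma>
      unfolding f_def by (intro test_mult_right test_translate[OF e(1)] test_smooth a that)
    have fsupp: "x \<in> T (3 * r)" if "x \<in> fun_support (f \<gamma>)" for x \<gamma>
    proof -
      have "x \<in> fun_support (\<lambda>x. ?h (x + y))" using that
        by (rule subsetD[OF fun_support_mult_left[of "\<lambda>x. ?h (x + y)" "\<psi> \<gamma>", folded f_def], rotated])
      then have "x + y \<in> T (2 * r)" using fun_support_translate[of ?h y] e(2) UT by blast
      from Tadd[OF this ny(2)] show ?thesis by simp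
    qed
    have f_id: "of_real (\<eta>' (x + z)) * f \<gamma> x = f \<gamma> x" if "z \<in> ball 0 r" for \<gamma> x z
    proof (cases "x \<in> fun_support (f \<gamma>)")
      case True
      have "x + z \<in> T (3 * r + r)" using fsupp[OF True] that by (intro Tadd) auto
      then have "x + z \<in> V'" using e'(3) by auto
      then show ?thesis using e'(4) by simp
    qed (simp add: fun_support_zero)
    have vf: "v \<gamma> (f \<gamma>) = of_real ((a \<gamma>)\<^sup>2 / 2)" if \<gamma>: "\<gamma> \<in> int_lattice" for \<gamma>
    proof -
      have "v \<gamma> (f \<gamma>) = v \<gamma> (\<psi> \<gamma>)"
        unfolding f_def
      proof (rule cut_off_near_support[OF vK[OF \<gamma>], of _ "(\<lambda>x. x + y) -` V"])
        show "open ((\<lambda>x. x + y) -` V)" by (intro continuous_open_vimage e) (auto intro!: continuous_intros)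
        show "K \<subseteq> (\<lambda>x. x + y) -` V"
        proof
          fix x assume "x \<in> K"
          then have "x + y \<in> T r" using ny(1) unfolding T_def by (intro fattened_mem)
          then show "x \<in> (\<lambda>x. x + y) -` V" using e(4) by auto
        qed
      qed (use e a \<gamma> in \<open>auto intro: test_translate\<close>)
      then show ?thesis using a(5)[OF \<gamma>] by simp
    qed
    have ftD: "(\<lambda>x. f \<gamma> (x - \<gamma>)) \<in> test_functions" if "\<gamma> \<in> int_lattice" for \<gamma>
      using test_translate[OF fD[OF that], of "- \<gamma>"] by simp
    have uf: "lattice_series v (\<lambda>x. f \<gamma> (x - \<gamma>)) = of_real ((a \<gamma>)\<^sup>2 / 2)" if \<gamma>: "\<gamma> \<in> int_lattice" for \<gamma>
    proof -
      have "lattice_series v (\<lambda>x. f \<gamma> (x - \<gamma>)) = (\<Sum>\<gamma>'\<in>{\<gamma>}. v \<gamma>' (\<lambda>x. f \<gamma> (x + \<gamma>' - \<gamma>)))"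
      proof (rule lattice_series_finite[OF vK ftD[OF \<gamma>]])
        fix \<gamma>' x assume \<gamma>': "\<gamma>' \<in> int_lattice - {\<gamma>}" and x: "x \<in> K"
        show "x + \<gamma>' \<notin> fun_support (\<lambda>x. f \<gamma> (x - \<gamma>))"
        proof
          assume "x + \<gamma>' \<in> fun_support (\<lambda>x. f \<gamma> (x - \<gamma>))"
          then have "x + \<gamma>' - \<gamma> \<in> fun_support (f \<gamma>)" using fun_support_translate[of "f \<gamma>" "- \<gamma>"] by auto
          from fsupp[OF this] obtain k w where k: "k \<in> K" "norm w \<le> 3 * r" "x + \<gamma>' - \<gamma> = k + w"
            unfolding T_def by auto
          have "\<gamma> - \<gamma>' \<in> int_lattice - {0}" using \<gamma> \<gamma>' by (auto intro: int_lattice_diff)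
          then have "d \<le> dist (x - k) (\<gamma> - \<gamma>')" using x k(1) by (intro d(2)) auto
          moreover have "(x - k) - (\<gamma> - \<gamma>') = w" using k(3) by (simp add: algebra_simps)
          ultimately show False using k(2) r(3) by (simp add: dist_norm)
        qed
      qed (use \<gamma> in auto)
      then show ?thesis using vf[OF \<gamma>] by simp
    qed
    define \<Phi> where "\<Phi> x = (\<Sum>\<gamma>\<in>F. f \<gamma> (x - \<gamma>))" for x
    define S where "S = (\<Sum>\<gamma>\<in>F. (a \<gamma>)\<^sup>2)"
    have S0: "S \<ge> 0" by (simp add: S_def sum_nonneg)
    have FL: "\<gamma> \<in> int_lattice" if "\<gamma> \<in> F" for \<gamma> using F(2) that by blast
    have \<Phi>D: "\<Phi> \<in> test_functions" unfolding \<Phi>_def by (intro test_sum ftD FL)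
    have "lattice_series v \<Phi> = (\<Sum>\<gamma>\<in>F. lattice_series v (\<lambda>x. f \<gamma> (x - \<gamma>)))"
      unfolding \<Phi>_def by (rule distribution_sum[OF ud]) (intro ftD FL)
    also have "\<dots> = (\<Sum>\<gamma>\<in>F. of_real ((a \<gamma>)\<^sup>2 / 2))" by (intro sum.cong refl uf FL)
    also have "\<dots> = of_real (S / 2)" by (simp add: S_def sum_divide_distrib)
    finally have u\<Phi>: "lattice_series v \<Phi> = of_real (S / 2)" .
    have "S / 2 \<le> A * bessel_norm b (- s) \<Phi>" using uA[OF \<Phi>D] S0 unfolding u\<Phi> norm_of_real by simp
    moreover have "bessel_norm b (- s) \<Phi> \<le> sqrt (C2 * C1) * sqrt S"
    proof (rule power2_le_imp_le)
      have "(bessel_norm b (- s) \<Phi>)\<^sup>2 \<le> C2 * (\<Sum>\<gamma>\<in>F. (bessel_norm b (- s) (f \<gamma>))\<^sup>2)"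
        unfolding \<Phi>_def[abs_def] by (intro C2(2) F test_schwartz fD FL f_id)
      also have "\<dots> \<le> C2 * (C1 * (\<Sum>\<gamma>\<in>F. (bessel_norm b (- s) (\<psi> \<gamma>))\<^sup>2))"
        using y(2) C2(1) unfolding f_def[abs_def] by (rule mult_left_mono)
      also have "\<dots> \<le> C2 * (C1 * S)"
        unfolding S_def using C1(1) C2(1) a(4) FL by (intro mult_left_mono sum_mono power_mono) auto
      finally show "(bessel_norm b (- s) \<Phi>)\<^sup>2 \<le> (sqrt (C2 * C1) * sqrt S)\<^sup>2"
        unfolding power_mult_distrib using C1(1) C2(1) S0 by (simp add: mult.assoc)
    qed (use C1(1) C2(1) S0 in simp)
    ultimately have "S / 2 \<le> A * (sqrt (C2 * C1) * sqrt S)"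
      using A(1) by (meson mult_left_mono order_trans)
    then have le: "sqrt S * sqrt S \<le> (C * A) * sqrt S" using S0 by (simp add: C_def mult_ac)
    have "sqrt S \<le> C * A"
    proof (cases "S = 0")
      case True
      then show ?thesis using A(1) C1(1) C2(1) by (simp add: C_def)
    next
      case False
      then have "sqrt S > 0" using S0 by simp
      with le show ?thesis by (rule mult_right_le_imp_le)
    qed
    then have "S \<le> (C * A)\<^sup>2" using S0 by (metis real_sqrt_ge_zero power_mono real_sqrt_pow2)
    moreover have "(\<Sum>\<gamma>\<in>F. (H_norm b s (v \<gamma>))\<^sup>2) = ennreal S"
      unfolding S_def by (rule sum_squares_ennreal) (use FL a in auto)
    ultimately show ?thesis by (simp add: ennreal_leI)
  qed
  moreover have "C \<ge> 0" using C1(1) C2(1) by (simp add: C_def)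
  ultimately show thesis using that by blast
qed

lemma infsum_ennreal_SUP:
  fixes f :: "'a \<Rightarrow> ennreal"
  shows "infsum f A = (SUP F\<in>{F. finite F \<and> F \<subseteq> A}. sum f F)"
  by (rule nonneg_infsum_complete) simp

lemma ennreal_sqrt_ennreal: "x \<ge> 0 \<Longrightarrow> ennreal_sqrt (ennreal (x\<^sup>2)) = ennreal x"
  by (simp add: ennreal_sqrt_def)

theorem lemma2p3:
  fixes b :: "'n::finite \<Rightarrow> 'j::finite"
    and s :: "real^'j"
    and K :: "(real^'n) set"
  assumes "surj b"
    and "compact K"
    and "{x - y | x y. x \<in> K \<and> y \<in> K} \<inter> int_lattice = {0}"
  shows "(\<forall>v :: real^'n \<Rightarrow> 'n functional.
            (\<forall>\<gamma>\<in>int_lattice. v \<gamma> \<in> H_space b s \<inter> distributions_in K) \<longrightarrow>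
            lattice_series v \<in> distributions \<and>
            (lattice_series v \<in> H_space b s \<longleftrightarrow>
             (\<Sum>\<^sub>\<infinity>\<gamma>\<in>int_lattice. (H_norm b s (v \<gamma>))\<^sup>2) < \<infinity>)) \<and>
         (\<exists>C::real. C \<ge> 1 \<and>
            (\<forall>v :: real^'n \<Rightarrow> 'n functional.
              (\<forall>\<gamma>\<in>int_lattice. v \<gamma> \<in> H_space b s \<inter> distributions_in K) \<longrightarrow>
              ennreal (inverse C) * H_norm b s (lattice_series v)
                \<le> ennreal_sqrt (\<Sum>\<^sub>\<infinity>\<gamma>\<in>int_lattice. (H_norm b s (v \<gamma>))\<^sup>2) \<and>
              ennreal_sqrt (\<Sum>\<^sub>\<infinity>\<gamma>\<in>int_lattice. (H_norm b s (v \<gamma>))\<^sup>2)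
                \<le> ennreal C * H_norm b s (lattice_series v)))"
proof -
  obtain C1 where C1: "C1 \<ge> 0"
    "\<And>v M. (\<And>\<gamma>. \<gamma> \<in> int_lattice \<Longrightarrow> v \<gamma> \<in> H_space b s \<inter> distributions_in K) \<Longrightarrow> M \<ge> 0 \<Longrightarrow>
      (\<And>F. finite F \<Longrightarrow> F \<subseteq> int_lattice \<Longrightarrow> (\<Sum>\<gamma>\<in>F. (H_norm b s (v \<gamma>))\<^sup>2) \<le> ennreal (M\<^sup>2)) \<Longrightarrow>
      lattice_series v \<in> H_space b s \<and> H_norm b s (lattice_series v) \<le> ennreal (C1 * M)"
    by (rule upper_estimate[OF assms(2), where b=b and s=s]) blast
  obtain C2 where C2: "C2 \<ge> 0"
    "\<And>v A F. (\<And>\<gamma>. \<gamma> \<in> int_lattice \<Longrightarrow> v \<gamma> \<in> H_space b s \<inter> distributions_in K) \<Longrightarrow>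
      lattice_series v \<in> H_space b s \<Longrightarrow> A \<ge> 0 \<Longrightarrow> H_norm b s (lattice_series v) = ennreal A \<Longrightarrow>
      finite F \<Longrightarrow> F \<subseteq> int_lattice \<Longrightarrow> (\<Sum>\<gamma>\<in>F. (H_norm b s (v \<gamma>))\<^sup>2) \<le> ennreal ((C2 * A)\<^sup>2)"
    by (rule lower_estimate[OF assms(2,3), where b=b and s=s]) blast
  define C where "C = C1 + C2 + 1"
  have C: "C \<ge> 1" "C1 \<le> C" "C2 \<le> C" using C1(1) C2(1) by (auto simp: C_def)
  have main: "lattice_series v \<in> distributions \<and>
      (lattice_series v \<in> H_space b s \<longleftrightarrow> \<Sigma> < \<infinity>) \<and>
      ennreal (inverse C) * H_norm b s (lattice_series v) \<le> ennreal_sqrt \<Sigma> \<and>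
      ennreal_sqrt \<Sigma> \<le> ennreal C * H_norm b s (lattice_series v)"
    if v: "\<forall>\<gamma>\<in>int_lattice. v \<gamma> \<in> H_space b s \<inter> distributions_in K"
      and \<Sigma>: "\<Sigma> = (\<Sum>\<^sub>\<infinity>\<gamma>\<in>int_lattice. (H_norm b s (v \<gamma>))\<^sup>2)" for v :: "real^'n \<Rightarrow> 'n functional" and \<Sigma>
  proof (intro conjI)
    let ?u = "lattice_series v"
    note \<Sigma>_SUP = \<Sigma>[unfolded infsum_ennreal_SUP]
    show "?u \<in> distributions" by (rule lattice_series_distribution[OF assms(2)]) (use v in blast)
    have up: "?u \<in> H_space b s \<and> H_norm b s ?u \<le> ennreal (C * M) \<and> ennreal_sqrt \<Sigma> = ennreal M \<and> M \<ge> 0"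
      if "M = sqrt (enn2real \<Sigma>)" "\<Sigma> < \<infinity>" for M
    proof -
      have M: "M \<ge> 0" "\<Sigma> = ennreal (M\<^sup>2)" using that by (auto simp: ennreal_enn2real_if less_top[symmetric])
      have "(\<Sum>\<gamma>\<in>F. (H_norm b s (v \<gamma>))\<^sup>2) \<le> ennreal (M\<^sup>2)" if "finite F" "F \<subseteq> int_lattice" for F
        unfolding M(2)[symmetric] \<Sigma>_SUP by (rule SUP_upper) (use that in simp)
      then have "?u \<in> H_space b s \<and> H_norm b s ?u \<le> ennreal (C1 * M)" using v M(1) by (intro C1(2)) auto
      moreover have "ennreal (C1 * M) \<le> ennreal (C * M)" using C M(1) by (intro ennreal_leI mult_right_mono) auto
      ultimately show ?thesis using M ennreal_sqrt_ennreal[OF M(1)] by auto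
    qed
    have low: "\<Sigma> < \<infinity> \<and> ennreal_sqrt \<Sigma> \<le> ennreal C * H_norm b s ?u" if u: "?u \<in> H_space b s"
    proof -
      obtain A where A: "A \<ge> 0" "H_norm b s ?u = ennreal A" using H_norm_bound[OF u] by metis
      have le: "\<Sigma> \<le> ennreal ((C2 * A)\<^sup>2)"
        unfolding \<Sigma>_SUP by (rule SUP_least) (use v u A in \<open>auto intro!: C2(2)\<close>)
      then have fin: "\<Sigma> < \<infinity>" by (rule le_less_trans) simp
      obtain q where q: "q \<ge> 0" "\<Sigma> = ennreal (q\<^sup>2)"
        using up[OF refl fin] fin by (intro that[of "sqrt (enn2real \<Sigma>)"]) (auto simp: ennreal_enn2real_if less_top[symmetric])
      have "q\<^sup>2 \<le> (C2 * A)\<^sup>2" using le unfolding q(2) by (simp add: ennreal_le_iff)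
      then have "q \<le> C2 * A" by (rule power2_le_imp_le) (use C2(1) A(1) in simp)
      also have "\<dots> \<le> C * A" using C A by (intro mult_right_mono)
      finally have "ennreal_sqrt \<Sigma> \<le> ennreal (C * A)" unfolding q(2) ennreal_sqrt_ennreal[OF q(1)] by (rule ennreal_leI)
      then show ?thesis using fin A C by (simp add: ennreal_mult)
    qed
    show "?u \<in> H_space b s \<longleftrightarrow> \<Sigma> < \<infinity>" using up[OF refl] low by blast
    show "ennreal (inverse C) * H_norm b s ?u \<le> ennreal_sqrt \<Sigma>"
    proof (cases "\<Sigma> < \<infinity>")
      case True
      define M where "M = sqrt (enn2real \<Sigma>)"
      note up = up[OF M_def True]
      have "ennreal (inverse C) * H_norm b s ?u \<le> ennreal (inverse C) * ennreal (C * M)"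
        using up by (intro mult_left_mono) auto
      also have "\<dots> = ennreal (inverse C * (C * M))" using C up by (subst ennreal_mult) auto
      also have "\<dots> = ennreal_sqrt \<Sigma>" using C up by (simp add: mult.assoc[symmetric])
      finally show ?thesis .
    next
      case False
      then show ?thesis by (simp add: ennreal_sqrt_def less_top[symmetric])
    qed
    show "ennreal_sqrt \<Sigma> \<le> ennreal C * H_norm b s ?u"
    proof (cases "?u \<in> H_space b s")
      case False
      then show ?thesis using C by (simp add: H_norm_def ennreal_mult_top)
    qed (use low in blast)
  qed
  show ?thesis
  proof (intro conjI exI[of _ C] allI impI)
    show "C \<ge> 1" by (rule C)
  qed (use main in blast)+
qed

end
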